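(* There exists a function $u:E^N\to\mathbb R$ which is invariant and dominated and satisfies $u=T^-_tu$ for all $t\ge 0$.
   Context: Let $E$ be a finite-dimensional Euclidean space with $\dim E\ge 1$ and norm $\|\cdot\|_E$, let $N\ge 2$, let $m_1,\dots,m_N>0$ be masses and let $\kappa\in(0,1)$. For $v=(v_1,\dots,v_N)\in E^N$ put $|v|^2=\sum_i m_i\|v_i\|_E^2$. The potential is $U_\kappa(x)=\sum_{i<j}m_im_j\|r_i-r_j\|_E^{-2\kappa}\in(0,+\infty]$ for $x=(r_1,\dots,r_N)\in E^N$ (equal to $+\infty$ if $r_i=r_j$ for some $i\ne j$). The action of an absolutely continuous curve $\gamma:[a,b]\to E^N$ is $A(\gamma)=\frac12\int_a^b|\dot\gamma(s)|^2ds+\int_a^bU_\kappa(\gamma(s))\,ds\in(0,+\infty]$. For $T>0$, $\mathcal C(x,y,T)$ is the set of absolutely continuous curves $\gamma:[0,T]\to E^N$ with $\gamma(0)=x$, $\gamma(T)=y$; $\phi(x,y,T)=\inf\{A(\gamma):\gamma\in\mathcal C(x,y,T)\}$; and $\phi(x,y)=\inf_{T>0}\phi(x,y,T)$. A function $u:E^N\to\mathbb R$ is dominated if $u(x)-u(y)\le\phi(x,y)$ for all $x,y\in E^N$. It is invariant if $u(r_1,\dots,r_N)=u(Ar_1+r,\dots,Ar_N+r)$ for all $(r_1,\dots,r_N)\in E^N$, all $r\in E$ and all $A$ in the orthogonal group $O(E)$. The Lax-Oleinik semigroup is defined by $T^-_0u=u$ and, for $t>0$, $T^-_tu(x)=\inf\{u(y)+\phi(x,y,t):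 y\in E^N\}$. *)

theory Defs
  imports "HOL-Analysis.Analysis"
begin

text \<open>
  A configuration is a vector \<open>x :: ('a, 'n) vec\<close> with \<open>'a\<close> the Euclidean space \<open>E\<close> and \<open>'n\<close> a finite
  linearly ordered index type with \<open>N = CARD('n)\<close> elements; \<open>x $ i\<close> is the position of the \<open>i\<close>-th
  body.
\<close>

definition mass_norm_sq :: "('n::finite \<Rightarrow> real) \<Rightarrow> ('a::euclidean_space, 'n) vec \<Rightarrow> real" where
  "mass_norm_sq m v = (\<Sum>i\<in>UNIV. m i * (norm (v $ i))\<^sup>2)"

text \<open>
  The case distinction is needed because \<open>0 powr a = 0\<close> also for negative \<open>a\<close>.
\<close>

definition potential ::
  "('n::{finite,linorder} \<Rightarrow> real) \<Rightarrow> real \<Rightarrow> ('a::euclidean_space, 'n) vec \<Rightarrow> ennreal" where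
  "potential m \<kappa> x =
     (\<Sum>(i, j)\<in>{(i, j). i < j}.
        if x $ i = x $ j then \<infinity>
        else ennreal (m i * m j * norm (x $ i - x $ j) powr (- 2 * \<kappa>)))"

text \<open>
  The notion does not depend on the choice of norm on \<open>('a, 'n) vec\<close>, as all of them are equivalent; the
  ambient one is used rather than the mass norm.
\<close>

definition absolutely_continuous_curve ::
  "real \<Rightarrow> real \<Rightarrow> (real \<Rightarrow> 'b::real_normed_vector) \<Rightarrow> bool" where
  "absolutely_continuous_curve a b \<gamma> \<longleftrightarrow>
     (\<forall>\<epsilon>>0. \<exists>\<delta>>0. \<forall>(n::nat) c d.
        (\<forall>i<n. a \<le> c i \<and> c i \<le> d i \<and> d i \<le> b) \<longrightarrow>
        disjoint_family_on (\<lambda>i. {c i<..<d i}) {..<n} \<longrightarrow>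
        (\<Sum>i<n. d i - c i) < \<delta> \<longrightarrow>
        (\<Sum>i<n. norm (\<gamma> (d i) - \<gamma> (c i))) < \<epsilon>)"

text \<open>
  An absolutely continuous curve is differentiable almost everywhere, so the unspecified value of
  \<open>vector_derivative\<close> at the remaining points is irrelevant for the integral.
\<close>

definition action ::
  "('n::{finite,linorder} \<Rightarrow> real) \<Rightarrow> real \<Rightarrow> real \<Rightarrow> real \<Rightarrow> (real \<Rightarrow> ('a::euclidean_space, 'n) vec) \<Rightarrow> ennreal"
where
  "action m \<kappa> a b \<gamma> =
     (\<integral>\<^sup>+s\<in>{a..b}. ennreal (mass_norm_sq m (vector_derivative \<gamma> (at s within {a..b}))) \<partial>lborel) / 2
     + (\<integral>\<^sup>+s\<in>{a..b}. potential m \<kappa> (\<gamma> s) \<partial>lborel)"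

definition curves :: "'b::real_normed_vector \<Rightarrow> 'b \<Rightarrow> real \<Rightarrow> (real \<Rightarrow> 'b) set" where
  "curves x y T = {\<gamma>. absolutely_continuous_curve 0 T \<gamma> \<and> \<gamma> 0 = x \<and> \<gamma> T = y}"

definition action_potential_time ::
  "('n::{finite,linorder} \<Rightarrow> real) \<Rightarrow> real \<Rightarrow> ('a::euclidean_space, 'n) vec \<Rightarrow> ('a, 'n) vec \<Rightarrow> real \<Rightarrow> ennreal"
where
  "action_potential_time m \<kappa> x y T = (INF \<gamma>\<in>curves x y T. action m \<kappa> 0 T \<gamma>)"

definition action_potential ::
  "('n::{finite,linorder} \<Rightarrow> real) \<Rightarrow> real \<Rightarrow> ('a::euclidean_space, 'n) vec \<Rightarrow> ('a, 'n) vec \<Rightarrow> ennreal"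
where
  "action_potential m \<kappa> x y = (INF T\<in>{0<..}. action_potential_time m \<kappa> x y T)"

definition dominated ::
  "('n::{finite,linorder} \<Rightarrow> real) \<Rightarrow> real \<Rightarrow> (('a::euclidean_space, 'n) vec \<Rightarrow> real) \<Rightarrow> bool" where
  "dominated m \<kappa> u \<longleftrightarrow>
     (\<forall>x y. ereal (u x - u y) \<le> enn2ereal (action_potential m \<kappa> x y))"

text \<open>The elements of \<open>O(E)\<close> are the maps \<open>A\<close> with \<open>orthogonal_transformation A\<close>.\<close>

definition invariant :: "(('a::euclidean_space, 'n::finite) vec \<Rightarrow> real) \<Rightarrow> bool" where
  "invariant u \<longleftrightarrow>
     (\<forall>x r (A :: 'a \<Rightarrow> 'a). orthogonal_transformation A \<longrightarrow> u x = u (\<chi> i. A (x $ i) + r))"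

text \<open>
  The values lie in \<open>ereal\<close> because the infimum may be \<open>-\<infinity>\<close> for arbitrary \<open>u\<close>.
\<close>

definition lax_oleinik ::
  "('n::{finite,linorder} \<Rightarrow> real) \<Rightarrow> real \<Rightarrow> real \<Rightarrow> (('a::euclidean_space, 'n) vec \<Rightarrow> real) \<Rightarrow> ('a, 'n) vec \<Rightarrow> ereal"
where
  "lax_oleinik m \<kappa> t u x =
     (if t = 0 then ereal (u x)
      else (INF y. ereal (u y) + enn2ereal (action_potential_time m \<kappa> x y t)))"

end

theory Submission
  imports Defs
begin

text \<open>The cost \<open>w\<^sub>t x = inf\<^sub>z \<phi>(x, z, t)\<close> of moving for time \<open>t\<close> with free end satisfies \<open>T\<^sup>-\<^sub>s w\<^sub>t = w\<^bsub>t+s\<^esub>\<close>, is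
  dominated, and inherits the symmetries of the action. Dilating time gives \<open>w\<^bsub>t+s\<^esub> \<le> (1 + s/t) w\<^sub>t\<close>, and
  \<open>w\<^sub>t\<close> grows sublinearly in \<open>t\<close> uniformly in \<open>x\<close>; hence \<open>w\<^bsub>t+s\<^esub> - w\<^sub>t\<close> tends to \<open>0\<close>, and the lower limit
  of \<open>w\<^sub>t - w\<^sub>t 0\<close> is the required fixed point. Passing to the limit needs two estimates of
  the action potential: an upper bound, from curves that separate the bodies like a power of time
  and exchange their order only at collisions, and the coercive lower bound \<open>c |x - y|\<^sup>2 / t\<close>. The latter rests on
  the almost everywhere differentiability of absolutely continuous curves, proved by Austin's
  argument with Vitali's covering theorem.\<close>

section \<open>Differentiability almost everywhere\<close>

text \<open>The kinetic energy is computed from \<open>vector_derivative\<close>, which is arbitrary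
  where a curve is not differentiable, whereas absolute continuity is the epsilon-delta notion.
  Bounding the action below by the displacement therefore needs the fundamental theorem of calculus
  for such curves, hence differentiability almost everywhere. The growth of w_t is at most C
  t^\<beta> with \<beta> = (1 - \<kappa>) / (1 + \<kappa>) < 1. This is the rate at which action
  accumulates along motions whose size grows like t^(1 / (1 + \<kappa>)). Domination passes to the
  lower limit at once, being a family of inequalities with constants uniform in t. The hard
  direction of the fixed point equation is the other one: a limit and an infimum are exchanged
  although the minimisers move with t. Coercivity bounds them, and the uniform domination of the w_t
  acts as equicontinuity, so neither minimising curves nor semicontinuity of the action are needed.
  Leaving the end point free makes invariance automatic, as a symmetry merely permutes the end
  points.\<close>

lemma sum_increments_le:
  fixes g :: "real \<Rightarrow> real"
  assumes "finite I" "a \<le> b"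
    and "\<And>i. i \<in> I \<Longrightarrow> a \<le> c i \<and> c i \<le> d i \<and> d i \<le> b"
    and "disjoint_family_on (\<lambda>i. {c i<..<d i}) I"
    and "mono_on {a..b} g"
  shows "(\<Sum>i\<in>I. g (d i) - g (c i)) \<le> g b - g a"
  using assms
proof (induction "card I" arbitrary: I b)
  case 0
  then show ?case by (auto simp: mono_on_def)
next
  case (Suc n)
  note mono = Suc.prems(5)
  show ?case
  \<comment> \<open>A degenerate interval has empty interior, so disjointness does not restrict its
    position. It contributes nothing to the sum and is removed first.\<close>
  proof (cases "\<exists>i\<in>I. c i = d i")
    case True
    then obtain i where i: "i \<in> I" "c i = d i" by auto
    have "(\<Sum>j\<in>I. g (d j) - g (c j)) = (\<Sum>j\<in>I - {i}. g (d j) - g (c j))"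
      using i Suc.prems(1) by (subst sum.remove[of _ i]) auto
    also have "\<dots> \<le> g b - g a"
      using Suc.prems Suc.hyps(2) i
      by (intro Suc.hyps(1)) (auto simp: disjoint_family_on_def)
    finally show ?thesis .
  next
    case False
    have ne: "I \<noteq> {}" using Suc.hyps(2) by auto
    then have "Max (d ` I) \<in> d ` I" using Suc.prems(1) by (intro Max_in) auto
    then obtain i where i: "i \<in> I" "d i = Max (d ` I)" by auto
    \<comment> \<open>The interval with the largest right end lies to the right of all others, since
      otherwise the midpoint below would belong to two of the open intervals.\<close>
    have dle: "d j \<le> c i" if "j \<in> I" "j \<noteq> i" for j
    proof (rule ccontr)
      assume "\<not> d j \<le> c i"
      have lt: "c i < d i" "c j < d j"
        using False i(1) that(1) Suc.prems(3) by (auto simp: less_le)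
      have "d j \<le> d i" using i(2) that(1) Suc.prems(1) by auto
      with \<open>\<not> d j \<le> c i\<close> lt have "(max (c i) (c j) + d j) / 2 \<in> {c i<..<d i} \<inter> {c j<..<d j}"
        by (auto simp: max_def)
      moreover have "{c i<..<d i} \<inter> {c j<..<d j} = {}"
        using Suc.prems(4) i(1) that unfolding disjoint_family_on_def by metis
      ultimately show False by blast
    qed
    have b: "a \<le> c i" "c i \<le> d i" "d i \<le> b" using Suc.prems(3)[OF i(1)] by auto
    have "(\<Sum>j\<in>I - {i}. g (d j) - g (c j)) \<le> g (c i) - g a"
    proof (rule Suc.hyps(1))
      show "n = card (I - {i})" using Suc.hyps(2) Suc.prems(1) i(1) by simp
      show "finite (I - {i})" using Suc.prems(1) by simp
      show "a \<le> c i" by fact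
      show "a \<le> c j \<and> c j \<le> d j \<and> d j \<le> c i" if "j \<in> I - {i}" for j
        using that dle Suc.prems(3) by auto
      show "disjoint_family_on (\<lambda>i. {c i<..<d i}) (I - {i})"
        using Suc.prems(4) by (auto simp: disjoint_family_on_def)
      show "mono_on {a..c i} g"
        using mono b by (auto simp: mono_on_def)
    qed
    moreover have "g (d i) \<le> g b" using mono b by (auto simp: mono_on_def)
    moreover have "(\<Sum>j\<in>I. g (d j) - g (c j)) = g (d i) - g (c i) + (\<Sum>j\<in>I - {i}. g (d j) - g (c j))"
      using i Suc.prems(1) by (subst sum.remove[of _ i]) auto
    ultimately show ?thesis by linarith
  qed
qed

text \<open>By Vitali, disjoint steep intervals cover E up to a null set. Their total length is at
  most 1 / K times the rise of g on them, and monotonicity bounds the sum of these rises by g v - g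
  u.\<close>

lemma steep_set_measure_le:
  fixes g :: "real \<Rightarrow> real"
  assumes E: "E \<in> sets borel" "E \<subseteq> {u..v}" and uv: "u \<le> v"
    and mono: "mono_on {u..v} g" and K: "0 < K"
    and steep: "\<And>x \<delta>. x \<in> E \<Longrightarrow> 0 < \<delta> \<Longrightarrow>
      \<exists>c d. u \<le> c \<and> c \<le> x \<and> x \<le> d \<and> d \<le> v \<and> c < d \<and> d - c < \<delta> \<and> K * (d - c) \<le> g d - g c"
  shows "K * measure lborel E \<le> g v - g u"
proof -
  define J where "J = {(c, d). u \<le> c \<and> d \<le> v \<and> c < d \<and> K * (d - c) \<le> g d - g c}"
  \<comment> \<open>The covering theorem speaks of closed balls, so an interval is recoded by centre
    and radius.\<close>
  define a where "a = (\<lambda>p::real \<times> real. (fst p + snd p) / 2)"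
  define r where "r = (\<lambda>p::real \<times> real. (snd p - fst p) / 2)"
  have cb: "cball (a p) (r p) = {fst p..snd p}" for p
    by (auto simp: a_def r_def cball_eq_atLeastAtMost field_simps)
  obtain C where C: "countable C" "C \<subseteq> J"
     "pairwise (\<lambda>i j. disjnt (cball (a i) (r i)) (cball (a j) (r j))) C"
     "negligible (E - (\<Union>i \<in> C. cball (a i) (r i)))"
  proof (rule Vitali_covering_theorem_cballs[of J r E a])
    show "0 < r p" if "p \<in> J" for p using that by (auto simp: J_def r_def)
    show "\<exists>i. i \<in> J \<and> x \<in> cball (a i) (r i) \<and> r i < \<delta>" if x: "x \<in> E" "0 < \<delta>" for x \<delta>
    proof -
      from steep[OF x] obtain c d where "u \<le> c \<and> c \<le> x \<and> x \<le> d \<and> d \<le> v \<and> c < d \<and> d - c < \<delta> \<and> K * (d - c) \<le> g d - g c"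
        by blast
      then show ?thesis unfolding cb by (intro exI[of _ "(c, d)"]) (auto simp: J_def r_def)
    qed
  qed auto
  let ?B = "(g v - g u) / K"
  have fin: "measure lebesgue (\<Union>i\<in>F. cball (a i) (r i)) \<le> ?B" if F: "F \<subseteq> C" "finite F" for F
  proof -
    have "measure lebesgue (\<Union>i\<in>F. cball (a i) (r i)) \<le> (\<Sum>i\<in>F. measure lebesgue (cball (a i) (r i)))"
      using F by (intro measure_UNION_le) auto
    also have "\<dots> = (\<Sum>i\<in>F. snd i - fst i)"
      using F C(2) unfolding cb by (intro sum.cong) (auto simp: J_def)
    also have "\<dots> \<le> (\<Sum>i\<in>F. (g (snd i) - g (fst i)) / K)"
      using F C(2) K by (intro sum_mono) (auto simp: J_def field_simps)
    also have "\<dots> = (\<Sum>i\<in>F. g (snd i) - g (fst i)) / K"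
      by (simp add: sum_divide_distrib)
    also have "\<dots> \<le> ?B"
    proof (intro divide_right_mono sum_increments_le[where g = g and c = fst and d = snd])
      show "disjoint_family_on (\<lambda>i. {fst i<..<snd i}) F"
        unfolding disjoint_family_on_def
      proof (intro ballI impI)
        fix i j assume ij: "i \<in> F" "j \<in> F" "i \<noteq> j"
        then have "{fst i..snd i} \<inter> {fst j..snd j} = {}"
          using C(3) F(1) unfolding pairwise_def disjnt_def cb by blast
        then show "{fst i<..<snd i} \<inter> {fst j<..<snd j} = {}"
          using greaterThanLessThan_subseteq_atLeastAtMost_iff by (blast dest: less_imp_le)
      qed
    qed (use F C(2) mono K uv in \<open>auto simp: J_def\<close>)
    finally show ?thesis .
  qed
  have Um: "(\<Union>i\<in>C. cball (a i) (r i)) \<in> lmeasurable" "measure lebesgue (\<Union>i\<in>C. cball (a i) (r i)) \<le> ?B"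
    using fin by (auto intro!: fmeasurable_UN_bound[OF C(1)] measure_UN_bound[OF C(1)])
  have Elm: "E \<in> lmeasurable"
    by (rule bounded_set_imp_lmeasurable[OF bounded_subset[OF bounded_closed_interval E(2)]])
      (use E(1) in auto)
  have "measure lebesgue E \<le> measure lebesgue ((\<Union>i\<in>C. cball (a i) (r i)) \<union> (E - (\<Union>i\<in>C. cball (a i) (r i))))"
    using Um(1) Elm by (intro measure_mono_fmeasurable) (auto intro!: fmeasurable.Un)
  also have "\<dots> = measure lebesgue (\<Union>i\<in>C. cball (a i) (r i))"
    using Um(1) C(4) by (intro measure_Un_null_set) (auto simp: negligible_iff_null_sets)
  finally have "measure lborel E \<le> ?B" using Um(2) E(1) by simp
  then have "K * measure lborel E \<le> K * ?B" using K by (intro mult_left_mono) auto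
  then show ?thesis using K by simp
qed

section \<open>Variation along finite partitions and Austin's lemma\<close>

fun variation :: "(real \<Rightarrow> real) \<Rightarrow> real list \<Rightarrow> real" where
  "variation f (x # y # xs) = \<bar>f y - f x\<bar> + variation f (y # xs)"
| "variation f [x] = 0"
| "variation f [] = 0"

lemma variation_Cons_ge: "variation f xs \<le> variation f (x # xs)"
  by (cases xs) auto

lemma variation_append_ge: "variation f xs + variation f ys \<le> variation f (xs @ ys)"
proof (induction f xs rule: variation.induct)
  case (2 f x)
  then show ?case using variation_Cons_ge by simp
qed auto

text \<open>Austin's argument: on an interval of a near-optimal partition where \<open>f\<close> increases, inserting
  short intervals of negative slope would increase the variation by twice their length.\<close>

lemma variation_add_oscillation_le:
  fixes f V :: "real \<Rightarrow> real"
  assumes E: "E \<in> sets borel"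
    and neg: "\<And>x \<delta>. x \<in> E \<Longrightarrow> 0 < \<delta> \<Longrightarrow>
      \<exists>c d. c \<le> x \<and> x \<le> d \<and> c < d \<and> d - c < \<delta> \<and> f d - f c \<le> - (d - c)"
    and pos: "\<And>x \<delta>. x \<in> E \<Longrightarrow> 0 < \<delta> \<Longrightarrow>
      \<exists>c d. c \<le> x \<and> x \<le> d \<and> c < d \<and> d - c < \<delta> \<and> d - c \<le> f d - f c"
    and V: "\<And>c d. a \<le> c \<Longrightarrow> c \<le> d \<Longrightarrow> d \<le> b \<Longrightarrow> \<bar>f d - f c\<bar> \<le> V d - V c"
    and xs: "sorted (x # xs)" "set (x # xs) \<subseteq> {a..b}"
  shows "variation f (x # xs) + 2 * measure lborel (E \<inter> {x<..<last (x # xs)})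
    \<le> V (last (x # xs)) - V x"
  using xs
proof (induction xs arbitrary: x)
  case Nil
  then show ?case by simp
next
  case (Cons y xs)
  let ?z = "last (y # xs)"
  have xy: "a \<le> x" "x \<le> y" "y \<le> b" using Cons.prems by auto
  have IH: "variation f (y # xs) + 2 * measure lborel (E \<inter> {y<..<?z}) \<le> V ?z - V y"
    using Cons by auto
  have key: "\<bar>f y - f x\<bar> + 2 * measure lborel (E \<inter> {x<..<y}) \<le> V y - V x"
  proof -
    \<comment> \<open>The sign turns the net change of \<open>f\<close> on \<open>{x..y}\<close>
      into an increase. Then \<open>V t - s * f t\<close> is monotone with total rise
      \<open>V y - V x - \<bar>f y - f x\<bar>\<close>. Where \<open>s * f\<close> falls with slope
      at most -1, both \<open>V\<close> and \<open>- s * f\<close> rise with slope at least 1; hence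
      the factor 2.\<close>
    define s :: real where "s = (if f x \<le> f y then 1 else -1)"
    have "2 * measure lborel (E \<inter> {x<..<y}) \<le> (V y - s * f y) - (V x - s * f x)"
    proof (rule steep_set_measure_le[where g = "\<lambda>t. V t - s * f t"])
      show "mono_on {x..y} (\<lambda>t. V t - s * f t)"
      proof (rule mono_onI)
        fix c d assume cd: "c \<in> {x..y}" "d \<in> {x..y}" "c \<le> d"
        show "V c - s * f c \<le> V d - s * f d"
          using V[of c d] cd xy by (auto simp: s_def)
      qed
    next
      fix t \<delta> assume t: "t \<in> E \<inter> {x<..<y}" "0 < (\<delta>::real)"
      \<comment> \<open>Intervals around \<open>t\<close> that are shorter than
        \<open>\<eta>\<close> stay inside \<open>{x..y}\<close>.\<close>
      define \<eta> where "\<eta> = min \<delta> (min (t - x) (y - t))"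
      have \<eta>: "\<eta> > 0" "\<eta> \<le> \<delta>" "\<eta> \<le> t - x" "\<eta> \<le> y - t" using t by (auto simp: \<eta>_def)
      have "\<exists>c d. c \<le> t \<and> t \<le> d \<and> c < d \<and> d - c < \<eta> \<and> s * (f d - f c) \<le> - (d - c)"
      proof (cases "f x \<le> f y")
        case True then show ?thesis using neg[of t \<eta>] t \<eta> by (auto simp: s_def)
      next
        case False
        from pos[of t \<eta>] t \<eta> obtain c d where "c \<le> t \<and> t \<le> d \<and> c < d \<and> d - c < \<eta> \<and> d - c \<le> f d - f c"
          by auto
        then show ?thesis using False by (intro exI[of _ c] exI[of _ d]) (auto simp: s_def)
      qed
      then obtain c d where cd: "c \<le> t" "t \<le> d" "c < d" "d - c < \<eta>" "s * (f d - f c) \<le> - (d - c)"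
        by auto
      have "x \<le> c" "d \<le> y" using cd \<eta> by auto
      moreover have "2 * (d - c) \<le> (V d - s * f d) - (V c - s * f c)"
        using V[of c d] cd(3,5) xy \<open>x \<le> c\<close> \<open>d \<le> y\<close> by (auto simp: s_def algebra_simps split: if_splits)
      ultimately show "\<exists>c d. x \<le> c \<and> c \<le> t \<and> t \<le> d \<and> d \<le> y \<and> c < d \<and> d - c < \<delta> \<and>
          2 * (d - c) \<le> (V d - s * f d) - (V c - s * f c)"
        using cd \<eta>(2) by (intro exI[of _ c] exI[of _ d]) auto
    qed (use E xy in auto)
    then show ?thesis by (auto simp: s_def split: if_splits)
  qed
  \<comment> \<open>Between the two open intervals only the partition point \<open>y\<close> is
    lost, a null set.\<close>
  have "measure lborel (E \<inter> {x<..<?z}) \<le> measure lborel ((E \<inter> {x<..<y}) \<union> {y} \<union> (E \<inter> {y<..<?z}))"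
  proof (rule measure_mono_fmeasurable)
    have "{u<..<v} \<inter> E \<in> fmeasurable lborel" for u v :: real
      by (rule fmeasurable_Int_fmeasurable) (cases "u \<le> v"; use E in \<open>auto intro!: fmeasurableI\<close>)+
    from this[of x y] this[of y ?z] show "E \<inter> {x<..<y} \<union> {y} \<union> E \<inter> {y<..<?z} \<in> fmeasurable lborel"
      by (intro fmeasurable.Un) (auto simp: Int_commute intro!: fmeasurableI)
  qed (use E in auto)
  also have "\<dots> \<le> measure lborel ((E \<inter> {x<..<y}) \<union> {y}) + measure lborel (E \<inter> {y<..<?z})"
    using E by (intro measure_Un_le) auto
  also have "measure lborel ((E \<inter> {x<..<y}) \<union> {y}) \<le> measure lborel (E \<inter> {x<..<y}) + measure lborel {y}"
    using E by (intro measure_Un_le) auto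
  finally have "measure lborel (E \<inter> {x<..<?z}) \<le> measure lborel (E \<inter> {x<..<y}) + measure lborel (E \<inter> {y<..<?z})"
    by simp
  then show ?case using IH key by simp
qed

definition bounded_variation_on :: "real \<Rightarrow> real \<Rightarrow> (real \<Rightarrow> real) \<Rightarrow> bool" where
  "bounded_variation_on a b f \<longleftrightarrow> (\<exists>M. \<forall>xs. sorted xs \<longrightarrow> set xs \<subseteq> {a..b} \<longrightarrow> variation f xs \<le> M)"

definition total_variation :: "real \<Rightarrow> (real \<Rightarrow> real) \<Rightarrow> real \<Rightarrow> real" where
  "total_variation a f x = (SUP xs\<in>{xs. sorted xs \<and> set xs \<subseteq> {a..x}}. variation f xs)"

lemma variation_le_total_variation:
  assumes "bounded_variation_on a b f" "x \<le> b" "sorted xs" "set xs \<subseteq> {a..x}"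
  shows "variation f xs \<le> total_variation a f x"
  unfolding total_variation_def
proof (rule cSUP_upper)
  from assms(1) obtain M where M: "\<And>xs. sorted xs \<Longrightarrow> set xs \<subseteq> {a..b} \<Longrightarrow> variation f xs \<le> M"
    by (auto simp: bounded_variation_on_def)
  show "bdd_above (variation f ` {xs. sorted xs \<and> set xs \<subseteq> {a..x}})"
    using assms(2) by (intro bdd_aboveI[of _ M]) (force intro!: M)
qed (use assms in auto)

lemma total_variation_increment:
  assumes bv: "bounded_variation_on a b f" and cd: "a \<le> c" "c \<le> d" "d \<le> b"
  shows "\<bar>f d - f c\<bar> \<le> total_variation a f d - total_variation a f c"
proof -
  have "total_variation a f c \<le> total_variation a f d - \<bar>f d - f c\<bar>"
    unfolding total_variation_def[of a f c]
  proof (rule cSUP_least)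
    fix xs assume "xs \<in> {xs. sorted xs \<and> set xs \<subseteq> {a..c}}"
    then have xs: "sorted xs" "set xs \<subseteq> {a..c}" by auto
    have "variation f xs + variation f [c, d] \<le> variation f (xs @ [c, d])"
      by (rule variation_append_ge)
    also have "\<dots> \<le> total_variation a f d"
      using xs cd by (intro variation_le_total_variation[OF bv]) (fastforce simp: sorted_append)+
    finally show "variation f xs \<le> total_variation a f d - \<bar>f d - f c\<bar>" by simp
  qed (auto intro!: exI[of _ "[]"])
  then show ?thesis by simp
qed

text \<open>A partition within \<epsilon> of the total variation leaves a gap of at most \<epsilon>,
  whereas \<open>variation_add_oscillation_le\<close> fits twice the measure of E into that
  gap.\<close>

lemma oscillation_null:
  fixes f :: "real \<Rightarrow> real"
  assumes bv: "bounded_variation_on a b f" and ab: "a < b"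
    and E: "E \<in> sets borel" "E \<subseteq> {a<..<b}"
    and neg: "\<And>x \<delta>. x \<in> E \<Longrightarrow> 0 < \<delta> \<Longrightarrow>
      \<exists>c d. c \<le> x \<and> x \<le> d \<and> c < d \<and> d - c < \<delta> \<and> f d - f c \<le> - (d - c)"
    and pos: "\<And>x \<delta>. x \<in> E \<Longrightarrow> 0 < \<delta> \<Longrightarrow>
      \<exists>c d. c \<le> x \<and> x \<le> d \<and> c < d \<and> d - c < \<delta> \<and> d - c \<le> f d - f c"
  shows "measure lborel E = 0"
proof -
  let ?V = "total_variation a f"
  have "2 * measure lborel E \<le> \<epsilon>" if "\<epsilon> > 0" for \<epsilon>
  proof -
    have "\<exists>y\<in>variation f ` {xs. sorted xs \<and> set xs \<subseteq> {a..b}}. ?V b - \<epsilon> < y"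
    proof (rule ccontr)
      assume "\<not> ?thesis"
      then have "Sup (variation f ` {xs. sorted xs \<and> set xs \<subseteq> {a..b}}) \<le> ?V b - \<epsilon>"
        by (intro cSUP_least) (auto simp: not_less intro!: exI[of _ "[]"])
      then show False using that by (simp add: total_variation_def)
    qed
    then obtain xs where xs: "sorted xs" "set xs \<subseteq> {a..b}" "?V b - \<epsilon> < variation f xs" by auto
    \<comment> \<open>Adding both end points makes the partition span \<open>{a..b}\<close> without
      lowering its variation.\<close>
    have "variation f xs + variation f [b] \<le> variation f (xs @ [b])" by (rule variation_append_ge)
    also have "\<dots> \<le> variation f (a # xs @ [b])" by (rule variation_Cons_ge)
    finally have 1: "variation f xs \<le> variation f (a # xs @ [b])" by simp
    have "variation f (a # xs @ [b]) + 2 * measure lborel (E \<inter> {a<..<last (a # xs @ [b])})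
        \<le> ?V (last (a # xs @ [b])) - ?V a"
      using xs ab
      by (intro variation_add_oscillation_le[OF E(1) neg pos total_variation_increment[OF bv]])
         (auto simp: sorted_append)
    moreover have "E \<inter> {a<..<b} = E" using E by auto
    moreover have "0 \<le> ?V a"
      using variation_le_total_variation[OF bv, of a "[]"] ab by simp
    ultimately show ?thesis using 1 xs(3) by simp
  qed
  \<comment> \<open>Choosing \<epsilon> to be the measure of E itself excludes a positive
    value.\<close>
  from this[of "measure lborel E"] measure_nonneg[of lborel E] show ?thesis
    by linarith
qed

lemma variation_eq_sum:
  "variation f xs = (\<Sum>i<length xs - 1. \<bar>f (xs ! Suc i) - f (xs ! i)\<bar>)"
proof (induction f xs rule: variation.induct)
  case (1 f x y xs)
  then show ?case
    by (simp add: sum.lessThan_Suc_shift del: sum.lessThan_Suc)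
qed auto

lemma disjoint_sorted_gaps:
  fixes xs :: "real list"
  assumes "sorted xs"
  shows "disjoint_family_on (\<lambda>i. {xs ! i<..<xs ! Suc i}) {..<length xs - 1}"
  unfolding disjoint_family_on_def
proof (intro ballI impI)
  fix i j assume ij: "i \<in> {..<length xs - 1}" "j \<in> {..<length xs - 1}" "i \<noteq> j"
  have "xs ! Suc i \<le> xs ! j" if "i < j" "j < length xs - 1" for i j
    using that assms by (intro sorted_nth_mono) auto
  from this[of i j] this[of j i] ij show "{xs ! i<..<xs ! Suc i} \<inter> {xs ! j<..<xs ! Suc j} = {}"
    by (cases "i < j") auto
qed

lemma sum_gaps_le:
  fixes xs :: "real list"
  assumes "sorted xs" "set xs \<subseteq> {a..b}" "a \<le> b"
  shows "(\<Sum>i<length xs - 1. xs ! Suc i - xs ! i) \<le> b - a"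
proof (rule sum_increments_le[where g = "\<lambda>x. x" and c = "\<lambda>i. xs ! i" and d = "\<lambda>i. xs ! Suc i"])
  fix i assume "i \<in> {..<length xs - 1}"
  then have "i < length xs" "Suc i < length xs" by auto
  then show "a \<le> xs ! i \<and> xs ! i \<le> xs ! Suc i \<and> xs ! Suc i \<le> b"
    using assms(1,2) nth_mem[of i xs] nth_mem[of "Suc i" xs] sorted_nth_mono[of xs i "Suc i"]
    by (auto simp: subset_iff)
qed (use assms disjoint_sorted_gaps in \<open>auto simp: mono_on_def\<close>)

lemma variation_affine_le:
  "variation (\<lambda>x. \<alpha> * f x + \<beta> * x) xs \<le> \<bar>\<alpha>\<bar> * variation f xs + \<bar>\<beta>\<bar> * variation (\<lambda>x. x) xs"
proof (induction f xs rule: variation.induct)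
  case (1 f x y xs)
  have "\<bar>\<alpha> * f y + \<beta> * y - (\<alpha> * f x + \<beta> * x)\<bar> = \<bar>\<alpha> * (f y - f x) + \<beta> * (y - x)\<bar>"
    by (simp add: algebra_simps)
  also have "\<dots> \<le> \<bar>\<alpha>\<bar> * \<bar>f y - f x\<bar> + \<bar>\<beta>\<bar> * \<bar>y - x\<bar>"
    by (metis abs_mult abs_triangle_ineq)
  finally show ?case using 1 by (simp add: algebra_simps)
qed auto

lemma bounded_variation_on_affine:
  assumes "bounded_variation_on a b f" "a \<le> b"
  shows "bounded_variation_on a b (\<lambda>x. \<alpha> * f x + \<beta> * x)"
proof -
  from assms(1) obtain M where M: "\<And>xs. sorted xs \<Longrightarrow> set xs \<subseteq> {a..b} \<Longrightarrow> variation f xs \<le> M"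
    by (auto simp: bounded_variation_on_def)
  show ?thesis unfolding bounded_variation_on_def
  proof (intro exI allI impI)
    fix xs :: "real list" assume xs: "sorted xs" "set xs \<subseteq> {a..b}"
    have "variation (\<lambda>x. x) xs = (\<Sum>i<length xs - 1. xs ! Suc i - xs ! i)"
      unfolding variation_eq_sum using xs(1)
      by (intro sum.cong refl abs_of_nonneg) (simp add: sorted_nth_mono)
    also have "\<dots> \<le> b - a" by (rule sum_gaps_le[OF xs assms(2)])
    finally have "\<bar>\<beta>\<bar> * variation (\<lambda>x. x) xs \<le> \<bar>\<beta>\<bar> * (b - a)" by (intro mult_left_mono) auto
    moreover have "\<bar>\<alpha>\<bar> * variation f xs \<le> \<bar>\<alpha>\<bar> * M" using M[OF xs] by (intro mult_left_mono) auto
    ultimately show "variation (\<lambda>x. \<alpha> * f x + \<beta> * x) xs \<le> \<bar>\<alpha>\<bar> * M + \<bar>\<beta>\<bar> * (b - a)"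
      using variation_affine_le[of \<alpha> f \<beta> xs] by linarith
  qed
qed

text \<open>The points where difference quotients exceed q for arbitrarily small steps of either
  sign. Countably many step bounds and strict inequalities make this a countable intersection of
  open sets when f is continuous, which settles measurability.\<close>

definition steep :: "(real \<Rightarrow> real) \<Rightarrow> real \<Rightarrow> real set" where
  "steep f q = {x. \<forall>n::nat. \<exists>h. h \<noteq> 0 \<and> \<bar>h\<bar> < inverse (Suc n) \<and> q < (f (x + h) - f x) / h}"

lemma steep_borel:
  assumes "continuous_on UNIV f"
  shows "steep f q \<in> sets borel"
proof -
  have "steep f q = (\<Inter>n::nat. \<Union>h\<in>{h. h \<noteq> 0 \<and> \<bar>h\<bar> < inverse (Suc n)}. {x. q < (f (x + h) - f x) / h})"
    by (auto simp: steep_def)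
  moreover have "open (\<Union>h\<in>{h. h \<noteq> 0 \<and> \<bar>h\<bar> < inverse (Suc n)}. {x. q < (f (x + h) - f x) / h})" for n :: nat
    by (intro open_UN ballI open_Collect_less continuous_intros
        continuous_on_compose2[OF assms]) auto
  ultimately show ?thesis by auto
qed

lemma steepD:
  assumes "x \<in> steep f q" "0 < \<delta>"
  shows "\<exists>c d. c \<le> x \<and> x \<le> d \<and> c < d \<and> d - c < \<delta> \<and> q * (d - c) \<le> f d - f c"
proof -
  obtain n :: nat where n: "inverse (Suc n) < \<delta>"
    using reals_Archimedean[OF assms(2)] by auto
  from assms(1) obtain h where h: "h \<noteq> 0" "\<bar>h\<bar> < inverse (Suc n)" "q < (f (x + h) - f x) / h"
    unfolding steep_def by blast
  have h\<delta>: "\<bar>h\<bar> < \<delta>" using h(2) n by linarith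
  show ?thesis
  proof (cases "h > 0")
    case True
    with h have "q * h \<le> f (x + h) - f x" by (auto simp: field_simps)
    then show ?thesis using h\<delta> True
      by (intro exI[of _ x] exI[of _ "x + h"]) auto
  next
    case False
    with h have "q * (- h) \<le> f x - f (x + h)" by (auto simp: field_simps)
    then show ?thesis using h\<delta> h(1) False
      by (intro exI[of _ "x + h"] exI[of _ x]) auto
  qed
qed

lemma frequently_steep:
  assumes "\<exists>\<^sub>F h in at 0. q < (f (x + h) - f x) / h"
  shows "x \<in> steep f q"
  unfolding steep_def
proof (intro CollectI allI)
  fix n :: nat
  have "\<forall>\<^sub>F h in at (0::real). h \<noteq> 0 \<and> \<bar>h\<bar> < inverse (Suc n)"
    unfolding eventually_at by (intro exI[of _ "inverse (Suc n)"]) (auto simp: dist_real_def)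
  then have "\<exists>\<^sub>F h in at 0. h \<noteq> 0 \<and> \<bar>h\<bar> < inverse (Suc n) \<and> q < (f (x + h) - f x) / h"
    by (intro frequently_rev_mp[OF assms]) (auto elim: eventually_mono)
  then show "\<exists>h. h \<noteq> 0 \<and> \<bar>h\<bar> < inverse (Suc n) \<and> q < (f (x + h) - f x) / h"
    by (rule frequently_ex)
qed

text \<open>If the lower limit were below the upper one, two rationals would fit strictly between
  them. Rational thresholds matter because each pair will cost one exceptional null set. Boundedness
  excludes infinite limits.\<close>

lemma tendsto_real_if_no_oscillation:
  fixes Q :: "'a \<Rightarrow> real"
  assumes F: "F \<noteq> bot" and bdd: "\<forall>\<^sub>F x in F. \<bar>Q x\<bar> \<le> K"
    and osc: "\<And>p q :: rat. p < q \<Longrightarrow>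
      \<not> ((\<exists>\<^sub>F x in F. Q x < of_rat p) \<and> (\<exists>\<^sub>F x in F. of_rat q < Q x))"
  shows "\<exists>L. (Q \<longlongrightarrow> L) F"
proof -
  let ?l = "Liminf F (\<lambda>x. ereal (Q x))" and ?u = "Limsup F (\<lambda>x. ereal (Q x))"
  have "?u \<le> ?l"
  proof (rule ccontr)
    assume "\<not> ?u \<le> ?l"
    then obtain p where p: "?l < ereal (of_rat p)" "ereal (of_rat p) < ?u"
      using ereal_dense3[of ?l ?u] by (auto simp: not_le)
    obtain q where q: "ereal (of_rat p) < ereal (of_rat q)" "ereal (of_rat q) < ?u"
      using ereal_dense3[OF p(2)] by auto
    have "\<exists>\<^sub>F x in F. Q x < of_rat p"
    proof (rule ccontr)
      assume "\<not> ?thesis"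
      then have "\<forall>\<^sub>F x in F. ereal (of_rat p) \<le> ereal (Q x)"
        by (auto simp: not_frequently not_less elim: eventually_mono)
      then have "ereal (of_rat p) \<le> ?l" by (rule Liminf_bounded)
      then show False using p(1) by simp
    qed
    moreover have "\<exists>\<^sub>F x in F. of_rat q < Q x"
    proof (rule ccontr)
      assume "\<not> ?thesis"
      then have "\<forall>\<^sub>F x in F. ereal (Q x) \<le> ereal (of_rat q)"
        by (auto simp: not_frequently not_less elim: eventually_mono)
      then have "?u \<le> ereal (of_rat q)" by (rule Limsup_bounded)
      then show False using q(2) by simp
    qed
    ultimately show False using osc[of p q] q(1) by (simp add: of_rat_less)
  qed
  then have eq: "?l = ?u" by (intro antisym Liminf_le_Limsup[OF F])
  have "ereal (- K) \<le> ?l" by (rule Liminf_bounded) (use bdd in \<open>auto elim!: eventually_mono\<close>)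
  moreover have "?u \<le> ereal K" by (rule Limsup_bounded) (use bdd in \<open>auto elim!: eventually_mono\<close>)
  ultimately obtain L where "?u = ereal L" unfolding eq by (cases ?u) auto
  then have "((\<lambda>x. ereal (Q x)) \<longlongrightarrow> ereal L) F"
    unfolding tendsto_iff_Liminf_eq_Limsup[OF F] using eq by simp
  then show ?thesis by (auto simp: lim_ereal)
qed

lemma AE_not_in_of_measure_zero:
  fixes E :: "real set"
  assumes "E \<in> sets borel" "E \<subseteq> {a..b}" "measure lborel E = 0"
  shows "AE x in lborel. x \<notin> E"
proof -
  have "E \<in> fmeasurable lborel"
  proof (rule fmeasurableI2)
    show "{a..b} \<in> fmeasurable lborel" by (simp add: fmeasurable_compact)
  qed (use assms in auto)
  then have "emeasure lborel E = 0" using assms(3) by (simp add: emeasure_eq_measure2)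
  then show ?thesis using assms(1) by (intro AE_not_in) (auto simp: null_sets_def)
qed

text \<open>Two kinds of points are discarded. Where difference quotients oscillate across a
  rational gap p < q, \<open>oscillation_null\<close> applies. Where they are unbounded, the total
  variation is steeper than every n, so the measure is at most its total rise divided by n. At all
  other points the quotients converge.\<close>

lemma bounded_variation_imp_differentiable_AE:
  fixes f :: "real \<Rightarrow> real"
  assumes cont: "continuous_on UNIV f" and bv: "bounded_variation_on a b f" and ab: "a < b"
  shows "AE x in lborel. x \<in> {a<..<b} \<longrightarrow> f differentiable (at x)"
proof -
  have cont': "continuous_on UNIV (\<lambda>x. - f x)" by (intro continuous_intros cont)
  have osc: "AE x in lborel. x \<notin> steep f q \<inter> steep (\<lambda>x. - f x) (- p) \<inter> {a<..<b}" if "p < q" for p q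
  proof (rule AE_not_in_of_measure_zero[of _ a b])
    \<comment> \<open>With \<open>r\<close> the midpoint and \<open>k\<close> half the length of the
      gap, \<open>g\<close> is (f - r x) / k, so slopes q and p of \<open>f\<close> become slopes 1
      and -1 of \<open>g\<close>, the form required by \<open>oscillation_null\<close>.\<close>
    define r where "r = (p + q) / 2"
    define k where "k = (q - p) / 2"
    have k: "k > 0" "r + k = q" "r - k = p" using that by (auto simp: r_def k_def field_simps)
    define g where "g = (\<lambda>x. inverse k * f x + (- r / k) * x)"
    have g: "g d - g c = (f d - f c - r * (d - c)) / k" for c d
      using k by (simp add: g_def field_simps)
    show "steep f q \<inter> steep (\<lambda>x. - f x) (- p) \<inter> {a<..<b} \<in> sets borel"
      using steep_borel[OF cont] steep_borel[OF cont'] by auto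
    note E = this
    show "measure lborel (steep f q \<inter> steep (\<lambda>x. - f x) (- p) \<inter> {a<..<b}) = 0"
    proof (rule oscillation_null[where f = g and a = a and b = b])
      show "bounded_variation_on a b g" unfolding g_def
        using bv ab by (intro bounded_variation_on_affine) auto
    next
      fix x \<delta> assume x: "x \<in> steep f q \<inter> steep (\<lambda>x. - f x) (- p) \<inter> {a<..<b}" "0 < (\<delta>::real)"
      from steepD[of x "\<lambda>x. - f x" "- p" \<delta>] x obtain c d
        where cd: "c \<le> x" "x \<le> d" "c < d" "d - c < \<delta>" "- p * (d - c) \<le> - f d - - f c" by auto
      then have "f d - f c - r * (d - c) \<le> - k * (d - c)" by (simp add: k(3)[symmetric] algebra_simps)
      then have "g d - g c \<le> - (d - c)" unfolding g using k(1) by (simp add: field_simps)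
      with cd show "\<exists>c d. c \<le> x \<and> x \<le> d \<and> c < d \<and> d - c < \<delta> \<and> g d - g c \<le> - (d - c)" by blast
      from steepD[of x f q \<delta>] x obtain c d
        where cd: "c \<le> x" "x \<le> d" "c < d" "d - c < \<delta>" "q * (d - c) \<le> f d - f c" by auto
      then have "k * (d - c) \<le> f d - f c - r * (d - c)" by (simp add: k(2)[symmetric] algebra_simps)
      then have "d - c \<le> g d - g c" unfolding g using k(1) by (simp add: field_simps)
      with cd show "\<exists>c d. c \<le> x \<and> x \<le> d \<and> c < d \<and> d - c < \<delta> \<and> d - c \<le> g d - g c" by blast
    qed (use E ab in auto)
  qed auto
  \<comment> \<open>The points at which absolute difference quotients are unbounded as the step
    tends to 0; the sign may vary with n.\<close>
  define B where "B = (\<Inter>n::nat. steep f (Suc n) \<union> steep (\<lambda>x. - f x) (Suc n)) \<inter> {a<..<b}"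
  have Bb: "B \<in> sets borel" unfolding B_def
    using steep_borel[OF cont] steep_borel[OF cont'] by (intro sets.Int sets.countable_INT'') auto
  have unb: "AE x in lborel. x \<notin> B"
  proof (rule AE_not_in_of_measure_zero[OF Bb, of a b])
    let ?V = "total_variation a f"
    have "Suc n * measure lborel B \<le> ?V b - ?V a" for n :: nat
    proof (rule steep_set_measure_le[OF Bb, where g = ?V])
      show "mono_on {a..b} ?V"
      proof (rule mono_onI)
        fix c d assume "c \<in> {a..b}" "d \<in> {a..b}" "c \<le> d"
        then show "?V c \<le> ?V d" using total_variation_increment[OF bv, of c d] by auto
      qed
    next
      fix x \<delta> assume x: "x \<in> B" "0 < (\<delta>::real)"
      define \<eta> where "\<eta> = min \<delta> (min (x - a) (b - x))"
      have \<eta>: "\<eta> > 0" "\<eta> \<le> \<delta>" "\<eta> \<le> x - a" "\<eta> \<le> b - x" using x by (auto simp: \<eta>_def B_def)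
      from x have "x \<in> steep f (Suc n) \<or> x \<in> steep (\<lambda>x. - f x) (Suc n)" by (auto simp: B_def)
      then have "\<exists>c d. c \<le> x \<and> x \<le> d \<and> c < d \<and> d - c < \<eta> \<and> real (Suc n) * (d - c) \<le> \<bar>f d - f c\<bar>"
      proof
        assume "x \<in> steep f (Suc n)"
        from steepD[OF this \<eta>(1)] obtain c d
          where "c \<le> x \<and> x \<le> d \<and> c < d \<and> d - c < \<eta> \<and> real (Suc n) * (d - c) \<le> f d - f c" by blast
        then show ?thesis by (intro exI[of _ c] exI[of _ d]) linarith
      next
        assume "x \<in> steep (\<lambda>x. - f x) (Suc n)"
        from steepD[OF this \<eta>(1)] obtain c d
          where "c \<le> x \<and> x \<le> d \<and> c < d \<and> d - c < \<eta> \<and> real (Suc n) * (d - c) \<le> - f d - - f c" by blast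
        then show ?thesis by (intro exI[of _ c] exI[of _ d]) linarith
      qed
      then obtain c d :: real where cd: "c \<le> x" "x \<le> d" "c < d" "d - c < \<eta>"
        "real (Suc n) * (d - c) \<le> \<bar>f d - f c\<bar>" by blast
      then have "a \<le> c" "d \<le> b" using \<eta> by auto
      then show "\<exists>c d. a \<le> c \<and> c \<le> x \<and> x \<le> d \<and> d \<le> b \<and> c < d \<and> d - c < \<delta> \<and> real (Suc n) * (d - c) \<le> ?V d - ?V c"
        using cd \<eta>(2) total_variation_increment[OF bv, of c d]
        by (intro exI[of _ c] exI[of _ d]) auto
    qed (use ab in \<open>auto simp: B_def\<close>)
    note bnd = this
    show "measure lborel B = 0"
    proof (rule ccontr)
      assume "measure lborel B \<noteq> 0"
      then have pos: "measure lborel B > 0" by (simp add: less_le)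
      obtain n where "?V b - ?V a < real n * measure lborel B"
        using reals_Archimedean3[OF pos] by blast
      also have "\<dots> \<le> Suc n * measure lborel B" using pos by simp
      finally show False using bnd[of n] by simp
    qed
  qed (auto simp: B_def)
  have "AE x in lborel. \<forall>p q :: rat. p < q \<longrightarrow>
      x \<notin> steep f (of_rat q) \<inter> steep (\<lambda>x. - f x) (- of_rat p) \<inter> {a<..<b}"
    unfolding AE_all_countable using osc by (auto simp: of_rat_less)
  with unb show ?thesis
  proof eventually_elim
    case (elim x)
    show ?case
    proof
      assume x: "x \<in> {a<..<b}"
      let ?Q = "\<lambda>h. (f (x + h) - f x) / h"
      from elim(1) x obtain n where n: "x \<notin> steep f (Suc n)" "x \<notin> steep (\<lambda>x. - f x) (Suc n)"
        by (auto simp: B_def)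
      have neg: "(- f (x + h) - - f x) / h = - ?Q h" for h by (cases "h = 0") (auto simp: field_simps)
      have "\<forall>\<^sub>F h in at 0. \<not> real (Suc n) < ?Q h" "\<forall>\<^sub>F h in at 0. \<not> real (Suc n) < - ?Q h"
        using n frequently_steep[of "Suc n" f x] frequently_steep[of "Suc n" "\<lambda>x. - f x" x]
        unfolding neg by (simp_all only: not_frequently[symmetric]) blast+
      then have "\<forall>\<^sub>F h in at 0. \<bar>?Q h\<bar> \<le> Suc n"
        by eventually_elim linarith
      then have "\<exists>L. (?Q \<longlongrightarrow> L) (at 0)"
      proof (rule tendsto_real_if_no_oscillation[rotated])
        fix p q :: rat assume pq: "p < q"
        show "\<not> ((\<exists>\<^sub>F h in at 0. ?Q h < of_rat p) \<and> (\<exists>\<^sub>F h in at 0. of_rat q < ?Q h))"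
        proof
          assume A: "(\<exists>\<^sub>F h in at 0. ?Q h < of_rat p) \<and> (\<exists>\<^sub>F h in at 0. of_rat q < ?Q h)"
          have "x \<in> steep (\<lambda>x. - f x) (- of_rat p)"
            by (rule frequently_steep, unfold neg) (use A in auto)
          moreover have "x \<in> steep f (of_rat q)"
            by (rule frequently_steep) (use A in auto)
          ultimately show False using elim(2) pq x by auto
        qed
      qed auto
      then obtain L where "(f has_real_derivative L) (at x)" by (auto simp: DERIV_def)
      then show "f differentiable (at x)" by (auto simp: real_differentiable_def)
    qed
  qed
qed

section \<open>Absolutely continuous curves are differentiable almost everywhere\<close>

lemma absolutely_continuous_curveD:
  assumes "absolutely_continuous_curve a b \<gamma>" "0 < \<epsilon>"
  shows "\<exists>\<delta>>0. \<forall>(I :: 'i set) c d. finite I \<longrightarrow> (\<forall>i\<in>I. a \<le> c i \<and> c i \<le> d i \<and> d i \<le> b) \<longrightarrow>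
      disjoint_family_on (\<lambda>i. {c i<..<d i}) I \<longrightarrow> (\<Sum>i\<in>I. d i - c i) < \<delta> \<longrightarrow>
      (\<Sum>i\<in>I. norm (\<gamma> (d i) - \<gamma> (c i))) < \<epsilon>"
proof -
  from assms obtain \<delta> where \<delta>: "0 < \<delta>"
    "\<And>n c d. (\<forall>i<n. a \<le> c i \<and> c i \<le> d i \<and> d i \<le> b) \<Longrightarrow>
        disjoint_family_on (\<lambda>i. {c i<..<d i}) {..<n::nat} \<Longrightarrow> (\<Sum>i<n. d i - c i) < \<delta> \<Longrightarrow>
        (\<Sum>i<n. norm (\<gamma> (d i) - \<gamma> (c i))) < \<epsilon>"
    unfolding absolutely_continuous_curve_def by blast
  show ?thesis
  proof (intro exI[of _ \<delta>] conjI allI impI \<delta>(1))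
    fix I :: "'i set" and c d :: "'i \<Rightarrow> real"
    assume I: "finite I" "\<forall>i\<in>I. a \<le> c i \<and> c i \<le> d i \<and> d i \<le> b"
      "disjoint_family_on (\<lambda>i. {c i<..<d i}) I" "(\<Sum>i\<in>I. d i - c i) < \<delta>"
    \<comment> \<open>Later families are indexed by list positions or by tagged intervals instead of
      \<open>{..<n}\<close>; a bijection renumbers them.\<close>
    obtain h where h: "bij_betw h {0..<card I} I" using ex_bij_betw_nat_finite[OF I(1)] by auto
    then have h': "bij_betw h {..<card I} I" by (simp add: atLeast0LessThan)
    then have hI: "h i \<in> I" if "i < card I" for i using that by (auto simp: bij_betw_def)
    have inj: "inj_on h {..<card I}" using h' by (auto simp: bij_betw_def)
    have "(\<Sum>i<card I. norm (\<gamma> (d (h i)) - \<gamma> (c (h i)))) < \<epsilon>"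
    proof (rule \<delta>(2)[of "card I" "\<lambda>i. c (h i)" "\<lambda>i. d (h i)"])
      show "disjoint_family_on (\<lambda>i. {c (h i)<..<d (h i)}) {..<card I}"
        unfolding disjoint_family_on_def
      proof (intro ballI impI)
        fix i j assume ij: "i \<in> {..<card I}" "j \<in> {..<card I}" "i \<noteq> j"
        then have "h i \<noteq> h j" using inj by (auto simp: inj_on_def)
        then show "{c (h i)<..<d (h i)} \<inter> {c (h j)<..<d (h j)} = {}"
          using I(3) hI ij by (simp add: disjoint_family_on_def)
      qed
      show "(\<Sum>i<card I. d (h i) - c (h i)) < \<delta>"
        using I(4) sum.reindex_bij_betw[OF h', of "\<lambda>i. d i - c i"] by simp
    qed (use I(2) hI in auto)
    then show "(\<Sum>i\<in>I. norm (\<gamma> (d i) - \<gamma> (c i))) < \<epsilon>"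
      using sum.reindex_bij_betw[OF h', of "\<lambda>i. norm (\<gamma> (d i) - \<gamma> (c i))"] by simp
  qed
qed

lemma absolutely_continuous_curve_imp_continuous_on:
  assumes "absolutely_continuous_curve a b \<gamma>"
  shows "continuous_on {a..b} \<gamma>"
  unfolding continuous_on_iff
proof (intro ballI allI impI)
  fix x \<epsilon> :: real assume x: "x \<in> {a..b}" and "0 < \<epsilon>"
  then obtain \<delta> where \<delta>: "0 < \<delta>"
    "\<forall>(I :: unit set) c d. finite I \<longrightarrow> (\<forall>i\<in>I. a \<le> c i \<and> c i \<le> d i \<and> d i \<le> b) \<longrightarrow>
      disjoint_family_on (\<lambda>i. {c i<..<d i}) I \<longrightarrow> (\<Sum>i\<in>I. d i - c i) < \<delta> \<longrightarrow>
      (\<Sum>i\<in>I. norm (\<gamma> (d i) - \<gamma> (c i))) < \<epsilon>"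
    using absolutely_continuous_curveD[OF assms] by blast
  show "\<exists>\<delta>>0. \<forall>x'\<in>{a..b}. dist x' x < \<delta> \<longrightarrow> dist (\<gamma> x') (\<gamma> x) < \<epsilon>"
  proof (intro exI[of _ \<delta>] conjI ballI impI \<delta>(1))
    fix y assume y: "y \<in> {a..b}" "dist y x < \<delta>"
    show "dist (\<gamma> y) (\<gamma> x) < \<epsilon>"
      using \<delta>(2)[rule_format, of UNIV "\<lambda>_. min x y" "\<lambda>_. max x y"] x y
      by (cases "x \<le> y") (auto simp: disjoint_family_on_def dist_norm min_def max_def norm_minus_commute)
  qed
qed

lemma absolutely_continuous_curve_lipschitz_image:
  assumes \<gamma>: "absolutely_continuous_curve a b \<gamma>" and L: "0 < L"
    and le: "\<And>c d. a \<le> c \<Longrightarrow> c \<le> d \<Longrightarrow> d \<le> b \<Longrightarrow> norm (\<eta> d - \<eta> c) \<le> L * norm (\<gamma> d - \<gamma> c)"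
  shows "absolutely_continuous_curve a b \<eta>"
  unfolding absolutely_continuous_curve_def
proof (intro allI impI)
  fix \<epsilon> :: real assume "0 < \<epsilon>"
  then have "0 < \<epsilon> / L" using L by simp
  with \<gamma> obtain \<delta> where \<delta>: "0 < \<delta>" "\<forall>(n::nat) c d.
        (\<forall>i<n. a \<le> c i \<and> c i \<le> d i \<and> d i \<le> b) \<longrightarrow>
        disjoint_family_on (\<lambda>i. {c i<..<d i}) {..<n} \<longrightarrow> (\<Sum>i<n. d i - c i) < \<delta> \<longrightarrow>
        (\<Sum>i<n. norm (\<gamma> (d i) - \<gamma> (c i))) < \<epsilon> / L"
    unfolding absolutely_continuous_curve_def by blast
  show "\<exists>\<delta>>0. \<forall>(n::nat) c d. (\<forall>i<n. a \<le> c i \<and> c i \<le> d i \<and> d i \<le> b) \<longrightarrow>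
      disjoint_family_on (\<lambda>i. {c i<..<d i}) {..<n} \<longrightarrow> (\<Sum>i<n. d i - c i) < \<delta> \<longrightarrow>
      (\<Sum>i<n. norm (\<eta> (d i) - \<eta> (c i))) < \<epsilon>"
  proof (intro exI[of _ \<delta>] conjI allI impI \<delta>(1))
    fix n :: nat and c d :: "nat \<Rightarrow> real"
    assume A: "\<forall>i<n. a \<le> c i \<and> c i \<le> d i \<and> d i \<le> b"
      "disjoint_family_on (\<lambda>i. {c i<..<d i}) {..<n}" "(\<Sum>i<n. d i - c i) < \<delta>"
    have "(\<Sum>i<n. norm (\<eta> (d i) - \<eta> (c i))) \<le> (\<Sum>i<n. L * norm (\<gamma> (d i) - \<gamma> (c i)))"
      using A(1) by (intro sum_mono le) auto
    also have "\<dots> = L * (\<Sum>i<n. norm (\<gamma> (d i) - \<gamma> (c i)))" by (simp add: sum_distrib_left)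
    also have "\<dots> < L * (\<epsilon> / L)" using \<delta>(2) A L by (intro mult_strict_left_mono) auto
    finally show "(\<Sum>i<n. norm (\<eta> (d i) - \<eta> (c i))) < \<epsilon>" using L by simp
  qed
qed

lemma absolutely_continuous_curve_inner:
  assumes "absolutely_continuous_curve a b \<gamma>"
  shows "absolutely_continuous_curve a b (\<lambda>t. \<gamma> t \<bullet> e)"
\<comment> \<open>The summand 1 keeps the Lipschitz constant positive when \<open>e\<close> is
  0.\<close>
proof (rule absolutely_continuous_curve_lipschitz_image[OF assms, of "norm e + 1"])
  fix c d :: real
  have "norm (\<gamma> d \<bullet> e - \<gamma> c \<bullet> e) \<le> norm e * norm (\<gamma> d - \<gamma> c)"
    using Cauchy_Schwarz_ineq2[of "\<gamma> d - \<gamma> c" e] by (simp add: inner_diff_left mult.commute)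
  also have "\<dots> \<le> (norm e + 1) * norm (\<gamma> d - \<gamma> c)" by (intro mult_right_mono) auto
  finally show "norm (\<gamma> d \<bullet> e - \<gamma> c \<bullet> e) \<le> (norm e + 1) * norm (\<gamma> d - \<gamma> c)" .
qed (simp add: add_nonneg_pos)

text \<open>On an interval shorter than the \<delta> belonging to \<epsilon> = 1 every partition has
  variation below 1, so the result on bounded variation applies there. Countably many such
  intervals, with rational end points, cover the open interval.\<close>

lemma absolutely_continuous_real_differentiable_AE:
  fixes f :: "real \<Rightarrow> real"
  assumes ac: "absolutely_continuous_curve a b f"
  shows "AE x in lborel. x \<in> {a<..<b} \<longrightarrow> f differentiable (at x)"
proof (cases "a < b")
  case False
  then show ?thesis by auto
next
  case ab: True
  obtain \<delta> where \<delta>: "0 < \<delta>"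
    "\<forall>(I :: nat set) c d. finite I \<longrightarrow> (\<forall>i\<in>I. a \<le> c i \<and> c i \<le> d i \<and> d i \<le> b) \<longrightarrow>
      disjoint_family_on (\<lambda>i. {c i<..<d i}) I \<longrightarrow> (\<Sum>i\<in>I. d i - c i) < \<delta> \<longrightarrow>
      (\<Sum>i\<in>I. norm (f (d i) - f (c i))) < 1"
    using absolutely_continuous_curveD[OF ac zero_less_one] by blast
  \<comment> \<open>Constant continuation beyond \<open>{a..b}\<close> supplies the continuity on
    the whole line that \<open>bounded_variation_imp_differentiable_AE\<close> asks for.\<close>
  define g where "g = (\<lambda>x. f (max a (min b x)))"
  have cg: "continuous_on UNIV g" unfolding g_def
    by (rule continuous_on_compose2[OF absolutely_continuous_curve_imp_continuous_on[OF ac]])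
      (use ab in \<open>auto intro!: continuous_intros\<close>)
  have loc: "AE x in lborel. x \<in> {u<..<v} \<longrightarrow> f differentiable (at x)"
    if uv: "a \<le> u" "u < v" "v \<le> b" "v - u < \<delta>" for u v
  proof -
    have gf: "g x = f x" if "x \<in> {u..v}" for x
    proof -
      have "max a (min b x) = x" using that uv by auto
      then show ?thesis by (simp add: g_def)
    qed
    have "bounded_variation_on u v g" unfolding bounded_variation_on_def
    proof (intro exI allI impI)
      fix xs :: "real list" assume xs: "sorted xs" "set xs \<subseteq> {u..v}"
      have mem: "xs ! i \<in> {u..v}" "xs ! Suc i \<in> {u..v}" "xs ! i \<le> xs ! Suc i" if "i < length xs - 1" for i
        using that xs nth_mem[of i xs] nth_mem[of "Suc i" xs]
        by (auto simp: subset_iff intro!: sorted_nth_mono)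
      have "variation g xs = (\<Sum>i<length xs - 1. norm (f (xs ! Suc i) - f (xs ! i)))"
        unfolding variation_eq_sum using mem by (intro sum.cong) (auto simp: gf)
      also have "\<dots> < 1"
      proof (rule \<delta>(2)[rule_format])
        show "(\<Sum>i<length xs - 1. xs ! Suc i - xs ! i) < \<delta>"
          using sum_gaps_le[OF xs] uv by linarith
        show "a \<le> xs ! i \<and> xs ! i \<le> xs ! Suc i \<and> xs ! Suc i \<le> b" if "i \<in> {..<length xs - 1}" for i
          using mem[of i] that uv by auto
      qed (use disjoint_sorted_gaps[OF xs(1)] in auto)
      finally show "variation g xs \<le> 1" by simp
    qed
    from bounded_variation_imp_differentiable_AE[OF cg this uv(2)] show ?thesis
    proof eventually_elim
      case (elim x)
      show ?case
      proof
        assume x: "x \<in> {u<..<v}"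
        with elim obtain D where "(g has_derivative D) (at x)" by (auto simp: differentiable_def)
        then have "(f has_derivative D) (at x)"
          by (rule has_derivative_transform_within_open[of _ _ _ _ "{u<..<v}"]) (use x gf in auto)
        then show "f differentiable (at x)" by (auto simp: differentiable_def)
      qed
    qed
  qed
  have "AE x in lborel. \<forall>p q :: rat. a \<le> of_rat p \<and> (of_rat p :: real) < of_rat q \<and> of_rat q \<le> b \<and>
      of_rat q - of_rat p < \<delta> \<longrightarrow> x \<in> {of_rat p<..<of_rat q} \<longrightarrow> f differentiable (at x)"
    unfolding AE_all_countable using loc by auto
  then show ?thesis
  proof eventually_elim
    case (elim x)
    show ?case
    proof
      assume x: "x \<in> {a<..<b}"
      obtain p :: rat where p: "max a (x - \<delta> / 2) < of_rat p" "of_rat p < x"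
        using of_rat_dense[of "max a (x - \<delta> / 2)" x] x \<delta>(1) by auto
      obtain q :: rat where q: "x < of_rat q" "of_rat q < min b (x + \<delta> / 2)"
        using of_rat_dense[of x "min b (x + \<delta> / 2)"] x \<delta>(1) by auto
      show "f differentiable (at x)" using elim[rule_format, of p q] p q by auto
    qed
  qed
qed

lemma absolutely_continuous_curve_differentiable_AE:
  fixes \<gamma> :: "real \<Rightarrow> 'b::euclidean_space"
  assumes ac: "absolutely_continuous_curve a b \<gamma>"
  shows "AE x in lborel. x \<in> {a<..<b} \<longrightarrow> \<gamma> differentiable (at x)"
proof -
  have "AE x in lborel. \<forall>i\<in>Basis. x \<in> {a<..<b} \<longrightarrow> (\<lambda>x. \<gamma> x \<bullet> i) differentiable (at x)"
  proof (rule AE_finite_allI[OF finite_Basis])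
    show "AE x in lborel. x \<in> {a<..<b} \<longrightarrow> (\<lambda>x. \<gamma> x \<bullet> i) differentiable (at x)" for i
      by (rule absolutely_continuous_real_differentiable_AE[OF absolutely_continuous_curve_inner[OF ac]])
  qed
  then show ?thesis
    by eventually_elim (subst differentiable_componentwise_within, blast)
qed

section \<open>The fundamental theorem of calculus for absolutely continuous curves\<close>

text \<open>The gauge integral fits this well. At tags outside N the derivative controls the
  increment over the tagged interval. At tags in N the gauge confines the intervals to an open set
  of measure below \<delta>, and absolute continuity makes the sum of their increments
  small.\<close>

lemma absolutely_continuous_has_integral_derivative:
  fixes f :: "real \<Rightarrow> real"
  assumes ac: "absolutely_continuous_curve a b f" and ab: "a \<le> b" and N: "negligible N"
    and der: "\<And>x. x \<in> {a..b} - N \<Longrightarrow> (f has_vector_derivative d x) (at x within {a..b})"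
  shows "(d has_integral (f b - f a)) {a..b}"
proof -
  \<comment> \<open>The value 0 on \<open>N\<close> removes the tags in \<open>N\<close> from the
    Riemann sum; \<open>has_integral_spike\<close> restores \<open>d\<close> at the end.\<close>
  define g where "g = (\<lambda>x. if x \<in> N then 0 else d x)"
  have "(g has_integral (f b - f a)) {a..b}"
    unfolding has_integral_factor_content_real
  proof (intro allI impI)
    fix e :: real assume e: "e > 0"
    show "\<exists>\<gamma>. gauge \<gamma> \<and> (\<forall>p. p tagged_division_of {a..b} \<and> \<gamma> fine p \<longrightarrow>
        norm ((\<Sum>(x,k)\<in>p. measure lborel k *\<^sub>R g x) - (f b - f a)) \<le> e * measure lborel {a..b})"
    \<comment> \<open>The admissible error is proportional to b - a and vanishes for
      \<open>a = b\<close>, where every term of the Riemann sum is 0.\<close>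
    proof (cases "a = b")
      case True
      have "norm ((\<Sum>(x,k)\<in>p. measure lborel k *\<^sub>R g x) - (f b - f a)) \<le> e * measure lborel {a..b}"
        if "p tagged_division_of {a..b}" for p
      proof -
        have "measure lborel k = 0" if "(x, k) \<in> p" for x k
        proof -
          have "k \<subseteq> {a..b}" "\<exists>u v. k = cbox u v"
            using tagged_division_ofD(3,4)[OF \<open>p tagged_division_of {a..b}\<close> that] by auto
          then obtain u v where "k = {u..v}" "{u..v} \<subseteq> {a..b}" by (metis box_real(2))
          then show ?thesis
            using True atLeastatMost_subset_iff[of u v a b] by (cases "u \<le> v") auto
        qed
        then have "(\<Sum>(x,k)\<in>p. measure lborel k *\<^sub>R g x) = 0" by (intro sum.neutral) auto
        then show ?thesis using True by simp
      qed
      then show ?thesis using gauge_trivial by blast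
    next
      case False
      then have ab': "a < b" using ab by simp
      \<comment> \<open>Half of the admissible error goes to the tags in \<open>N\<close>, the other
        half to the remaining tags.\<close>
      let ?e = "e * (b - a) / 2"
      have "?e > 0" using e ab' by simp
      from absolutely_continuous_curveD[OF ac this] obtain \<delta> where \<delta>: "0 < \<delta>"
        "\<forall>(I :: (real \<times> real set) set) c d. finite I \<longrightarrow> (\<forall>i\<in>I. a \<le> c i \<and> c i \<le> d i \<and> d i \<le> b) \<longrightarrow>
          disjoint_family_on (\<lambda>i. {c i<..<d i}) I \<longrightarrow> (\<Sum>i\<in>I. d i - c i) < \<delta> \<longrightarrow>
          (\<Sum>i\<in>I. norm (f (d i) - f (c i))) < ?e"
        by blast
      have Nl: "N \<in> null_sets lebesgue" using N by (simp add: negligible_iff_null_sets)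
      then have "N \<in> sets lebesgue" by auto
      from sets_lebesgue_outer_open[OF this \<delta>(1)] obtain W
        where W: "open W" "N \<subseteq> W" "W - N \<in> lmeasurable" "emeasure lebesgue (W - N) < ennreal \<delta>" by auto
      have Weq: "W = (W - N) \<union> N" using W(2) by auto
      have Wm: "W \<in> lmeasurable"
        using W(3) Nl by (subst Weq, intro fmeasurable.Un) (auto simp: fmeasurable_def null_sets_def)
      have "measure lebesgue W = measure lebesgue (W - N)"
        using W(3) Nl by (subst Weq, intro measure_Un_null_set) auto
      also have "\<dots> < \<delta>" using W(3,4) \<delta>(1) by (simp add: emeasure_eq_measure2 ennreal_less_iff)
      finally have W\<delta>: "measure lebesgue W < \<delta>" .
      have "\<exists>r>0. \<forall>y\<in>{a..b}. \<bar>y - x\<bar> < r \<longrightarrow> \<bar>f y - f x - (y - x) * d x\<bar> \<le> e / 2 * \<bar>y - x\<bar>"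
        if "x \<in> {a..b} - N" for x
        using der[OF that] e unfolding has_vector_derivative_def has_derivative_within_alt
        by (auto dest!: spec[of _ "e / 2"])
      then obtain r where r: "\<And>x. x \<in> {a..b} - N \<Longrightarrow> r x > 0"
        "\<And>x y. x \<in> {a..b} - N \<Longrightarrow> y \<in> {a..b} \<Longrightarrow> \<bar>y - x\<bar> < r x \<Longrightarrow>
          \<bar>f y - f x - (y - x) * d x\<bar> \<le> e / 2 * \<bar>y - x\<bar>" by metis
      \<comment> \<open>The value \<open>UNIV\<close> outside \<open>{a..b}\<close> only completes
        the gauge: no tag lies there.\<close>
      define \<gamma> where "\<gamma> x = (if x \<in> N then W else if x \<in> {a..b} then ball x (r x) else UNIV)" for x
      have "gauge \<gamma>" unfolding gauge_def \<gamma>_def using W r(1) by auto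
      moreover have bound: "norm ((\<Sum>(x,k)\<in>p. measure lborel k *\<^sub>R g x) - (f b - f a)) \<le> e * measure lborel {a..b}"
        if p: "p tagged_division_of {a..b}" and fine: "\<gamma> fine p" for p
      proof -
        have fin: "finite p" using p by blast
        have pk: "\<exists>u v. fst i \<in> {u..v} \<and> snd i = {u..v} \<and> a \<le> u \<and> u \<le> v \<and> v \<le> b \<and> {u..v} \<subseteq> \<gamma> (fst i)"
          if "i \<in> p" for i
        proof -
          obtain x k where i: "i = (x, k)" by (cases i)
          have "x \<in> k" "k \<subseteq> {a..b}" "\<exists>u v. k = cbox u v" "k \<subseteq> \<gamma> x"
            using tagged_division_ofD(2-4)[OF p that[unfolded i]] fine that i by (auto simp: fine_def)
          then obtain u v where "k = {u..v}" "u \<le> x" "x \<le> v" by (auto simp: box_real)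
          with \<open>k \<subseteq> {a..b}\<close> \<open>x \<in> k\<close> \<open>k \<subseteq> \<gamma> x\<close> show ?thesis by (intro exI[of _ u] exI[of _ v]) (auto simp: i)
        qed
        define L where "L i = Inf (snd i)" for i :: "real \<times> real set"
        define R where "R i = Sup (snd i)" for i :: "real \<times> real set"
        have LR: "fst i \<in> {L i..R i}" "snd i = {L i..R i}" "a \<le> L i" "L i \<le> R i" "R i \<le> b"
          "{L i..R i} \<subseteq> \<gamma> (fst i)" if "i \<in> p" for i
          using pk[OF that] by (auto simp: L_def R_def)
        let ?q = "{i\<in>p. fst i \<in> N}"
        have disj: "disjoint_family_on (\<lambda>i. {L i<..<R i}) p"
          unfolding disjoint_family_on_def
        proof (intro ballI impI)
          fix i j assume ij: "i \<in> p" "j \<in> p" "i \<noteq> j"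
          have "interior (snd i) \<inter> interior (snd j) = {}"
            using tagged_division_ofD(5)[OF p, of "fst i" "snd i" "fst j" "snd j"] ij by (auto simp: prod_eq_iff)
          then show "{L i<..<R i} \<inter> {L j<..<R j} = {}" using LR(2)[OF ij(1)] LR(2)[OF ij(2)] by simp
        qed
        have "(\<Sum>i\<in>?q. R i - L i) = (\<Sum>i\<in>?q. measure lebesgue {L i<..<R i})"
          using LR by (intro sum.cong) auto
        also have "\<dots> = measure lebesgue (\<Union>i\<in>?q. {L i<..<R i})"
          using fin disj LR(4) by (intro measure_finite_Union[symmetric])
            (auto simp: disjoint_family_on_def)
        also have "\<dots> \<le> measure lebesgue W"
        proof (rule measure_mono_fmeasurable[OF _ _ Wm])
          show "(\<Union>i\<in>?q. {L i<..<R i}) \<subseteq> W" using LR(6) by (fastforce simp: \<gamma>_def)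
        qed (use fin in auto)
        finally have len: "(\<Sum>i\<in>?q. R i - L i) < \<delta>" using W\<delta> by simp
        have 1: "(\<Sum>i\<in>?q. \<bar>f (R i) - f (L i)\<bar>) < ?e"
          unfolding real_norm_def[symmetric]
          by (rule \<delta>(2)[rule_format]) (use fin LR len disj in \<open>auto simp: disjoint_family_on_def\<close>)
        \<comment> \<open>At a tag outside \<open>N\<close> both ends of the interval are compared
          with the tag, which lies between them, so the two errors add up to \<open>e / 2\<close>
          times the length.\<close>
        have 2: "\<bar>(R i - L i) * g (fst i) - (f (R i) - f (L i))\<bar> \<le>
            e / 2 * (R i - L i) + (if fst i \<in> N then \<bar>f (R i) - f (L i)\<bar> else 0)" if i: "i \<in> p" for i
        proof (cases "fst i \<in> N")
          case True
          moreover have "0 \<le> e / 2 * (R i - L i)" using LR(4)[OF i] e by simp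
          ultimately show ?thesis by (simp add: g_def)
        next
          case nN: False
          let ?x = "fst i"
          have x: "?x \<in> {a..b} - N" using LR[OF i] nN by auto
          then have sub: "{L i..R i} \<subseteq> ball ?x (r ?x)" using LR(6)[OF i] by (auto simp: \<gamma>_def)
          have LRi: "L i \<in> {a..b}" "R i \<in> {a..b}" "\<bar>L i - ?x\<bar> < r ?x" "\<bar>R i - ?x\<bar> < r ?x"
            using LR(1-5)[OF i] subsetD[OF sub, of "L i"] subsetD[OF sub, of "R i"]
            by (auto simp: dist_real_def)
          have "\<bar>f (R i) - f ?x - (R i - ?x) * d ?x\<bar> \<le> e / 2 * \<bar>R i - ?x\<bar>"
            "\<bar>f (L i) - f ?x - (L i - ?x) * d ?x\<bar> \<le> e / 2 * \<bar>L i - ?x\<bar>"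
            using r(2)[OF x] LRi by auto
          moreover have "(f (R i) - f (L i)) - (R i - L i) * d ?x =
              (f (R i) - f ?x - (R i - ?x) * d ?x) - (f (L i) - f ?x - (L i - ?x) * d ?x)"
            by (simp add: algebra_simps)
          ultimately have "\<bar>(f (R i) - f (L i)) - (R i - L i) * d ?x\<bar> \<le> e / 2 * \<bar>R i - ?x\<bar> + e / 2 * \<bar>L i - ?x\<bar>"
            by linarith
          also have "\<dots> = e / 2 * (R i - L i)" using LR(1)[OF i] by (simp add: field_simps)
          finally show ?thesis using nN by (simp add: g_def abs_minus_commute)
        qed
        have "(\<Sum>(x,k)\<in>p. measure lborel k *\<^sub>R g x) = (\<Sum>i\<in>p. (R i - L i) * g (fst i))"
        proof (intro sum.cong refl)
          fix i assume i: "i \<in> p"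
          have "measure lborel (snd i) = R i - L i" using LR(4)[OF i] by (subst LR(2)[OF i]) simp
          then show "(case i of (x, k) \<Rightarrow> measure lborel k *\<^sub>R g x) = (R i - L i) * g (fst i)"
            by (simp add: case_prod_beta)
        qed
        moreover have "f b - f a = (\<Sum>i\<in>p. f (R i) - f (L i))"
          using additive_tagged_division_1[OF ab p, of f] by (simp add: L_def R_def case_prod_beta)
        ultimately have "norm ((\<Sum>(x,k)\<in>p. measure lborel k *\<^sub>R g x) - (f b - f a))
            = \<bar>\<Sum>i\<in>p. (R i - L i) * g (fst i) - (f (R i) - f (L i))\<bar>"
          by (simp add: sum_subtractf)
        also have "\<dots> \<le> (\<Sum>i\<in>p. e / 2 * (R i - L i) + (if fst i \<in> N then \<bar>f (R i) - f (L i)\<bar> else 0))"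
          using 2 by (intro order_trans[OF sum_abs] sum_mono) auto
        also have "\<dots> = e / 2 * (\<Sum>i\<in>p. R i - L i) + (\<Sum>i\<in>?q. \<bar>f (R i) - f (L i)\<bar>)"
          unfolding sum.distrib sum_distrib_left[symmetric] sum.inter_filter[OF fin] ..
        also have "(\<Sum>i\<in>p. R i - L i) = b - a"
          using additive_tagged_division_1[OF ab p, of "\<lambda>x. x"] by (simp add: L_def R_def case_prod_beta)
        finally have "norm ((\<Sum>(x,k)\<in>p. measure lborel k *\<^sub>R g x) - (f b - f a))
            \<le> e / 2 * (b - a) + (\<Sum>i\<in>?q. \<bar>f (R i) - f (L i)\<bar>)" .
        also have "\<dots> \<le> e / 2 * (b - a) + e * (b - a) / 2" using 1 by (intro add_left_mono less_imp_le)
        also have "\<dots> = e * measure lborel {a..b}" using ab by simp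
        finally show ?thesis .
      qed
      ultimately show ?thesis by (intro exI[of _ \<gamma>] conjI allI impI bound) auto
    qed
  qed
  then show ?thesis
    by (rule has_integral_spike[OF N, rotated]) (auto simp: g_def)
qed

lemma negligible_not_differentiable:
  fixes \<gamma> :: "real \<Rightarrow> 'b::euclidean_space"
  assumes ac: "absolutely_continuous_curve a b \<gamma>"
  shows "negligible {x\<in>{a..b}. \<not> (x \<in> {a<..<b} \<and> \<gamma> differentiable (at x))}"
proof -
  from AE_E[OF absolutely_continuous_curve_differentiable_AE[OF ac]] obtain Z
    where Z: "{x \<in> space lborel. \<not> (x \<in> {a<..<b} \<longrightarrow> \<gamma> differentiable (at x))} \<subseteq> Z"
      "emeasure lborel Z = 0" "Z \<in> sets lborel" by blast
  then have "Z \<in> null_sets lebesgue" by (intro null_sets_completionI) auto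
  then have "negligible (Z \<union> {a, b})" by (intro negligible_Un) (auto simp: negligible_iff_null_sets)
  then show ?thesis
  proof (rule negligible_subset, intro subsetI)
    fix x assume "x \<in> {x\<in>{a..b}. \<not> (x \<in> {a<..<b} \<and> \<gamma> differentiable (at x))}"
    then have "x = a \<or> x = b \<or> x \<in> {a<..<b} \<and> \<not> \<gamma> differentiable (at x)" by auto
    then show "x \<in> Z \<union> {a, b}" using Z(1) by auto
  qed
qed

text \<open>Cauchy--Schwarz in the linearised form \<open>2 \<alpha> |v| \<le> |v|\<^sup>2 + \<alpha>\<^sup>2\<close>.\<close>

lemma displacement_le_energy:
  fixes \<gamma> :: "real \<Rightarrow> 'b::euclidean_space"
  assumes ac: "absolutely_continuous_curve a b \<gamma>" and ab: "a \<le> b"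
  shows "ennreal (2 * \<alpha> * norm (\<gamma> b - \<gamma> a) - \<alpha>\<^sup>2 * (b - a)) \<le>
    (\<integral>\<^sup>+s\<in>{a..b}. ennreal ((norm (vector_derivative \<gamma> (at s within {a..b})))\<^sup>2) \<partial>lborel)"
    (is "_ \<le> ?K")
proof (cases "?K = \<infinity>")
  case False
  \<comment> \<open>Projecting the velocity onto the direction of displacement reduces the claim to
    a scalar function whose integral is the length of the displacement. For zero displacement
    \<open>sgn\<close> gives 0, which is why only \<open>norm e \<le> 1\<close> is claimed.\<close>
  define e where "e = sgn (\<gamma> b - \<gamma> a)"
  define d where "d s = vector_derivative \<gamma> (at s within {a..b}) \<bullet> e" for s
  have e1: "norm e \<le> 1" by (simp add: e_def norm_sgn)
  have De: "\<gamma> b \<bullet> e - \<gamma> a \<bullet> e = norm (\<gamma> b - \<gamma> a)"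
  proof -
    have "v \<bullet> sgn v = norm v" for v :: 'b
      by (cases "v = 0") (simp_all add: sgn_div_norm power2_norm_eq_inner[symmetric] power2_eq_square)
    then show ?thesis by (simp add: e_def inner_diff_left[symmetric])
  qed
  have d: "(d has_integral (\<gamma> b \<bullet> e - \<gamma> a \<bullet> e)) {a..b}"
  proof (rule absolutely_continuous_has_integral_derivative[OF absolutely_continuous_curve_inner[OF ac] ab
        negligible_not_differentiable[OF ac]])
    fix x assume "x \<in> {a..b} - {x\<in>{a..b}. \<not> (x \<in> {a<..<b} \<and> \<gamma> differentiable (at x))}"
    then have "\<gamma> differentiable (at x within {a..b})" by (auto intro: differentiable_at_withinI)
    then have "(\<gamma> has_vector_derivative vector_derivative \<gamma> (at x within {a..b})) (at x within {a..b})"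
      by (simp add: vector_derivative_works)
    then show "((\<lambda>t. \<gamma> t \<bullet> e) has_vector_derivative d x) (at x within {a..b})"
      unfolding d_def by (rule bounded_linear.has_vector_derivative[OF bounded_linear_inner_left])
  qed
  let ?q = "\<lambda>s. (indicator {a..b} s * d s)\<^sup>2"
  have qm: "?q \<in> lebesgue \<rightarrow>\<^sub>M borel"
    using has_integral_implies_lebesgue_measurable[OF d] by simp
  have "(\<integral>\<^sup>+s. ennreal (?q s) \<partial>lebesgue) = (\<integral>\<^sup>+s. ennreal (?q s) \<partial>lborel)"
    by (rule nn_integral_completion)
  also have "\<dots> \<le> ?K"
  proof (intro nn_integral_mono)
    fix s
    have "\<bar>d s\<bar> \<le> norm (vector_derivative \<gamma> (at s within {a..b}))"
      unfolding d_def by (rule order_trans[OF Cauchy_Schwarz_ineq2]) (use e1 in \<open>simp add: mult_left_le\<close>)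
    then have "(d s)\<^sup>2 \<le> (norm (vector_derivative \<gamma> (at s within {a..b})))\<^sup>2"
      by (simp add: abs_le_square_iff[symmetric])
    then show "ennreal (?q s) \<le> ennreal ((norm (vector_derivative \<gamma> (at s within {a..b})))\<^sup>2) * indicator {a..b} s"
      by (auto simp: indicator_def intro!: ennreal_leI)
  qed
  finally have qK: "(\<integral>\<^sup>+s. ennreal (?q s) \<partial>lebesgue) \<le> ?K" .
  with False obtain r where r: "(\<integral>\<^sup>+s. ennreal (?q s) \<partial>lebesgue) = ennreal r" "0 \<le> r"
    by (cases "\<integral>\<^sup>+s. ennreal (?q s) \<partial>lebesgue") (auto simp: top_unique)
  have "(?q has_integral r) UNIV"
    by (subst has_integral_iff_nn_integral_lebesgue) (use qm r in auto)
  then have "((\<lambda>s. if s \<in> {a..b} then (d s)\<^sup>2 else 0) has_integral r) UNIV"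
    by (rule has_integral_eq[rotated]) auto
  then have q: "((\<lambda>s. (d s)\<^sup>2) has_integral r) {a..b}" by (simp only: has_integral_restrict_UNIV)
  have "2 * \<alpha> * (\<gamma> b \<bullet> e - \<gamma> a \<bullet> e) \<le> r + \<alpha>\<^sup>2 * (b - a)"
  proof (rule has_integral_le[OF has_integral_mult_right[OF d]])
    show "((\<lambda>s. (d s)\<^sup>2 + \<alpha>\<^sup>2) has_integral (r + \<alpha>\<^sup>2 * (b - a))) {a..b}"
      using has_integral_add[OF q has_integral_const_real[of "\<alpha>\<^sup>2" a b]] ab
      by (simp add: mult.commute)
    fix s
    have "0 \<le> (d s - \<alpha>)\<^sup>2" by simp
    then show "2 * \<alpha> * d s \<le> (d s)\<^sup>2 + \<alpha>\<^sup>2" by (simp add: power2_diff mult.commute mult.left_commute)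
  qed
  then have "ennreal (2 * \<alpha> * norm (\<gamma> b - \<gamma> a) - \<alpha>\<^sup>2 * (b - a)) \<le> ennreal r"
    unfolding De by (intro ennreal_leI) simp
  then show ?thesis using qK r(1) by simp
qed auto

section \<open>Action of concatenated and dilated curves\<close>

text \<open>\<open>nn_integral\<close> is a lower integral on non-measurable functions; it is attained by a measurable
  minorant, which makes it additive over sets and equivariant under affine maps without
  measurability hypotheses.\<close>

lemma ex_measurable_minorant:
  "\<exists>g\<in>borel_measurable M. (\<forall>x. g x \<le> f x) \<and> integral\<^sup>N M g = integral\<^sup>N M f"
proof -
  let ?S = "{g. simple_function M g \<and> g \<le> f}"
  have ne: "?S \<noteq> {}" by (auto intro!: exI[of _ "\<lambda>_. 0"] simp: le_fun_def)
  from ennreal_SUP_countable_SUP[OF ne, of "integral\<^sup>S M"] obtain y :: "nat \<Rightarrow> ennreal"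
    where y: "range y \<subseteq> integral\<^sup>S M ` ?S" "Sup (integral\<^sup>S M ` ?S) = Sup (range y)" by auto
  then have "\<forall>n. \<exists>g. g \<in> ?S \<and> y n = integral\<^sup>S M g" by auto
  then obtain G where G: "\<And>n. G n \<in> ?S" "\<And>n. y n = integral\<^sup>S M (G n)" by metis
  let ?g = "\<lambda>x. SUP n. G n x"
  have m: "?g \<in> borel_measurable M"
    using G(1) by (intro borel_measurable_SUP) (auto intro: borel_measurable_simple_function)
  have le: "?g x \<le> f x" for x using G(1) by (auto intro!: SUP_least simp: le_fun_def)
  have "integral\<^sup>N M f \<le> integral\<^sup>N M ?g"
    unfolding nn_integral_def[of M f] y(2)
  proof (rule SUP_least)
    fix n
    have "y n = integral\<^sup>N M (G n)" using G by (simp add: nn_integral_eq_simple_integral)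
    also have "\<dots> \<le> integral\<^sup>N M ?g" by (intro nn_integral_mono SUP_upper) auto
    finally show "y n \<le> integral\<^sup>N M ?g" .
  qed
  moreover have "integral\<^sup>N M ?g \<le> integral\<^sup>N M f" using le by (intro nn_integral_mono) auto
  ultimately show ?thesis using m le by (intro bexI[of _ ?g] conjI allI order_antisym)
qed

lemma nn_integral_Un_disjoint:
  assumes AB: "A \<in> sets M" "B \<in> sets M" "A \<inter> B = {}"
  shows "(\<integral>\<^sup>+x\<in>A \<union> B. f x \<partial>M) = (\<integral>\<^sup>+x\<in>A. f x \<partial>M) + (\<integral>\<^sup>+x\<in>B. f x \<partial>M)"
proof (rule antisym)
  obtain g where g: "g \<in> borel_measurable M" "\<And>x. g x \<le> f x * indicator (A \<union> B) x"
    "integral\<^sup>N M g = (\<integral>\<^sup>+x\<in>A \<union> B. f x \<partial>M)"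
    using ex_measurable_minorant[of M "\<lambda>x. f x * indicator (A \<union> B) x"] by blast
  have "integral\<^sup>N M g \<le> (\<integral>\<^sup>+x. g x * indicator A x + g x * indicator B x \<partial>M)"
  proof (intro nn_integral_mono)
    fix x show "g x \<le> g x * indicator A x + g x * indicator B x"
      using g(2)[of x] by (auto simp: indicator_def split: if_splits)
  qed
  also have "\<dots> = (\<integral>\<^sup>+x\<in>A. g x \<partial>M) + (\<integral>\<^sup>+x\<in>B. g x \<partial>M)"
    using g(1) AB by (intro nn_integral_add) auto
  also have "\<dots> \<le> (\<integral>\<^sup>+x\<in>A. f x \<partial>M) + (\<integral>\<^sup>+x\<in>B. f x \<partial>M)"
  proof -
    have "g x * indicator A x \<le> f x * indicator A x" "g x * indicator B x \<le> f x * indicator B x" for x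
      using g(2)[of x] by (auto simp: indicator_def split: if_splits)
    then show ?thesis by (intro add_mono nn_integral_mono) auto
  qed
  finally show "(\<integral>\<^sup>+x\<in>A \<union> B. f x \<partial>M) \<le> (\<integral>\<^sup>+x\<in>A. f x \<partial>M) + (\<integral>\<^sup>+x\<in>B. f x \<partial>M)"
    using g(3) by simp
next
  obtain g where g: "g \<in> borel_measurable M" "\<And>x. g x \<le> f x * indicator A x"
    "integral\<^sup>N M g = (\<integral>\<^sup>+x\<in>A. f x \<partial>M)"
    using ex_measurable_minorant[of M "\<lambda>x. f x * indicator A x"] by blast
  obtain h where h: "h \<in> borel_measurable M" "\<And>x. h x \<le> f x * indicator B x"
    "integral\<^sup>N M h = (\<integral>\<^sup>+x\<in>B. f x \<partial>M)"
    using ex_measurable_minorant[of M "\<lambda>x. f x * indicator B x"] by blast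
  have "integral\<^sup>N M g + integral\<^sup>N M h = (\<integral>\<^sup>+x. g x + h x \<partial>M)"
    using g(1) h(1) by (intro nn_integral_add[symmetric])
  also have "\<dots> \<le> (\<integral>\<^sup>+x\<in>A \<union> B. f x \<partial>M)"
  proof (intro nn_integral_mono)
    fix x show "g x + h x \<le> f x * indicator (A \<union> B) x"
      using g(2)[of x] h(2)[of x] AB(3) by (cases "x \<in> A"; cases "x \<in> B") auto
  qed
  finally show "(\<integral>\<^sup>+x\<in>A. f x \<partial>M) + (\<integral>\<^sup>+x\<in>B. f x \<partial>M) \<le> (\<integral>\<^sup>+x\<in>A \<union> B. f x \<partial>M)"
    using g(3) h(3) by simp
qed

text \<open>A measurable minorant gives one inequality for every factor; the same inequality for 1 /
  c applied to c f gives the other.\<close>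

lemma nn_integral_cmult_real:
  assumes "0 < c"
  shows "(\<integral>\<^sup>+x. ennreal c * f x \<partial>M) = ennreal c * integral\<^sup>N M f"
proof -
  have ge: "ennreal c * integral\<^sup>N M f \<le> (\<integral>\<^sup>+x. ennreal c * f x \<partial>M)" for c f
  proof -
    obtain g where g: "g \<in> borel_measurable M" "\<And>x. g x \<le> f x"
      "integral\<^sup>N M g = integral\<^sup>N M f" using ex_measurable_minorant by blast
    have "ennreal c * integral\<^sup>N M g = (\<integral>\<^sup>+x. ennreal c * g x \<partial>M)"
      using g(1) by (simp add: nn_integral_cmult)
    also have "\<dots> \<le> (\<integral>\<^sup>+x. ennreal c * f x \<partial>M)"
      using g(2) by (intro nn_integral_mono mult_left_mono) auto
    finally show ?thesis using g(3) by simp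
  qed
  have inv: "ennreal c * (ennreal (1 / c) * y) = y" "ennreal (1 / c) * (ennreal c * y) = y" for y
    using assms by (simp_all add: mult.assoc[symmetric] ennreal_mult[symmetric])
  have "ennreal (1 / c) * (\<integral>\<^sup>+x. ennreal c * f x \<partial>M) \<le> integral\<^sup>N M f"
    using ge[of "1 / c" "\<lambda>x. ennreal c * f x"] by (simp add: inv)
  then have "ennreal c * (ennreal (1 / c) * (\<integral>\<^sup>+x. ennreal c * f x \<partial>M)) \<le> ennreal c * integral\<^sup>N M f"
    by (intro mult_left_mono) auto
  then show ?thesis using ge[of c f] by (simp add: inv order_antisym)
qed

text \<open>Again one inequality suffices, since the inverse of an affine map is affine.\<close>

lemma nn_integral_affine:
  fixes k l :: real
  assumes k: "0 < k"
  shows "(\<integral>\<^sup>+x. f x \<partial>lborel) = ennreal k * (\<integral>\<^sup>+x. f (l + k * x) \<partial>lborel)"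
proof -
  have le: "(\<integral>\<^sup>+x. f x \<partial>lborel) \<le> ennreal k * (\<integral>\<^sup>+x. f (l + k * x) \<partial>lborel)" if "0 < k" for f k l
  proof -
    obtain g where g: "g \<in> borel_measurable lborel" "\<And>x. g x \<le> f x"
      "integral\<^sup>N lborel g = integral\<^sup>N lborel f" using ex_measurable_minorant by blast
    have "integral\<^sup>N lborel g = ennreal k * (\<integral>\<^sup>+x. g (l + k * x) \<partial>lborel)"
      using nn_integral_real_affine[of g k l] g(1) that by simp
    also have "\<dots> \<le> ennreal k * (\<integral>\<^sup>+x. f (l + k * x) \<partial>lborel)"
      using g(2) by (intro mult_left_mono nn_integral_mono) auto
    finally show ?thesis using g(3) by simp
  qed
  have inv: "ennreal k * (ennreal (1 / k) * y) = y" for y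
    using k by (simp add: mult.assoc[symmetric] ennreal_mult[symmetric])
  have "(\<integral>\<^sup>+x. f (l + k * x) \<partial>lborel) \<le> ennreal (1 / k) * (\<integral>\<^sup>+x. f (l + k * (- l / k + 1 / k * x)) \<partial>lborel)"
    using k by (intro le) simp
  also have "(\<lambda>x. f (l + k * (- l / k + 1 / k * x))) = f"
    using k by (simp add: field_simps)
  finally have "ennreal k * (\<integral>\<^sup>+x. f (l + k * x) \<partial>lborel) \<le> ennreal k * (ennreal (1 / k) * (\<integral>\<^sup>+x. f x \<partial>lborel))"
    by (intro mult_left_mono) auto
  then show ?thesis using le[OF k, of f l] by (simp add: inv order_antisym)
qed

lemma nn_integral_Icc_Ioo:
  "(\<integral>\<^sup>+x\<in>{a..b}. f x \<partial>lborel) = (\<integral>\<^sup>+x\<in>{a<..<b}. f x \<partial>lborel)" for a b :: real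
proof (rule nn_integral_cong_AE)
  have "AE x in lborel. x \<notin> {a, b}" by (intro AE_not_in) (simp add: finite_imp_null_set_lborel)
  then show "AE x in lborel. f x * indicator {a..b} x = f x * indicator {a<..<b} x"
    by eventually_elim (auto simp: indicator_def)
qed

lemma nn_integral_Ioo_split:
  fixes a b c :: real
  assumes "a \<le> c" "c \<le> b"
  shows "(\<integral>\<^sup>+x\<in>{a<..<b}. f x \<partial>lborel) = (\<integral>\<^sup>+x\<in>{a<..<c}. f x \<partial>lborel) + (\<integral>\<^sup>+x\<in>{c<..<b}. f x \<partial>lborel)"
proof -
  have "AE x in lborel. x \<notin> {c}" by (intro AE_not_in) (simp add: finite_imp_null_set_lborel)
  then have "(\<integral>\<^sup>+x\<in>{a<..<b}. f x \<partial>lborel) = (\<integral>\<^sup>+x\<in>{a<..<c} \<union> {c<..<b}. f x \<partial>lborel)"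
    by (intro nn_integral_cong_AE, eventually_elim) (use assms in \<open>auto simp: indicator_def\<close>)
  then show ?thesis by (simp add: nn_integral_Un_disjoint)
qed

lemma nn_integral_Ioo_affine:
  fixes a b k l :: real
  assumes k: "0 < k"
  shows "(\<integral>\<^sup>+x\<in>{l + k * a<..<l + k * b}. f x \<partial>lborel) = ennreal k * (\<integral>\<^sup>+x\<in>{a<..<b}. f (l + k * x) \<partial>lborel)"
proof -
  have "indicator {l + k * a<..<l + k * b} (l + k * x) = (indicator {a<..<b} x :: ennreal)" for x
    using k by (auto simp: indicator_def)
  then show ?thesis by (subst nn_integral_affine[OF k, of _ l]) simp
qed

section \<open>Kinetic and potential parts of the action\<close>

definition kinetic :: "('n::finite \<Rightarrow> real) \<Rightarrow> real \<Rightarrow> real \<Rightarrow> (real \<Rightarrow> ('a::euclidean_space, 'n) vec) \<Rightarrow> ennreal" where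
  "kinetic m a b \<gamma> = (\<integral>\<^sup>+s\<in>{a<..<b}. ennreal (mass_norm_sq m (vector_derivative \<gamma> (at s))) \<partial>lborel)"

definition potential_action ::
  "('n::{finite,linorder} \<Rightarrow> real) \<Rightarrow> real \<Rightarrow> real \<Rightarrow> real \<Rightarrow> (real \<Rightarrow> ('a::euclidean_space, 'n) vec) \<Rightarrow> ennreal" where
  "potential_action m \<kappa> a b \<gamma> = (\<integral>\<^sup>+s\<in>{a<..<b}. potential m \<kappa> (\<gamma> s) \<partial>lborel)"

text \<open>On the open interval the derivative no longer refers to the ambient interval. This is
  what allows the kinetic energy to be split and glued.\<close>

lemma vector_derivative_within_Icc:
  fixes \<gamma> :: "real \<Rightarrow> 'b::real_normed_vector"
  assumes "s \<in> {a<..<b}"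
  shows "vector_derivative \<gamma> (at s within {a..b}) = vector_derivative \<gamma> (at s)"
proof -
  have "s \<in> interior {a..b}" using assms by simp
  then show ?thesis by (simp only: at_within_interior)
qed

lemma action_eq: "action m \<kappa> a b \<gamma> = kinetic m a b \<gamma> / 2 + potential_action m \<kappa> a b \<gamma>"
proof -
  have "(\<integral>\<^sup>+s\<in>{a<..<b}. ennreal (mass_norm_sq m (vector_derivative \<gamma> (at s within {a..b}))) \<partial>lborel) = kinetic m a b \<gamma>"
    unfolding kinetic_def
    by (intro nn_integral_cong) (auto simp: indicator_def vector_derivative_within_Icc)
  then show ?thesis by (simp only: action_def nn_integral_Icc_Ioo[where a = a and b = b] potential_action_def)
qed

lemma action_split:
  assumes "a \<le> c" "c \<le> b"
  shows "action m \<kappa> a b \<gamma> = action m \<kappa> a c \<gamma> + action m \<kappa> c b \<gamma>"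
proof -
  have "kinetic m a b \<gamma> = kinetic m a c \<gamma> + kinetic m c b \<gamma>"
    "potential_action m \<kappa> a b \<gamma> = potential_action m \<kappa> a c \<gamma> + potential_action m \<kappa> c b \<gamma>"
    unfolding kinetic_def potential_action_def by (rule nn_integral_Ioo_split[OF assms])+
  then show ?thesis by (simp only: action_eq add_divide_distrib_ennreal ac_simps)
qed

lemma action_cong:
  assumes "\<And>s. s \<in> {a<..<b} \<Longrightarrow> \<gamma> s = \<eta> s"
  shows "action m \<kappa> a b \<gamma> = action m \<kappa> a b \<eta>"
proof -
  have "vector_derivative \<gamma> (at s) = vector_derivative \<eta> (at s)" if "s \<in> {a<..<b}" for s
  proof (rule vector_derivative_cong_eq)
    show "\<forall>\<^sub>F x in nhds s. x \<in> UNIV \<longrightarrow> \<gamma> x = \<eta> x"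
      using eventually_nhds_in_open[of "{a<..<b}" s] that assms by (auto elim: eventually_mono)
  qed auto
  then have "kinetic m a b \<gamma> = kinetic m a b \<eta>"
    unfolding kinetic_def by (intro nn_integral_cong) (simp add: indicator_def)
  moreover have "potential_action m \<kappa> a b \<gamma> = potential_action m \<kappa> a b \<eta>"
    unfolding potential_action_def by (intro nn_integral_cong) (simp add: indicator_def assms)
  ultimately show ?thesis by (simp add: action_eq)
qed

section \<open>Reparametrisation, concatenation and dilation of curves\<close>

lemma mass_norm_sq_scaleR: "mass_norm_sq m (c *\<^sub>R v) = c\<^sup>2 * mass_norm_sq m v"
  by (simp add: mass_norm_sq_def sum_distrib_left power_mult_distrib algebra_simps)

lemma absolutely_continuous_curve_affine:
  assumes ac: "absolutely_continuous_curve (l + k * a) (l + k * b) \<gamma>" and k: "0 < k"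
  shows "absolutely_continuous_curve a b (\<lambda>r. \<gamma> (l + k * r))"
  unfolding absolutely_continuous_curve_def
proof (intro allI impI)
  fix \<epsilon> :: real assume "0 < \<epsilon>"
  with ac obtain \<delta> where \<delta>: "0 < \<delta>" "\<forall>(n::nat) c d.
        (\<forall>i<n. l + k * a \<le> c i \<and> c i \<le> d i \<and> d i \<le> l + k * b) \<longrightarrow>
        disjoint_family_on (\<lambda>i. {c i<..<d i}) {..<n} \<longrightarrow> (\<Sum>i<n. d i - c i) < \<delta> \<longrightarrow>
        (\<Sum>i<n. norm (\<gamma> (d i) - \<gamma> (c i))) < \<epsilon>"
    unfolding absolutely_continuous_curve_def by blast
  show "\<exists>\<delta>>0. \<forall>(n::nat) c d. (\<forall>i<n. a \<le> c i \<and> c i \<le> d i \<and> d i \<le> b) \<longrightarrow>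
      disjoint_family_on (\<lambda>i. {c i<..<d i}) {..<n} \<longrightarrow> (\<Sum>i<n. d i - c i) < \<delta> \<longrightarrow>
      (\<Sum>i<n. norm (\<gamma> (l + k * d i) - \<gamma> (l + k * c i))) < \<epsilon>"
  proof (intro exI[of _ "\<delta> / k"] conjI allI impI)
    fix n :: nat and c d :: "nat \<Rightarrow> real"
    assume A: "\<forall>i<n. a \<le> c i \<and> c i \<le> d i \<and> d i \<le> b"
      "disjoint_family_on (\<lambda>i. {c i<..<d i}) {..<n}" "(\<Sum>i<n. d i - c i) < \<delta> / k"
    show "(\<Sum>i<n. norm (\<gamma> (l + k * d i) - \<gamma> (l + k * c i))) < \<epsilon>"
    proof (rule \<delta>(2)[rule_format])
      have "(\<Sum>i<n. l + k * d i - (l + k * c i)) = k * (\<Sum>i<n. d i - c i)"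
        by (simp add: sum_distrib_left right_diff_distrib)
      also have "\<dots> < \<delta>" using A(3) k by (simp add: field_simps)
      finally show "(\<Sum>i<n. l + k * d i - (l + k * c i)) < \<delta>" .
      show "disjoint_family_on (\<lambda>i. {l + k * c i<..<l + k * d i}) {..<n}"
        unfolding disjoint_family_on_def
      proof (intro ballI impI)
        fix i j assume ij: "i \<in> {..<n}" "j \<in> {..<n}" "i \<noteq> j"
        have "(x - l) / k \<in> {c i<..<d i} \<inter> {c j<..<d j}"
          if "x \<in> {l + k * c i<..<l + k * d i} \<inter> {l + k * c j<..<l + k * d j}" for x
          using that k by (auto simp: field_simps)
        then show "{l + k * c i<..<l + k * d i} \<inter> {l + k * c j<..<l + k * d j} = {}"
          using A(2) ij unfolding disjoint_family_on_def by blast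
      qed
    qed (use A(1) k in auto)
  qed (use \<delta> k in auto)
qed

lemma absolutely_continuous_curve_subset:
  assumes "absolutely_continuous_curve a b \<gamma>" "a \<le> a'" "b' \<le> b"
  shows "absolutely_continuous_curve a' b' \<gamma>"
  unfolding absolutely_continuous_curve_def
proof (intro allI impI)
  fix \<epsilon> :: real assume "0 < \<epsilon>"
  with assms(1) obtain \<delta> where \<delta>: "0 < \<delta>" "\<forall>(n::nat) c d.
        (\<forall>i<n. a \<le> c i \<and> c i \<le> d i \<and> d i \<le> b) \<longrightarrow>
        disjoint_family_on (\<lambda>i. {c i<..<d i}) {..<n} \<longrightarrow> (\<Sum>i<n. d i - c i) < \<delta> \<longrightarrow>
        (\<Sum>i<n. norm (\<gamma> (d i) - \<gamma> (c i))) < \<epsilon>"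
    unfolding absolutely_continuous_curve_def by blast
  show "\<exists>\<delta>>0. \<forall>(n::nat) c d. (\<forall>i<n. a' \<le> c i \<and> c i \<le> d i \<and> d i \<le> b') \<longrightarrow>
      disjoint_family_on (\<lambda>i. {c i<..<d i}) {..<n} \<longrightarrow> (\<Sum>i<n. d i - c i) < \<delta> \<longrightarrow>
      (\<Sum>i<n. norm (\<gamma> (d i) - \<gamma> (c i))) < \<epsilon>"
    using assms(2,3) \<delta> by (intro exI[of _ \<delta>]) (auto intro!: \<delta>(2)[rule_format] intro: order_trans)
qed

lemma absolutely_continuous_curve_concat:
  assumes ac1: "absolutely_continuous_curve a c \<gamma>" and ac2: "absolutely_continuous_curve c b \<eta>"
    and eq: "\<gamma> c = \<eta> c" and ab: "a \<le> c" "c \<le> b"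
  shows "absolutely_continuous_curve a b (\<lambda>r. if r \<le> c then \<gamma> r else \<eta> r)"
    (is "absolutely_continuous_curve a b ?\<zeta>")
  unfolding absolutely_continuous_curve_def
proof (intro allI impI)
  fix \<epsilon> :: real assume "0 < \<epsilon>"
  then have e2: "0 < \<epsilon> / 2" by simp
  from ac1 e2 obtain \<delta>1 where \<delta>1: "0 < \<delta>1" "\<forall>(n::nat) s t.
        (\<forall>i<n. a \<le> s i \<and> s i \<le> t i \<and> t i \<le> c) \<longrightarrow>
        disjoint_family_on (\<lambda>i. {s i<..<t i}) {..<n} \<longrightarrow> (\<Sum>i<n. t i - s i) < \<delta>1 \<longrightarrow>
        (\<Sum>i<n. norm (\<gamma> (t i) - \<gamma> (s i))) < \<epsilon> / 2"
    unfolding absolutely_continuous_curve_def by blast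
  from ac2 e2 obtain \<delta>2 where \<delta>2: "0 < \<delta>2" "\<forall>(n::nat) s t.
        (\<forall>i<n. c \<le> s i \<and> s i \<le> t i \<and> t i \<le> b) \<longrightarrow>
        disjoint_family_on (\<lambda>i. {s i<..<t i}) {..<n} \<longrightarrow> (\<Sum>i<n. t i - s i) < \<delta>2 \<longrightarrow>
        (\<Sum>i<n. norm (\<eta> (t i) - \<eta> (s i))) < \<epsilon> / 2"
    unfolding absolutely_continuous_curve_def by blast
  show "\<exists>\<delta>>0. \<forall>(n::nat) s t. (\<forall>i<n. a \<le> s i \<and> s i \<le> t i \<and> t i \<le> b) \<longrightarrow>
      disjoint_family_on (\<lambda>i. {s i<..<t i}) {..<n} \<longrightarrow> (\<Sum>i<n. t i - s i) < \<delta> \<longrightarrow>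
      (\<Sum>i<n. norm (?\<zeta> (t i) - ?\<zeta> (s i))) < \<epsilon>"
  proof (intro exI[of _ "min \<delta>1 \<delta>2"] conjI allI impI)
    fix n :: nat and s t :: "nat \<Rightarrow> real"
    assume A: "\<forall>i<n. a \<le> s i \<and> s i \<le> t i \<and> t i \<le> b"
      "disjoint_family_on (\<lambda>i. {s i<..<t i}) {..<n}" "(\<Sum>i<n. t i - s i) < min \<delta>1 \<delta>2"
    have disj: "disjoint_family_on (\<lambda>i. {f (s i)<..<f (t i)}) {..<n}"
      if "\<And>x y. {f x<..<f y} \<subseteq> {x<..<y}" for f :: "real \<Rightarrow> real"
      unfolding disjoint_family_on_def
    proof (intro ballI impI)
      fix i j assume "i \<in> {..<n}" "j \<in> {..<n}" "i \<noteq> j"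
      then have "{s i<..<t i} \<inter> {s j<..<t j} = {}" using A(2) by (simp add: disjoint_family_on_def)
      then show "{f (s i)<..<f (t i)} \<inter> {f (s j)<..<f (t j)} = {}"
        using that[of "s i" "t i"] that[of "s j" "t j"] by blast
    qed
    have "(\<Sum>i<n. min c (t i) - min c (s i)) \<le> (\<Sum>i<n. t i - s i)"
      using A(1) by (intro sum_mono) (auto simp: min_def)
    then have 1: "(\<Sum>i<n. norm (\<gamma> (min c (t i)) - \<gamma> (min c (s i)))) < \<epsilon> / 2"
      using A(1,3) ab by (intro \<delta>1(2)[rule_format] disj) auto
    have "(\<Sum>i<n. max c (t i) - max c (s i)) \<le> (\<Sum>i<n. t i - s i)"
      using A(1) by (intro sum_mono) (auto simp: max_def)
    then have 2: "(\<Sum>i<n. norm (\<eta> (max c (t i)) - \<eta> (max c (s i)))) < \<epsilon> / 2"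
      using A(1,3) ab by (intro \<delta>2(2)[rule_format] disj) auto
    \<comment> \<open>In this form an increment of the glued curve is the sum of one increment of
      each piece, also on an interval straddling \<open>c\<close>.\<close>
    have "?\<zeta> r = \<gamma> (min c r) + \<eta> (max c r) - \<gamma> c" for r
      using eq by (auto simp: min_def max_def)
    then have "?\<zeta> y - ?\<zeta> x = (\<gamma> (min c y) - \<gamma> (min c x)) + (\<eta> (max c y) - \<eta> (max c x))" for x y
      by (simp add: algebra_simps eq)
    then have "(\<Sum>i<n. norm (?\<zeta> (t i) - ?\<zeta> (s i))) \<le>
        (\<Sum>i<n. norm (\<gamma> (min c (t i)) - \<gamma> (min c (s i))) + norm (\<eta> (max c (t i)) - \<eta> (max c (s i))))"
      by (intro sum_mono) (metis norm_triangle_ineq)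
    also have "\<dots> < \<epsilon>" using 1 2 by (simp add: sum.distrib)
    finally show "(\<Sum>i<n. norm (?\<zeta> (t i) - ?\<zeta> (s i))) < \<epsilon>" .
  qed (use \<delta>1 \<delta>2 in auto)
qed

lemma kinetic_affine:
  fixes \<gamma> :: "real \<Rightarrow> ('a::euclidean_space, 'n::finite) vec"
  assumes ac: "absolutely_continuous_curve (l + k * a) (l + k * b) \<gamma>" and k: "0 < k"
  shows "kinetic m a b (\<lambda>r. \<gamma> (l + k * r)) = ennreal k * kinetic m (l + k * a) (l + k * b) \<gamma>"
proof -
  let ?\<eta> = "\<lambda>r. \<gamma> (l + k * r)"
  let ?F = "\<lambda>s. ennreal (mass_norm_sq m (vector_derivative \<gamma> (at s)))"
  have "kinetic m a b ?\<eta> = (\<integral>\<^sup>+r. ennreal (k\<^sup>2) * (?F (l + k * r) * indicator {a<..<b} r) \<partial>lborel)"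
    unfolding kinetic_def
  \<comment> \<open>The exceptional null set is taken for the reparametrised curve and so needs no
    transport. The derivative of \<open>\<gamma>\<close> is then recovered by the chain rule through
    the inverse affine map.\<close>
  proof (rule nn_integral_cong_AE, rule AE_mp[OF absolutely_continuous_curve_differentiable_AE[OF
        absolutely_continuous_curve_affine[OF ac k]]], intro AE_I2 impI)
    fix r assume r: "r \<in> {a<..<b} \<longrightarrow> ?\<eta> differentiable (at r)"
    show "ennreal (mass_norm_sq m (vector_derivative ?\<eta> (at r))) * indicator {a<..<b} r =
        ennreal (k\<^sup>2) * (?F (l + k * r) * indicator {a<..<b} r)"
    proof (cases "r \<in> {a<..<b}")
      case True
      let ?D = "vector_derivative ?\<eta> (at r)"
      have "(?\<eta> has_vector_derivative ?D) (at r)"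
        using r True by (simp add: vector_derivative_works)
      then have "(?\<eta> has_vector_derivative ?D) (at ((\<lambda>x. (x - l) / k) (l + k * r)))"
        using k by simp
      moreover have "((\<lambda>x. (x - l) / k) has_vector_derivative (1 / k)) (at (l + k * r))"
        using k by (auto intro!: derivative_eq_intros simp: has_real_derivative_iff_has_vector_derivative[symmetric])
      ultimately have "(?\<eta> \<circ> (\<lambda>x. (x - l) / k) has_vector_derivative (1 / k) *\<^sub>R ?D) (at (l + k * r))"
        by (intro vector_diff_chain_at)
      moreover have "?\<eta> \<circ> (\<lambda>x. (x - l) / k) = \<gamma>" using k by (auto simp: fun_eq_iff)
      ultimately have "vector_derivative \<gamma> (at (l + k * r)) = (1 / k) *\<^sub>R ?D"
        by (simp add: vector_derivative_at)
      then have "?D = k *\<^sub>R vector_derivative \<gamma> (at (l + k * r))" using k by simp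
      then show ?thesis by (simp add: mass_norm_sq_scaleR ennreal_mult' mult.assoc)
    qed simp
  qed
  also have "\<dots> = ennreal (k\<^sup>2) * (\<integral>\<^sup>+r\<in>{a<..<b}. ?F (l + k * r) \<partial>lborel)"
    using k by (intro nn_integral_cmult_real) simp
  \<comment> \<open>The substitution uses up one of the two factors k from the squared
    speed.\<close>
  also have "\<dots> = ennreal k * kinetic m (l + k * a) (l + k * b) \<gamma>"
    unfolding kinetic_def nn_integral_Ioo_affine[OF k] using k
    by (simp add: power2_eq_square ennreal_mult mult.assoc)
  finally show ?thesis .
qed

lemma potential_action_affine:
  assumes k: "0 < k"
  shows "potential_action m \<kappa> (l + k * a) (l + k * b) \<gamma> = ennreal k * potential_action m \<kappa> a b (\<lambda>r. \<gamma> (l + k * r))"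
  unfolding potential_action_def nn_integral_Ioo_affine[OF k] ..

lemma action_shift:
  fixes \<gamma> :: "real \<Rightarrow> ('a::euclidean_space, 'n::{finite,linorder}) vec"
  assumes "absolutely_continuous_curve (l + a) (l + b) \<gamma>"
  shows "action m \<kappa> a b (\<lambda>r. \<gamma> (l + r)) = action m \<kappa> (l + a) (l + b) \<gamma>"
  using kinetic_affine[of l 1 a b \<gamma> m] potential_action_affine[of 1 m \<kappa> l a b \<gamma>] assms
  by (simp add: action_eq)

lemma le_INF_add_INF:
  fixes f g :: "_ \<Rightarrow> ennreal"
  assumes "\<And>i j. i \<in> I \<Longrightarrow> j \<in> J \<Longrightarrow> a \<le> f i + g j"
  shows "a \<le> (INF i\<in>I. f i) + (INF j\<in>J. g j)"
proof (rule ennreal_le_epsilon)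
  fix e :: real assume e: "0 < e" and fin: "(INF i\<in>I. f i) + (INF j\<in>J. g j) < top"
  have less: "X < X + ennreal r" if "X < top" "0 < r" for X r
    using that by (cases X) (auto simp: ennreal_plus[symmetric] ennreal_less_iff simp del: ennreal_plus)
  have ex: "\<exists>i\<in>I. f i \<le> (INF i\<in>I. f i) + ennreal (e / 2)" if "(INF i\<in>I. f i) < top" for f :: "_ \<Rightarrow> ennreal" and I
  proof -
    have "(INF i\<in>I. f i) < (INF i\<in>I. f i) + ennreal (e / 2)"
      using less[OF that, of "e / 2"] e by simp
    then show ?thesis unfolding INF_less_iff by (auto intro: less_imp_le)
  qed
  obtain i j where ij: "i \<in> I" "f i \<le> (INF i\<in>I. f i) + ennreal (e / 2)"
    "j \<in> J" "g j \<le> (INF j\<in>J. g j) + ennreal (e / 2)"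
    using ex[of f I] ex[of g J] fin by auto
  have "a \<le> f i + g j" using assms ij by simp
  also have "\<dots> \<le> ((INF i\<in>I. f i) + ennreal (e / 2)) + ((INF j\<in>J. g j) + ennreal (e / 2))"
    using ij by (intro add_mono)
  also have "\<dots> = (INF i\<in>I. f i) + (INF j\<in>J. g j) + (ennreal (e / 2) + ennreal (e / 2))"
    by (simp add: ac_simps)
  also have "ennreal (e / 2) + ennreal (e / 2) = ennreal e"
    using e by (subst ennreal_plus[symmetric]) auto
  finally show "a \<le> (INF i\<in>I. f i) + (INF j\<in>J. g j) + ennreal e" .
qed

lemma action_potential_time_concat:
  fixes x y z :: "('a::euclidean_space, 'n::{finite,linorder}) vec"
  assumes "0 \<le> s" "0 \<le> t"
  shows "action_potential_time m \<kappa> x z (s + t) \<le> action_potential_time m \<kappa> x y s + action_potential_time m \<kappa> y z t"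
  unfolding action_potential_time_def[of _ _ x y] action_potential_time_def[of _ _ y z]
proof (rule le_INF_add_INF)
  fix \<gamma> \<eta> assume "\<gamma> \<in> curves x y s" "\<eta> \<in> curves y z t"
  then have g: "absolutely_continuous_curve 0 s \<gamma>" "\<gamma> 0 = x" "\<gamma> s = y"
    and h: "absolutely_continuous_curve 0 t \<eta>" "\<eta> 0 = y" "\<eta> t = z" by (auto simp: curves_def)
  define \<eta>' where "\<eta>' = (\<lambda>r. \<eta> (- s + r))"
  have h': "absolutely_continuous_curve s (s + t) \<eta>'"
    using absolutely_continuous_curve_affine[of "- s" 1 s "s + t" \<eta>] h(1) by (simp add: \<eta>'_def)
  define \<zeta> where "\<zeta> = (\<lambda>r. if r \<le> s then \<gamma> r else \<eta>' r)"
  have "\<zeta> \<in> curves x z (s + t)"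
    unfolding curves_def \<zeta>_def
    using absolutely_continuous_curve_concat[OF g(1) h'] assms g h by (auto simp: \<eta>'_def)
  then have "action_potential_time m \<kappa> x z (s + t) \<le> action m \<kappa> 0 (s + t) \<zeta>"
    unfolding action_potential_time_def by (rule INF_lower)
  also have "\<dots> = action m \<kappa> 0 s \<zeta> + action m \<kappa> s (s + t) \<zeta>"
    using assms by (intro action_split) auto
  also have "action m \<kappa> 0 s \<zeta> = action m \<kappa> 0 s \<gamma>"
    by (rule action_cong) (auto simp: \<zeta>_def)
  also have "action m \<kappa> s (s + t) \<zeta> = action m \<kappa> s (s + t) \<eta>'"
    by (rule action_cong) (auto simp: \<zeta>_def)
  also have "\<dots> = action m \<kappa> 0 t \<eta>"
    using action_shift[of "- s" s "s + t" \<eta> m \<kappa>] h(1) by (simp add: \<eta>'_def)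
  finally show "action_potential_time m \<kappa> x z (s + t) \<le> action m \<kappa> 0 s \<gamma> + action m \<kappa> 0 t \<eta>" .
qed

text \<open>The converse of concatenation for a single curve; the intermediate point is its position
  at time s.\<close>

lemma curves_split:
  fixes x z :: "('a::euclidean_space, 'n::{finite,linorder}) vec"
  assumes \<gamma>: "\<gamma> \<in> curves x z (s + t)" and st: "0 \<le> s" "0 \<le> t"
  shows "action_potential_time m \<kappa> x (\<gamma> s) s + action_potential_time m \<kappa> (\<gamma> s) z t \<le> action m \<kappa> 0 (s + t) \<gamma>"
proof -
  have g: "absolutely_continuous_curve 0 (s + t) \<gamma>" "\<gamma> 0 = x" "\<gamma> (s + t) = z"
    using \<gamma> by (auto simp: curves_def)
  have ac: "absolutely_continuous_curve 0 s \<gamma>" "absolutely_continuous_curve s (s + t) \<gamma>"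
    using absolutely_continuous_curve_subset[OF g(1)] st by auto
  have "\<gamma> \<in> curves x (\<gamma> s) s" using ac g by (auto simp: curves_def)
  moreover have "(\<lambda>r. \<gamma> (s + r)) \<in> curves (\<gamma> s) z t"
    using absolutely_continuous_curve_affine[of s 1 0 t \<gamma>] ac g by (auto simp: curves_def)
  ultimately have "action_potential_time m \<kappa> x (\<gamma> s) s + action_potential_time m \<kappa> (\<gamma> s) z t
      \<le> action m \<kappa> 0 s \<gamma> + action m \<kappa> 0 t (\<lambda>r. \<gamma> (s + r))"
    unfolding action_potential_time_def by (intro add_mono INF_lower)
  also have "action m \<kappa> 0 t (\<lambda>r. \<gamma> (s + r)) = action m \<kappa> s (s + t) \<gamma>"
    using action_shift[of s 0 t \<gamma> m \<kappa>] ac by simp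
  finally show ?thesis using action_split[of 0 s "s + t" m \<kappa> \<gamma>] st by simp
qed

text \<open>Slowing a curve down by \<theta> keeps its end points, divides the kinetic part by
  \<theta> and multiplies the potential part by \<theta>. For \<theta> \<ge> 1 both factors are at
  most \<theta>.\<close>

lemma action_potential_time_dilate:
  fixes x y :: "('a::euclidean_space, 'n::{finite,linorder}) vec"
  assumes \<theta>: "1 \<le> \<theta>"
  shows "action_potential_time m \<kappa> x y (\<theta> * T) \<le> ennreal \<theta> * action_potential_time m \<kappa> x y T"
proof -
  have l0: "0 < \<theta>" using \<theta> by simp
  have inv: "ennreal \<theta> * (ennreal (1 / \<theta>) * y) = y" "ennreal (1 / \<theta>) * (ennreal \<theta> * y) = y" for y
    using l0 by (simp_all add: mult.assoc[symmetric] ennreal_mult[symmetric])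
  \<comment> \<open>With the factor on the left the infimum stands alone on the right, so the bound
    can be checked curve by curve.\<close>
  have "ennreal (1 / \<theta>) * action_potential_time m \<kappa> x y (\<theta> * T) \<le> action_potential_time m \<kappa> x y T"
    unfolding action_potential_time_def[of _ _ x y T]
  proof (rule INF_greatest)
    fix \<gamma> assume "\<gamma> \<in> curves x y T"
    then have g: "absolutely_continuous_curve 0 T \<gamma>" "\<gamma> 0 = x" "\<gamma> T = y" by (auto simp: curves_def)
    let ?\<eta> = "\<lambda>r. \<gamma> (0 + 1 / \<theta> * r)"
    have ac: "absolutely_continuous_curve (0 + 1 / \<theta> * 0) (0 + 1 / \<theta> * (\<theta> * T)) \<gamma>"
      using g l0 by simp
    have "?\<eta> \<in> curves x y (\<theta> * T)"
      using absolutely_continuous_curve_affine[OF ac] g l0 by (auto simp: curves_def)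
    then have "action_potential_time m \<kappa> x y (\<theta> * T) \<le> action m \<kappa> 0 (\<theta> * T) ?\<eta>"
      unfolding action_potential_time_def by (rule INF_lower)
    also have "\<dots> = ennreal (1 / \<theta>) * kinetic m 0 T \<gamma> / 2 + ennreal \<theta> * potential_action m \<kappa> 0 T \<gamma>"
      unfolding action_eq using kinetic_affine[OF ac, of m] potential_action_affine[of "1 / \<theta>" m \<kappa> 0 0 "\<theta> * T" \<gamma>] l0
      by (simp add: inv)
    also have "\<dots> \<le> ennreal \<theta> * kinetic m 0 T \<gamma> / 2 + ennreal \<theta> * potential_action m \<kappa> 0 T \<gamma>"
      using \<theta> by (intro add_mono divide_right_mono_ennreal mult_right_mono ennreal_leI) (auto simp: field_simps intro: order_trans)
    also have "\<dots> = ennreal \<theta> * action m \<kappa> 0 T \<gamma>"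
      by (simp add: action_eq distrib_left ennreal_times_divide)
    finally have "ennreal (1 / \<theta>) * action_potential_time m \<kappa> x y (\<theta> * T) \<le> ennreal (1 / \<theta>) * (ennreal \<theta> * action m \<kappa> 0 T \<gamma>)"
      by (intro mult_left_mono) auto
    then show "ennreal (1 / \<theta>) * action_potential_time m \<kappa> x y (\<theta> * T) \<le> action m \<kappa> 0 T \<gamma>"
      by (simp add: inv)
  qed
  then have "ennreal \<theta> * (ennreal (1 / \<theta>) * action_potential_time m \<kappa> x y (\<theta> * T)) \<le> ennreal \<theta> * action_potential_time m \<kappa> x y T"
    by (intro mult_left_mono) auto
  then show ?thesis by (simp add: inv)
qed

section \<open>Symmetry, coercivity and power-like separation\<close>

lemma norm_vec_sq: "(norm (v :: ('a::euclidean_space, 'n::finite) vec))\<^sup>2 = (\<Sum>i\<in>UNIV. (norm (v $ i))\<^sup>2)"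
  by (simp add: norm_vec_def L2_set_def sum_nonneg)

lemma absolutely_continuous_curve_isometry:
  fixes A :: "'a::euclidean_space \<Rightarrow> 'a" and \<gamma> :: "real \<Rightarrow> ('a, 'n::{finite,linorder}) vec"
  assumes A: "orthogonal_transformation A" and ac: "absolutely_continuous_curve a b \<gamma>"
  shows "absolutely_continuous_curve a b (\<lambda>s. \<chi> i. A (\<gamma> s $ i) + r)"
    and "action m \<kappa> a b (\<lambda>s. \<chi> i. A (\<gamma> s $ i) + r) = action m \<kappa> a b \<gamma>"
proof -
  define L :: "('a, 'n) vec \<Rightarrow> ('a, 'n) vec" where "L v = (\<chi> i. A (v $ i))" for v
  have linA: "linear A" using A by (simp add: orthogonal_transformation_def)
  have nA: "norm (A v) = norm v" for v using orthogonal_transformation_norm[OF A] .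
  have "linear L"
    by (rule linearI) (simp_all add: L_def vec_eq_iff linear_add[OF linA] linear_cmul[OF linA])
  then have blL: "bounded_linear L" by (simp add: linear_conv_bounded_linear)
  have nL: "norm (L v) = norm v" for v by (simp add: norm_vec_def L_def nA)
  have mL: "mass_norm_sq m (L v) = mass_norm_sq m v" for v by (simp add: mass_norm_sq_def L_def nA)
  have eq: "(\<lambda>s. \<chi> i. A (\<gamma> s $ i) + r) = (\<lambda>s. L (\<gamma> s) + (\<chi> i. r))"
    by (simp add: L_def vec_eq_iff fun_eq_iff)
  show ac': "absolutely_continuous_curve a b (\<lambda>s. \<chi> i. A (\<gamma> s $ i) + r)"
    unfolding eq
    by (rule absolutely_continuous_curve_lipschitz_image[OF ac, of 1])
      (simp_all add: bounded_linear.linear[OF blL, THEN linear_diff, symmetric] nL)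
  have "kinetic m a b (\<lambda>s. L (\<gamma> s) + (\<chi> i. r)) = kinetic m a b \<gamma>"
    unfolding kinetic_def
  proof (rule nn_integral_cong_AE, rule AE_mp[OF absolutely_continuous_curve_differentiable_AE[OF ac]],
      intro AE_I2 impI)
    fix s assume s: "s \<in> {a<..<b} \<longrightarrow> \<gamma> differentiable (at s)"
    show "ennreal (mass_norm_sq m (vector_derivative (\<lambda>s. L (\<gamma> s) + (\<chi> i. r)) (at s))) * indicator {a<..<b} s =
        ennreal (mass_norm_sq m (vector_derivative \<gamma> (at s))) * indicator {a<..<b} s"
    proof (cases "s \<in> {a<..<b}")
      case True
      with s have "(\<gamma> has_vector_derivative vector_derivative \<gamma> (at s)) (at s)"
        by (simp add: vector_derivative_works)
      from bounded_linear.has_vector_derivative[OF blL this]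
      have "((\<lambda>s. L (\<gamma> s) + (\<chi> i. r)) has_vector_derivative L (vector_derivative \<gamma> (at s))) (at s)"
        by (auto intro!: derivative_eq_intros)
      then show ?thesis by (simp add: vector_derivative_at mL)
    qed simp
  qed
  moreover have "potential m \<kappa> (L v + (\<chi> i. r)) = potential m \<kappa> v" for v
  proof -
    have "A (v $ i) = A (v $ j) \<longleftrightarrow> v $ i = v $ j" for i j
      using nA[of "v $ i - v $ j"] by (auto simp: linear_diff[OF linA])
    moreover have "norm (A (v $ i) - A (v $ j)) = norm (v $ i - v $ j)" for i j
      using nA[of "v $ i - v $ j"] by (simp add: linear_diff[OF linA])
    ultimately show ?thesis unfolding potential_def by (intro sum.cong) (auto simp: L_def)
  qed
  ultimately show "action m \<kappa> a b (\<lambda>s. \<chi> i. A (\<gamma> s $ i) + r) = action m \<kappa> a b \<gamma>"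
    unfolding eq by (simp only: action_eq potential_action_def)
qed

text \<open>Half the smallest mass works, by \<open>displacement_le_energy\<close>. The parameter
  \<alpha> is left free: the choice |y - x| / T gives the quadratic bound, while a fixed large
  \<alpha> gives growth in |y - x| of any prescribed slope, which is what confines the minimisers
  later.\<close>

lemma ex_coercivity_constant:
  fixes m :: "'n::{finite,linorder} \<Rightarrow> real"
  assumes m: "\<And>i. m i > 0"
  shows "\<exists>\<mu>>0. \<forall>(x :: ('a::euclidean_space, 'n) vec) y T \<alpha>. 0 \<le> T \<longrightarrow>
    ennreal (\<mu> * (2 * \<alpha> * norm (y - x) - \<alpha>\<^sup>2 * T)) \<le> action_potential_time m \<kappa> x y T"
proof -
  define \<mu> where "\<mu> = Min (range m)"
  have "\<mu> \<in> range m" unfolding \<mu>_def by (intro Min_in) auto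
  then have \<mu>: "\<mu> > 0" using m by auto
  have \<mu>_le: "\<mu> \<le> m i" for i by (simp add: \<mu>_def)
  have ms: "\<mu> * (norm v)\<^sup>2 \<le> mass_norm_sq m v" for v :: "('a, 'n) vec"
    unfolding norm_vec_sq mass_norm_sq_def sum_distrib_left
    by (intro sum_mono mult_right_mono \<mu>_le) auto
  have "ennreal (\<mu> / 2 * (2 * \<alpha> * norm (y - x) - \<alpha>\<^sup>2 * T)) \<le> action_potential_time m \<kappa> x y T"
    if T: "0 \<le> T" for x y :: "('a, 'n) vec" and T \<alpha>
    unfolding action_potential_time_def
  proof (rule INF_greatest)
    fix \<gamma> assume "\<gamma> \<in> curves x y T"
    then have g: "absolutely_continuous_curve 0 T \<gamma>" "\<gamma> 0 = x" "\<gamma> T = y" by (auto simp: curves_def)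
    have "ennreal (\<mu> * (2 * \<alpha> * norm (y - x) - \<alpha>\<^sup>2 * T)) = ennreal \<mu> * ennreal (2 * \<alpha> * norm (y - x) - \<alpha>\<^sup>2 * T)"
      using \<mu> by (simp add: ennreal_mult')
    also have "\<dots> \<le> ennreal \<mu> * (\<integral>\<^sup>+s\<in>{0..T}. ennreal ((norm (vector_derivative \<gamma> (at s within {0..T})))\<^sup>2) \<partial>lborel)"
      using displacement_le_energy[OF g(1) T, of \<alpha>] g by (intro mult_left_mono) auto
    also have "\<dots> = (\<integral>\<^sup>+s. ennreal \<mu> * (ennreal ((norm (vector_derivative \<gamma> (at s within {0..T})))\<^sup>2) * indicator {0..T} s) \<partial>lborel)"
      using \<mu> by (simp only: nn_integral_cmult_real)
    also have "\<dots> \<le> (\<integral>\<^sup>+s\<in>{0..T}. ennreal (mass_norm_sq m (vector_derivative \<gamma> (at s within {0..T}))) \<partial>lborel)"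
    proof (rule nn_integral_mono)
      fix s
      show "ennreal \<mu> * (ennreal ((norm (vector_derivative \<gamma> (at s within {0..T})))\<^sup>2) * indicator {0..T} s) \<le>
          ennreal (mass_norm_sq m (vector_derivative \<gamma> (at s within {0..T}))) * indicator {0..T} s"
        using ms[of "vector_derivative \<gamma> (at s within {0..T})"] \<mu>
        by (auto simp: indicator_def ennreal_mult'[symmetric] intro!: ennreal_leI)
    qed
    finally have "ennreal (\<mu> * (2 * \<alpha> * norm (y - x) - \<alpha>\<^sup>2 * T)) / 2 \<le> action m \<kappa> 0 T \<gamma>"
      unfolding action_def by (intro add_increasing2 divide_right_mono_ennreal) auto
    moreover have "ennreal (\<mu> / 2 * (2 * \<alpha> * norm (y - x) - \<alpha>\<^sup>2 * T)) = ennreal (\<mu> * (2 * \<alpha> * norm (y - x) - \<alpha>\<^sup>2 * T)) / 2"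
    proof -
      have "ennreal (z / 2) = ennreal z / 2" for z
        using divide_ennreal[of z 2] by (cases "0 \<le> z") (auto simp: ennreal_neg)
      then show ?thesis by (metis times_divide_eq_left)
    qed
    ultimately show "ennreal (\<mu> / 2 * (2 * \<alpha> * norm (y - x) - \<alpha>\<^sup>2 * T)) \<le> action m \<kappa> 0 T \<gamma>" by simp
  qed
  then show ?thesis using \<mu> by (intro exI[of _ "\<mu> / 2"]) auto
qed

text \<open>Meant for curves that are Lipschitz away from a power-like singularity: a monotone H of
  small total rise absorbs the singular part, the constant K the rest. Increments of H over disjoint
  intervals add up to at most its total rise.\<close>

lemma absolutely_continuous_curve_criterion:
  fixes \<gamma> :: "real \<Rightarrow> 'b::real_normed_vector"
  assumes ab: "a \<le> b"
    and le: "\<And>\<epsilon>. 0 < \<epsilon> \<Longrightarrow> \<exists>H K. mono_on {a..b} H \<and> H b - H a < \<epsilon> \<and> 0 \<le> K \<and>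
      (\<forall>c d. a \<le> c \<longrightarrow> c \<le> d \<longrightarrow> d \<le> b \<longrightarrow> norm (\<gamma> d - \<gamma> c) \<le> H d - H c + K * (d - c))"
  shows "absolutely_continuous_curve a b \<gamma>"
  unfolding absolutely_continuous_curve_def
proof (intro allI impI)
  fix \<epsilon> :: real assume e: "0 < \<epsilon>"
  obtain H :: "real \<Rightarrow> real" and K where HK: "mono_on {a..b} H" "H b - H a < \<epsilon> / 2" "0 \<le> K"
    "\<And>c d. a \<le> c \<Longrightarrow> c \<le> d \<Longrightarrow> d \<le> b \<Longrightarrow> norm (\<gamma> d - \<gamma> c) \<le> H d - H c + K * (d - c)"
    using le[of "\<epsilon> / 2"] e by auto
  define \<delta> where "\<delta> = \<epsilon> / (2 * (K + 1))"
  have \<delta>: "0 < \<delta>" using e HK(3) by (simp add: \<delta>_def)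
  have "(K + 1) * \<delta> = \<epsilon> / 2" using HK(3) by (simp add: \<delta>_def field_simps)
  then have K\<delta>: "K * \<delta> \<le> \<epsilon> / 2" using \<delta> by (simp add: distrib_right)
  show "\<exists>\<delta>>0. \<forall>(n::nat) c d. (\<forall>i<n. a \<le> c i \<and> c i \<le> d i \<and> d i \<le> b) \<longrightarrow>
      disjoint_family_on (\<lambda>i. {c i<..<d i}) {..<n} \<longrightarrow> (\<Sum>i<n. d i - c i) < \<delta> \<longrightarrow>
      (\<Sum>i<n. norm (\<gamma> (d i) - \<gamma> (c i))) < \<epsilon>"
  proof (intro exI[of _ \<delta>] conjI allI impI \<delta>)
    fix n :: nat and c d :: "nat \<Rightarrow> real"
    assume A: "\<forall>i<n. a \<le> c i \<and> c i \<le> d i \<and> d i \<le> b"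
      "disjoint_family_on (\<lambda>i. {c i<..<d i}) {..<n}" "(\<Sum>i<n. d i - c i) < \<delta>"
    have "(\<Sum>i<n. norm (\<gamma> (d i) - \<gamma> (c i))) \<le> (\<Sum>i<n. (H (d i) - H (c i)) + K * (d i - c i))"
      using A(1) by (intro sum_mono HK(4)) auto
    also have "\<dots> = (\<Sum>i<n. H (d i) - H (c i)) + K * (\<Sum>i<n. d i - c i)"
      by (simp only: sum.distrib sum_distrib_left)
    also have "\<dots> \<le> (H b - H a) + K * \<delta>"
      using A HK ab by (intro add_mono mult_left_mono sum_increments_le[where g = H and c = c and d = d]) auto
    also have "\<dots> < \<epsilon>" using HK(2) K\<delta> by simp
    finally show "(\<Sum>i<n. norm (\<gamma> (d i) - \<gamma> (c i))) < \<epsilon>" .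
  qed
qed

text \<open>The power is cut at \<tau>. Below the cut its total rise is \<tau>^a; above it the slope
  is at most \<tau>^(a - 1), which follows from (d / c')^a \<le> d / c'.\<close>

lemma powr_increment_le:
  fixes a :: real
  assumes a: "0 < a" "a \<le> 1" and \<tau>: "0 < \<tau>" and cd: "0 \<le> c" "c \<le> d"
  shows "d powr a - c powr a \<le> (min d \<tau>) powr a - (min c \<tau>) powr a + \<tau> powr (a - 1) * (d - c)"
proof (cases "d \<le> \<tau>")
  case True
  then show ?thesis using cd by simp
next
  case False
  define c' where "c' = max c \<tau>"
  have c': "0 < c'" "\<tau> \<le> c'" "c' \<le> d" "c \<le> c'" using \<tau> False cd by (auto simp: c'_def)
  have "(d / c') powr a \<le> (d / c') powr 1" using c' a by (intro powr_mono) auto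
  then have 1: "d powr a / c' powr a \<le> d / c'" using c' by (simp add: powr_divide)
  have "d powr a - c' powr a = c' powr a * (d powr a / c' powr a - 1)" using c' by (simp add: field_simps)
  also have "\<dots> \<le> c' powr a * (d / c' - 1)" using 1 by (intro mult_left_mono) auto
  also have "\<dots> = c' powr (a - 1) * (d - c')" using c' by (simp add: powr_diff field_simps)
  also have "\<dots> \<le> \<tau> powr (a - 1) * (d - c)"
    using c' a \<tau> by (intro mult_mono powr_mono2') auto
  finally show ?thesis using False cd by (auto simp: c'_def max_def min_def split: if_splits)
qed

text \<open>It vanishes at both ends, so adding a multiple of it to a curve keeps the end points,
  and it grows like s^a away from them, fast enough to pull the bodies out of a collision.\<close>

definition bump :: "real \<Rightarrow> real \<Rightarrow> real \<Rightarrow> real" where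
  "bump a T s = (min s (T - s)) powr a"

lemma bump_eq: "0 < a \<Longrightarrow> 0 \<le> s \<Longrightarrow> s \<le> T \<Longrightarrow> bump a T s = min (s powr a) ((T - s) powr a)"
  by (cases "s \<le> T - s") (auto simp: bump_def min_def powr_mono2 intro: antisym)

text \<open>The rise of the left power plus the fall of the right one is a majorant that increases
  with time; cutting both at \<tau> yields the H and K of the criterion.\<close>

lemma bump_increment_le:
  assumes a: "0 < a" "a \<le> 1" and \<tau>: "0 < \<tau>" and cd: "0 \<le> c" "c \<le> d" "d \<le> T"
  shows "\<bar>bump a T d - bump a T c\<bar> \<le>
    ((min d \<tau>) powr a - (min (T - d) \<tau>) powr a) - ((min c \<tau>) powr a - (min (T - c) \<tau>) powr a)
    + 2 * \<tau> powr (a - 1) * (d - c)"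
proof -
  have "\<bar>bump a T d - bump a T c\<bar> \<le> (d powr a - c powr a) + ((T - c) powr a - (T - d) powr a)"
  proof -
    have "c powr a \<le> d powr a" "(T - d) powr a \<le> (T - c) powr a"
      using a cd by (auto intro!: powr_mono2)
    then show ?thesis using a cd by (auto simp: bump_eq min_def)
  qed
  then show ?thesis
    using powr_increment_le[OF a \<tau> cd(1,2)] powr_increment_le[OF a \<tau>, of "T - d" "T - c"] cd
    by (simp add: algebra_simps)
qed

lemma absolutely_continuous_curve_bump:
  fixes u v w :: "'b::real_normed_vector"
  assumes a: "0 < a" "a \<le> 1" and T: "0 < T"
  shows "absolutely_continuous_curve 0 T (\<lambda>s. u + s *\<^sub>R v + bump a T s *\<^sub>R w)"
proof (rule absolutely_continuous_curve_criterion)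
  fix \<epsilon> :: real assume e: "0 < \<epsilon>"
  let ?W = "norm w + 1"
  \<comment> \<open>Solves \<tau>^a = \<epsilon> / (4 W) with W = norm w + 1. The singular parts at
    the two ends then contribute at most 2 W \<tau>^a = \<epsilon> / 2.\<close>
  define \<tau> where "\<tau> = (\<epsilon> / (4 * ?W)) powr (1 / a)"
  have W: "?W > 0" by (simp add: add_nonneg_pos)
  have root: "0 < r powr (1 / a)" "(r powr (1 / a)) powr a = r" if "0 < r" for r :: real
    using that a by (simp_all add: powr_powr)
  have "\<epsilon> / (4 * ?W) > 0" using e W by simp
  from root[OF this] have \<tau>: "0 < \<tau>" "\<tau> powr a = \<epsilon> / (4 * ?W)" unfolding \<tau>_def .
  define H where "H s = ?W * ((min s \<tau>) powr a - (min (T - s) \<tau>) powr a)" for s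
  define K where "K = ?W * (2 * \<tau> powr (a - 1)) + norm v"
  have "H T - H 0 = ?W * (2 * (min T \<tau>) powr a)" using T \<tau> by (simp add: H_def algebra_simps)
  also have "\<dots> \<le> ?W * (2 * \<tau> powr a)" using W T \<tau> a by (intro mult_left_mono powr_mono2) auto
  also have "\<dots> = \<epsilon> / 2" using W unfolding \<tau>(2) by (simp add: field_simps)
  finally have HT: "H T - H 0 < \<epsilon>" using e by simp
  moreover have "mono_on {0..T} H"
    unfolding H_def using W a
    by (intro mono_onI mult_left_mono diff_mono powr_mono2) (use \<tau> in auto)
  moreover have "norm (u + d *\<^sub>R v + bump a T d *\<^sub>R w - (u + c *\<^sub>R v + bump a T c *\<^sub>R w)) \<le> H d - H c + K * (d - c)"
    if cd: "0 \<le> c" "c \<le> d" "d \<le> T" for c d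
  proof -
    have "u + d *\<^sub>R v + bump a T d *\<^sub>R w - (u + c *\<^sub>R v + bump a T c *\<^sub>R w) =
        (d - c) *\<^sub>R v + (bump a T d - bump a T c) *\<^sub>R w" by (simp add: algebra_simps)
    also have "norm \<dots> \<le> (d - c) * norm v + \<bar>bump a T d - bump a T c\<bar> * norm w"
      using norm_triangle_ineq[of "(d - c) *\<^sub>R v" "(bump a T d - bump a T c) *\<^sub>R w"] cd by simp
    also have "\<bar>bump a T d - bump a T c\<bar> * norm w \<le> \<bar>bump a T d - bump a T c\<bar> * ?W"
      by (intro mult_left_mono) auto
    also have "\<dots> \<le> (((min d \<tau>) powr a - (min (T - d) \<tau>) powr a) - ((min c \<tau>) powr a - (min (T - c) \<tau>) powr a)
        + 2 * \<tau> powr (a - 1) * (d - c)) * ?W"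
      by (intro mult_right_mono bump_increment_le a \<tau> cd) (use W in auto)
    finally show ?thesis by (simp add: H_def K_def algebra_simps)
  qed
  moreover have "0 \<le> K" using W by (simp add: K_def)
  ultimately show "\<exists>H K. mono_on {0..T} H \<and> H T - H 0 < \<epsilon> \<and> 0 \<le> K \<and>
      (\<forall>c d. 0 \<le> c \<longrightarrow> c \<le> d \<longrightarrow> d \<le> T \<longrightarrow>
        norm (u + d *\<^sub>R v + bump a T d *\<^sub>R w - (u + c *\<^sub>R v + bump a T c *\<^sub>R w)) \<le> H d - H c + K * (d - c))"
    by blast
qed (use T in auto)

text \<open>The midpoint is a kink. Adding the singularities of both ends gives one integrable bound
  that serves both halves.\<close>

lemma bump_has_derivative:
  assumes s: "0 < s" "s < T" "s \<noteq> T / 2"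
  shows "\<exists>D. (bump a T has_real_derivative D) (at s) \<and> D\<^sup>2 \<le> a\<^sup>2 * (s powr (2 * a - 2) + (T - s) powr (2 * a - 2))"
proof (cases "s < T / 2")
  case True
  have "((\<lambda>s. s powr a) has_real_derivative a * s powr (a - 1)) (at s)"
    using s by (intro has_real_derivative_powr)
  then have "(bump a T has_real_derivative a * s powr (a - 1)) (at s)"
    by (rule has_field_derivative_transform_within_open[of _ _ _ "{..<T / 2}"])
      (use True in \<open>auto simp: bump_def min_def\<close>)
  moreover have "(a * s powr (a - 1))\<^sup>2 = a\<^sup>2 * s powr (2 * a - 2)"
    using s by (simp add: power_mult_distrib powr_power algebra_simps)
  ultimately show ?thesis by (intro exI[of _ "a * s powr (a - 1)"]) (auto intro!: mult_left_mono)
next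
  case False
  have "((\<lambda>s. (T - s) powr a) has_real_derivative - (a * (T - s) powr (a - 1))) (at s)"
    using s by (auto intro!: derivative_eq_intros)
  then have "(bump a T has_real_derivative - (a * (T - s) powr (a - 1))) (at s)"
    by (rule has_field_derivative_transform_within_open[of _ _ _ "{T / 2<..}"])
      (use s False in \<open>auto simp: bump_def min_def\<close>)
  moreover have "(- (a * (T - s) powr (a - 1)))\<^sup>2 = a\<^sup>2 * (T - s) powr (2 * a - 2)"
    using s by (simp add: power_mult_distrib powr_power algebra_simps)
  ultimately show ?thesis by (intro exI[of _ "- (a * (T - s) powr (a - 1))"]) (auto intro!: mult_left_mono)
qed

lemma nn_integral_singularities:
  assumes p: "p < 1" and T: "0 < T"
  shows "(\<integral>\<^sup>+s\<in>{0..T}. ennreal (s powr - p + (T - s) powr - p) \<partial>lborel) = ennreal (2 * (T powr (1 - p) / (1 - p)))"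
proof -
  have "((\<lambda>s. s powr - p) has_integral (T powr (- p + 1) / (- p + 1))) {0..T}"
    using p T by (intro has_integral_powr_from_0) auto
  then have I: "((\<lambda>s. s powr - p) has_integral (T powr (1 - p) / (1 - p))) {0..T}"
    by (simp add: add.commute)
  have "((\<lambda>s. (- s) powr - p) has_integral (T powr (1 - p) / (1 - p))) {- T..- 0}"
    by (rule has_integral_reflect_real[THEN iffD2]) (use I T in auto)
  then have "((\<lambda>s. (- s) powr - p) has_integral (T powr (1 - p) / (1 - p))) (cbox (- T) 0)" by simp
  from has_integral_affinity[OF this, of 1 "- T"]
  have "((\<lambda>s. (T - s) powr - p) has_integral (T powr (1 - p) / (1 - p))) {0..T}"
    by (simp add: box_real)
  from has_integral_add[OF I this]
  have "((\<lambda>s. s powr - p + (T - s) powr - p) has_integral (2 * (T powr (1 - p) / (1 - p)))) {0..T}"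
    by (simp only: mult_2)
  then show ?thesis by (intro nn_integral_has_integral_lebesgue') auto
qed

lemma mass_norm_sq_add_le:
  assumes "\<And>i. m i > 0"
  shows "mass_norm_sq m (u + v) \<le> 2 * mass_norm_sq m u + 2 * mass_norm_sq m v"
proof -
  have "(norm (u $ i + v $ i))\<^sup>2 \<le> 2 * (norm (u $ i))\<^sup>2 + 2 * (norm (v $ i))\<^sup>2" for i
  proof -
    have "(norm (u $ i + v $ i))\<^sup>2 \<le> (norm (u $ i) + norm (v $ i))\<^sup>2"
      by (intro power_mono norm_triangle_ineq) auto
    also have "\<dots> \<le> 2 * (norm (u $ i))\<^sup>2 + 2 * (norm (v $ i))\<^sup>2"
      using zero_le_power2[of "norm (u $ i) - norm (v $ i)"] by (simp add: power2_sum power2_diff)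
    finally show ?thesis .
  qed
  then have "mass_norm_sq m (u + v) \<le> (\<Sum>i\<in>UNIV. m i * (2 * (norm (u $ i))\<^sup>2 + 2 * (norm (v $ i))\<^sup>2))"
    unfolding mass_norm_sq_def using assms by (intro sum_mono mult_left_mono) (auto simp: less_imp_le)
  also have "\<dots> = 2 * mass_norm_sq m u + 2 * mass_norm_sq m v"
    by (simp add: mass_norm_sq_def sum_distrib_left sum.distrib algebra_simps)
  finally show ?thesis .
qed

section \<open>Upper bound for the action potential\<close>

text \<open>Along the straight segment from \<open>x\<close> to \<open>c\<close>, with the bodies spread out in direction \<open>e\<close>
  proportionally to their rank, mutual distances are at least \<open>bump\<close>. The exponent \<open>1 / (1 + \<kappa>)\<close> is that
  of parabolic motions; it makes the singularities of kinetic and potential energy agree.\<close>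

lemma action_potential_time_ordered_le:
  fixes m :: "'n::{finite,linorder} \<Rightarrow> real" and x c :: "('a::euclidean_space, 'n) vec" and \<sigma> :: "'n \<Rightarrow> nat"
  assumes m: "\<And>i. m i > 0" and \<kappa>: "0 < \<kappa>" "\<kappa> < 1" and e: "norm e = 1" and T: "0 < T"
    and \<sigma>: "inj \<sigma>" "\<And>i. \<sigma> i \<le> CARD('n)"
    and ord: "\<And>i j. \<sigma> i < \<sigma> j \<Longrightarrow> (x $ i) \<bullet> e \<le> (x $ j) \<bullet> e \<and> (c $ i) \<bullet> e \<le> (c $ j) \<bullet> e"
  defines "\<beta> \<equiv> (1 - \<kappa>) / (1 + \<kappa>)"
  shows "action_potential_time m \<kappa> x c T \<le>
    ennreal (mass_norm_sq m (c - x) / T + ((\<Sum>i\<in>UNIV. m i * (real CARD('n))\<^sup>2) + (\<Sum>(i, j)\<in>{(i, j). i < j}. m i * m j))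
      * (2 * (T powr \<beta> / \<beta>)))"
proof -
  \<comment> \<open>The two singularities agree because 2 a - 2 = - 2 \<kappa> a = - p. They are
    integrable, p < 1, because \<kappa> < 1, and integrating them gives the exponent 1 - p =
    \<beta>.\<close>
  define a where "a = 1 / (1 + \<kappa>)"
  define p where "p = 2 * \<kappa> / (1 + \<kappa>)"
  have a: "0 < a" "a \<le> 1" using \<kappa> by (auto simp: a_def)
  have p: "p < 1" "1 - p = \<beta>" "2 * a - 2 = - p" "a * (- 2 * \<kappa>) = - p"
    using \<kappa> by (auto simp: p_def a_def \<beta>_def field_simps)
  define M1 where "M1 = (\<Sum>i\<in>UNIV. m i * (real CARD('n))\<^sup>2)"
  define M2 where "M2 = (\<Sum>(i, j)\<in>{(i, j). i < j}. m i * m j)"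
  have M: "0 \<le> M1" "0 \<le> M2"
    unfolding M1_def M2_def using m by (auto intro!: sum_nonneg simp: less_imp_le)
  define R :: "('a, 'n) vec" where "R = (\<chi> i. real (\<sigma> i) *\<^sub>R e)"
  have R: "mass_norm_sq m R \<le> M1"
    unfolding mass_norm_sq_def M1_def R_def using m \<sigma>(2) e
    by (intro sum_mono mult_left_mono power_mono) (auto simp: less_imp_le)
  define v where "v = (1 / T) *\<^sub>R (c - x)"
  define \<gamma> where "\<gamma> s = x + s *\<^sub>R v + bump a T s *\<^sub>R R" for s
  define J where "J s = s powr - p + (T - s) powr - p" for s
  define I where "I = 2 * (T powr \<beta> / \<beta>)"
  have I: "(\<integral>\<^sup>+s\<in>{0..T}. ennreal (J s) \<partial>lborel) = ennreal I" "0 \<le> I"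
    using nn_integral_singularities[OF p(1) T] p(1,2) \<kappa> by (simp_all add: J_def I_def \<beta>_def)
  have J0: "0 \<le> J s" for s by (simp add: J_def)
  have "absolutely_continuous_curve 0 T \<gamma>"
    unfolding \<gamma>_def by (rule absolutely_continuous_curve_bump[OF a T])
  moreover have "\<gamma> 0 = x" "\<gamma> T = c" using T by (simp_all add: \<gamma>_def bump_def v_def)
  ultimately have "\<gamma> \<in> curves x c T" by (simp add: curves_def)
  then have 0: "action_potential_time m \<kappa> x c T \<le> action m \<kappa> 0 T \<gamma>"
    unfolding action_potential_time_def by (rule INF_lower)
  have int: "(\<integral>\<^sup>+s\<in>{0..T}. ennreal (A + B * J s) \<partial>lborel) = ennreal (A * T + B * I)" if "0 \<le> A" "0 \<le> B" for A B
  proof -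
    have Jm: "J \<in> borel_measurable borel" unfolding J_def by measurable
    have "(\<integral>\<^sup>+s\<in>{0..T}. ennreal (A + B * J s) \<partial>lborel) =
        (\<integral>\<^sup>+s. ennreal A * indicator {0..T} s + ennreal B * (ennreal (J s) * indicator {0..T} s) \<partial>lborel)"
      using that J0 by (intro nn_integral_cong) (auto simp: indicator_def ennreal_plus ennreal_mult)
    also have "\<dots> = ennreal A * ennreal T + ennreal B * ennreal I"
      using Jm T by (subst nn_integral_add) (auto simp: nn_integral_cmult I(1) nn_integral_cmult_indicator)
    finally show ?thesis using that T I(2) by (simp add: ennreal_plus ennreal_mult)
  qed
  have kin: "kinetic m 0 T \<gamma> \<le> ennreal (2 * mass_norm_sq m v * T + 2 * M1 * I)"
  proof -
    have "mass_norm_sq m v \<ge> 0" using m by (auto simp: mass_norm_sq_def less_imp_le intro!: sum_nonneg)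
    have "kinetic m 0 T \<gamma> \<le> (\<integral>\<^sup>+s\<in>{0..T}. ennreal (2 * mass_norm_sq m v + 2 * M1 * J s) \<partial>lborel)"
      unfolding kinetic_def
    proof (rule nn_integral_mono_AE)
      \<comment> \<open>The kink of \<open>bump\<close> at T / 2 is a single point.\<close>
      have "AE s in lborel. s \<notin> {T / 2}" by (intro AE_not_in) (simp add: finite_imp_null_set_lborel)
      then show "AE s in lborel. ennreal (mass_norm_sq m (vector_derivative \<gamma> (at s))) * indicator {0<..<T} s \<le>
          ennreal (2 * mass_norm_sq m v + 2 * M1 * J s) * indicator {0..T} s"
      proof eventually_elim
        case (elim s)
        show ?case
        proof (cases "s \<in> {0<..<T}")
          case True
          with elim obtain D where D: "(bump a T has_real_derivative D) (at s)"
            "D\<^sup>2 \<le> a\<^sup>2 * (s powr (2 * a - 2) + (T - s) powr (2 * a - 2))"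
            using bump_has_derivative[of s T a] by auto
          have "a\<^sup>2 \<le> 1" using a by (simp add: power_le_one)
          then have "a\<^sup>2 * J s \<le> 1 * J s" using J0 by (intro mult_right_mono)
          then have DJ: "D\<^sup>2 \<le> J s" using D(2) unfolding p(3) J_def by simp
          have "(\<gamma> has_vector_derivative v + D *\<^sub>R R) (at s)"
            unfolding \<gamma>_def using D(1) by (auto intro!: derivative_eq_intros)
          then have "mass_norm_sq m (vector_derivative \<gamma> (at s)) = mass_norm_sq m (v + D *\<^sub>R R)"
            by (simp add: vector_derivative_at)
          also have "\<dots> \<le> 2 * mass_norm_sq m v + 2 * mass_norm_sq m (D *\<^sub>R R)"
            by (rule mass_norm_sq_add_le[OF m])
          also have "mass_norm_sq m (D *\<^sub>R R) \<le> J s * M1"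
            unfolding mass_norm_sq_scaleR
          proof (intro mult_mono DJ R J0)
            show "0 \<le> mass_norm_sq m R" using m by (auto simp: mass_norm_sq_def less_imp_le intro!: sum_nonneg)
          qed
          finally show ?thesis using True by (simp add: ennreal_leI mult.commute mult.left_commute)
        qed simp
      qed
    qed
    also have "\<dots> = ennreal (2 * mass_norm_sq m v * T + 2 * M1 * I)"
      using \<open>mass_norm_sq m v \<ge> 0\<close> M by (intro int) auto
    finally show ?thesis .
  qed
  have sep: "bump a T s \<le> norm (\<gamma> s $ i - \<gamma> s $ j)" if s: "0 < s" "s < T" and ij: "\<sigma> j < \<sigma> i" for s i j
  proof -
    have sT: "0 \<le> s / T" "s / T \<le> 1" using s by auto
    \<comment> \<open>Along \<open>e\<close> the segment preserves the common order of its ends, and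
      distinct ranks differ by at least 1, so the bump alone bounds the distance from below.\<close>
    have "(\<gamma> s $ i - \<gamma> s $ j) \<bullet> e = (1 - s / T) * ((x $ i) \<bullet> e - (x $ j) \<bullet> e) + (s / T) * ((c $ i) \<bullet> e - (c $ j) \<bullet> e)
        + bump a T s * (real (\<sigma> i) - real (\<sigma> j))"
      using e by (simp add: \<gamma>_def v_def R_def algebra_simps inner_diff_left inner_add_left
          flip: power2_norm_eq_inner)
    moreover have "0 \<le> (1 - s / T) * ((x $ i) \<bullet> e - (x $ j) \<bullet> e)" "0 \<le> (s / T) * ((c $ i) \<bullet> e - (c $ j) \<bullet> e)"
      using ord[OF ij] sT by (simp_all only: diff_ge_0_iff_ge mult_nonneg_nonneg)
    moreover have "bump a T s * 1 \<le> bump a T s * (real (\<sigma> i) - real (\<sigma> j))"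
      using ij by (intro mult_left_mono) (auto simp: bump_def)
    ultimately have "bump a T s \<le> (\<gamma> s $ i - \<gamma> s $ j) \<bullet> e" by linarith
    also have "\<dots> \<le> norm (\<gamma> s $ i - \<gamma> s $ j) * norm e" by (rule norm_cauchy_schwarz)
    finally show ?thesis using e by simp
  qed
  have pot: "potential_action m \<kappa> 0 T \<gamma> \<le> ennreal (M2 * I)"
  proof -
    have "potential m \<kappa> (\<gamma> s) \<le> ennreal (M2 * J s)" if s: "0 < s" "s < T" for s
    proof -
      have b: "0 < bump a T s" using s by (simp add: bump_def)
      have bJ: "bump a T s powr (- 2 * \<kappa>) \<le> J s"
      proof -
        have "bump a T s powr (- 2 * \<kappa>) = (min s (T - s)) powr - p"
          unfolding bump_def powr_powr p(4) ..
        also have "\<dots> \<le> J s" by (auto simp: J_def min_def)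
        finally show ?thesis .
      qed
      have pair: "(if \<gamma> s $ i = \<gamma> s $ j then \<infinity> else ennreal (m i * m j * norm (\<gamma> s $ i - \<gamma> s $ j) powr (- 2 * \<kappa>)))
          \<le> ennreal (m i * m j * J s)" if "i < j" for i j
      proof -
        have "\<sigma> i \<noteq> \<sigma> j" using \<sigma>(1) that by (auto dest: injD)
        then have n: "bump a T s \<le> norm (\<gamma> s $ i - \<gamma> s $ j)"
          using sep[OF s, of i j] sep[OF s, of j i] by (cases "\<sigma> i < \<sigma> j") (auto simp: norm_minus_commute)
        then have "norm (\<gamma> s $ i - \<gamma> s $ j) powr (- 2 * \<kappa>) \<le> bump a T s powr (- 2 * \<kappa>)"
          using b \<kappa> by (intro powr_mono2') auto
        with bJ have "norm (\<gamma> s $ i - \<gamma> s $ j) powr (- 2 * \<kappa>) \<le> J s" by linarith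
        then have "m i * m j * norm (\<gamma> s $ i - \<gamma> s $ j) powr (- 2 * \<kappa>) \<le> m i * m j * J s"
          using m by (intro mult_left_mono) (auto simp: less_imp_le)
        moreover have "\<gamma> s $ i \<noteq> \<gamma> s $ j" using n b by auto
        ultimately show ?thesis by (simp add: ennreal_leI)
      qed
      have "potential m \<kappa> (\<gamma> s) \<le> (\<Sum>(i, j)\<in>{(i, j). i < j}. ennreal (m i * m j * J s))"
        unfolding potential_def by (rule sum_mono) (use pair in auto)
      also have "\<dots> = (\<Sum>q\<in>{(i, j). i < j}. ennreal (m (fst q) * m (snd q) * J s))"
        by (simp add: case_prod_beta)
      also have "\<dots> = ennreal (\<Sum>q\<in>{(i, j). i < j}. m (fst q) * m (snd q) * J s)"
        using m J0 by (intro sum_ennreal) (auto simp: less_imp_le)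
      also have "(\<Sum>q\<in>{(i, j). i < j}. m (fst q) * m (snd q) * J s) = M2 * J s"
        by (simp add: M2_def sum_distrib_right case_prod_beta)
      finally show ?thesis .
    qed
    then have "potential_action m \<kappa> 0 T \<gamma> \<le> (\<integral>\<^sup>+s\<in>{0..T}. ennreal (0 + M2 * J s) \<partial>lborel)"
      unfolding potential_action_def by (intro nn_integral_mono) (auto simp: indicator_def)
    also have "\<dots> = ennreal (0 * T + M2 * I)" using M by (intro int) auto
    finally show ?thesis by simp
  qed
  have v: "mass_norm_sq m v * T = mass_norm_sq m (c - x) / T"
    using T by (simp add: v_def mass_norm_sq_scaleR power2_eq_square)
  have nn: "0 \<le> mass_norm_sq m v" using m by (auto simp: mass_norm_sq_def less_imp_le intro!: sum_nonneg)
  \<comment> \<open>The factor 2 from \<open>mass_norm_sq_add_le\<close> cancels the one half in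
    front of the kinetic energy.\<close>
  have half: "ennreal (2 * z) / 2 = ennreal z" if "0 \<le> z" for z
    using divide_ennreal[of "2 * z" 2] that by simp
  have "kinetic m 0 T \<gamma> / 2 \<le> ennreal (2 * (mass_norm_sq m v * T + M1 * I)) / 2"
    using kin by (intro divide_right_mono_ennreal) (simp add: distrib_left mult.assoc)
  also have "\<dots> = ennreal (mass_norm_sq m v * T + M1 * I)" using nn M I(2) T by (intro half) simp
  finally have "action m \<kappa> 0 T \<gamma> \<le> ennreal (mass_norm_sq m v * T + M1 * I) + ennreal (M2 * I)"
    unfolding action_eq using pot by (intro add_mono)
  also have "\<dots> = ennreal (mass_norm_sq m (c - x) / T + (M1 + M2) * I)"
    unfolding v[symmetric] using nn M I(2) T by (subst ennreal_plus[symmetric]) (auto simp: algebra_simps)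
  finally show ?thesis using 0 unfolding M1_def M2_def I_def by (rule order_trans[rotated])
qed

section \<open>Ordering the bodies along a direction\<close>

lemma ex_rank:
  fixes X :: "'n::{finite,linorder} \<Rightarrow> real"
  shows "\<exists>\<sigma> :: 'n \<Rightarrow> nat. inj \<sigma> \<and> (\<forall>i. \<sigma> i \<le> CARD('n)) \<and> (\<forall>i j. \<sigma> i < \<sigma> j \<longrightarrow> X i \<le> X j)"
proof -
  \<comment> \<open>Predecessors in the lexicographic order of (X i, i). Breaking ties by the index
    keeps the ranks distinct even when coordinates coincide.\<close>
  define P where "P i = {j. X j < X i \<or> (X j = X i \<and> j < i)}" for i
  have less: "card (P j) < card (P i)" if "X j < X i \<or> (X j = X i \<and> j < i)" for i j
    by (rule psubset_card_mono) (use that in \<open>auto simp: P_def\<close>)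
  have "inj (\<lambda>i. card (P i))"
  proof (rule injI)
    fix i j assume eq: "card (P i) = card (P j)"
    show "i = j"
    proof (rule ccontr)
      assume "i \<noteq> j"
      then show False using less[of i j] less[of j i] eq by (cases "X i = X j") (auto simp: neq_iff)
    qed
  qed
  moreover have "card (P i) \<le> CARD('n)" for i by (intro card_mono) auto
  moreover have "X i \<le> X j" if "card (P i) < card (P j)" for i j
    using less[of j i] that by (cases "X j < X i") auto
  ultimately show ?thesis by (intro exI[of _ "\<lambda>i. card (P i)"]) auto
qed

text \<open>Collapsing the intervals between corresponding coordinates of \<open>x\<close> and \<open>y\<close> yields a configuration
  whose order is compatible with both orders.\<close>

lemma ex_common_contraction:
  fixes X Y :: "'n::finite \<Rightarrow> real"
  shows "\<exists>F. mono F \<and> (\<forall>i. F (X i) = F (Y i)) \<and> (\<forall>t. \<bar>F t - t\<bar> \<le> (\<Sum>i\<in>UNIV. \<bar>X i - Y i\<bar>))"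
proof -
  define S where "S = (\<Union>i. {min (X i) (Y i)..max (X i) (Y i)})"
  have Sf: "S \<in> fmeasurable lborel" unfolding S_def
    by (intro fmeasurable.finite_UN) (auto intro: fmeasurable_compact)
  then have Sb: "S \<in> sets borel" by (simp add: fmeasurable_def)
  have Sm: "measure lborel S \<le> (\<Sum>i\<in>UNIV. \<bar>X i - Y i\<bar>)"
  proof -
    have "measure lborel S \<le> (\<Sum>i\<in>UNIV. measure lborel {min (X i) (Y i)..max (X i) (Y i)})"
      unfolding S_def by (rule measure_UNION_le) auto
    also have "\<dots> = (\<Sum>i\<in>UNIV. \<bar>X i - Y i\<bar>)" by (intro sum.cong) (auto simp: min_def max_def)
    finally show ?thesis .
  qed
  \<comment> \<open>\<open>F\<close> has slope 0 on \<open>S\<close> and 1 elsewhere. Hence it is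
    monotone, constant between \<open>X i\<close> and \<open>Y i\<close>, and displaces no point by
    more than the measure of \<open>S\<close>.\<close>
  define F where "F t = t - measure lborel (S \<inter> {..t})" for t
  have fm: "S \<inter> A \<in> fmeasurable lborel" if "A \<in> sets borel" for A
    using Sf that by (intro fmeasurable_Int_fmeasurable) auto
  have diff: "measure lborel (S \<inter> {..t}) - measure lborel (S \<inter> {..s}) = measure lborel (S \<inter> {s<..t})" if "s \<le> t" for s t
  proof -
    have "S \<inter> {..t} = (S \<inter> {..s}) \<union> (S \<inter> {s<..t})" using that by auto
    then have "measure lborel (S \<inter> {..t}) = measure lborel (S \<inter> {..s}) + measure lborel (S \<inter> {s<..t})"
      using fm by (simp only:) (intro measure_Union; auto simp: fmeasurableD2 Sb)
    then show ?thesis by simp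
  qed
  have "mono F"
  proof (rule monoI)
    fix s t :: real assume st: "s \<le> t"
    have "measure lborel (S \<inter> {s<..t}) \<le> measure lborel {s..t}"
      using fm by (intro measure_mono_fmeasurable) (auto simp: fmeasurable_compact Sb)
    then show "F s \<le> F t" using diff[OF st] st by (simp add: F_def)
  qed
  moreover have "F (X i) = F (Y i)" for i
  proof -
    let ?s = "min (X i) (Y i)" and ?t = "max (X i) (Y i)"
    have "{?s<..?t} \<subseteq> {?s..?t}" by auto
    also have "\<dots> \<subseteq> S" unfolding S_def by blast
    finally have "S \<inter> {?s<..?t} = {?s<..?t}" by blast
    then have "measure lborel (S \<inter> {?s<..?t}) = ?t - ?s" by simp
    moreover have "?s \<le> ?t" by (simp add: min_def max_def)
    ultimately have "F ?t = F ?s" using diff[of ?s ?t] by (simp add: F_def)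
    then show ?thesis by (auto simp: min_def max_def split: if_splits)
  qed
  moreover have "\<bar>F t - t\<bar> \<le> (\<Sum>i\<in>UNIV. \<bar>X i - Y i\<bar>)" for t
  proof -
    have "measure lborel (S \<inter> {..t}) \<le> measure lborel S"
      using fm Sf by (intro measure_mono_fmeasurable) (auto simp: Sb)
    then show ?thesis using Sm by (simp add: F_def)
  qed
  ultimately show ?thesis by blast
qed

text \<open>On a line, bodies can exchange their order only by colliding. The passage therefore goes
  through a configuration c whose order along e is weakly compatible with that of x and of y;
  collisions occur at most at the ends of the two halves. The distances to c, at most N d and (N +
  1) d componentwise, account for K.\<close>

lemma action_potential_time_le:
  fixes m :: "'n::{finite,linorder} \<Rightarrow> real"
  assumes m: "\<And>i. m i > 0" and \<kappa>: "0 < \<kappa>" "\<kappa> < 1"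
  shows "\<exists>K C. 0 \<le> K \<and> 0 \<le> C \<and> (\<forall>(x :: ('a::euclidean_space, 'n) vec) y T. 0 < T \<longrightarrow>
    action_potential_time m \<kappa> x y T \<le> ennreal (K * (norm (x - y))\<^sup>2 / T + C * T powr ((1 - \<kappa>) / (1 + \<kappa>))))"
proof -
  define \<beta> where "\<beta> = (1 - \<kappa>) / (1 + \<kappa>)"
  define N where "N = real CARD('n)"
  define M where "M = (\<Sum>i\<in>UNIV. m i)"
  define B where "B = ((\<Sum>i\<in>UNIV. m i * (real CARD('n))\<^sup>2) + (\<Sum>(i, j)\<in>{(i, j). i < j}. m i * m j)) * (2 / \<beta>)"
  define K where "K = 2 * (M * (N\<^sup>2 + (N + 1)\<^sup>2))"
  have \<beta>: "0 < \<beta>" using \<kappa> by (simp add: \<beta>_def)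
  have B: "0 \<le> B" unfolding B_def using m \<beta>
    by (intro mult_nonneg_nonneg add_nonneg_nonneg sum_nonneg) (auto simp: less_imp_le)
  have M: "0 \<le> M" unfolding M_def using m by (intro sum_nonneg) (auto simp: less_imp_le)
  have N: "0 \<le> N" by (simp add: N_def)
  have msq: "mass_norm_sq m v \<le> M * r\<^sup>2" if "\<And>i. norm (v $ i) \<le> r" for r and v :: "('a, 'n) vec"
    unfolding mass_norm_sq_def M_def sum_distrib_right using m that
    by (intro sum_mono mult_left_mono power_mono) (auto simp: less_imp_le)
  have main: "action_potential_time m \<kappa> x y T \<le> ennreal (K * (norm (x - y))\<^sup>2 / T + 2 * B * T powr \<beta>)"
    if T: "0 < T" for x y :: "('a, 'n) vec" and T
  proof -
    obtain e :: 'a where "e \<in> Basis" using nonempty_Basis by blast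
    then have e: "norm e = 1" by (rule norm_Basis)
    define d where "d = norm (x - y)"
    obtain F where F: "mono F" "\<And>i. F ((x $ i) \<bullet> e) = F ((y $ i) \<bullet> e)"
      "\<And>t. \<bar>F t - t\<bar> \<le> (\<Sum>i\<in>UNIV. \<bar>(x $ i) \<bullet> e - (y $ i) \<bullet> e\<bar>)"
      using ex_common_contraction[of "\<lambda>i. (x $ i) \<bullet> e" "\<lambda>i. (y $ i) \<bullet> e"] by blast
    have comp: "norm (x $ i - y $ i) \<le> d" for i
      using Finite_Cartesian_Product.norm_nth_le[of "x - y" i] by (simp add: d_def)
    have "(\<Sum>i\<in>UNIV. \<bar>(x $ i) \<bullet> e - (y $ i) \<bullet> e\<bar>) \<le> (\<Sum>i\<in>(UNIV :: 'n set). d)"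
    proof (rule sum_mono)
      fix i
      have "\<bar>(x $ i - y $ i) \<bullet> e\<bar> \<le> norm (x $ i - y $ i) * norm e" by (rule Cauchy_Schwarz_ineq2)
      then show "\<bar>(x $ i) \<bullet> e - (y $ i) \<bullet> e\<bar> \<le> d" using comp[of i] e by (simp add: inner_diff_left)
    qed
    then have Fd: "\<bar>F t - t\<bar> \<le> N * d" for t using F(3)[of t] by (simp add: N_def)
    \<comment> \<open>Only the component along \<open>e\<close> moves. Since \<open>F\<close>
      identifies the coordinates of \<open>x\<close> and \<open>y\<close> and is monotone, the order
      of \<open>c\<close> agrees weakly with both.\<close>
    define c :: "('a, 'n) vec" where "c = (\<chi> i. x $ i + (F ((x $ i) \<bullet> e) - (x $ i) \<bullet> e) *\<^sub>R e)"
    have ce: "(c $ i) \<bullet> e = F ((x $ i) \<bullet> e)" for i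
      using e by (simp add: c_def inner_add_left norm_eq_1)
    have cx: "norm ((c - x) $ i) \<le> N * d" for i using Fd[of "(x $ i) \<bullet> e"] e by (simp add: c_def)
    have yc: "norm ((y - c) $ i) \<le> (N + 1) * d" for i
      using cx[of i] comp[of i] norm_triangle_ineq4[of "y $ i - x $ i" "c $ i - x $ i"]
      by (simp add: distrib_right norm_minus_commute)
    have cxm: "mass_norm_sq m (c - x) \<le> M * (N * d)\<^sup>2" and ycm: "mass_norm_sq m (y - c) \<le> M * ((N + 1) * d)\<^sup>2"
      using cx yc by (auto intro!: msq)
    have T2: "0 < T / 2" using T by simp
    have Tb: "(T / 2) powr \<beta> \<le> T powr \<beta>" using T \<beta> by (intro powr_mono2) auto
    have bnd: "action_potential_time m \<kappa> z w (T / 2) \<le> ennreal (r / (T / 2) + B * T powr \<beta>)"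
      if "mass_norm_sq m (w - z) \<le> r" "inj \<sigma>" "\<And>i. \<sigma> i \<le> CARD('n)"
        "\<And>i j. \<sigma> i < \<sigma> j \<Longrightarrow> (z $ i) \<bullet> e \<le> (z $ j) \<bullet> e \<and> (w $ i) \<bullet> e \<le> (w $ j) \<bullet> e"
      for z w :: "('a, 'n) vec" and \<sigma> :: "'n \<Rightarrow> nat" and r
    proof -
      have "action_potential_time m \<kappa> z w (T / 2) \<le> ennreal (mass_norm_sq m (w - z) / (T / 2) + B * (T / 2) powr \<beta>)"
      proof -
        have eq: "S * (2 * ((T / 2) powr \<beta> / \<beta>)) = S * (2 / \<beta>) * (T / 2) powr \<beta>" for S by simp
        show ?thesis
          using action_potential_time_ordered_le[where m = m, OF m \<kappa> e T2 that(2-4)]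
          unfolding B_def \<beta>_def[symmetric] eq .
      qed
      also have "\<dots> \<le> ennreal (r / (T / 2) + B * T powr \<beta>)"
        using that(1) T2 Tb B by (intro ennreal_leI add_mono divide_right_mono mult_left_mono) auto
      finally show ?thesis .
    qed
    obtain \<sigma> :: "'n \<Rightarrow> nat" where \<sigma>: "inj \<sigma>" "\<And>i. \<sigma> i \<le> CARD('n)" "\<And>i j. \<sigma> i < \<sigma> j \<Longrightarrow> (x $ i) \<bullet> e \<le> (x $ j) \<bullet> e"
      using ex_rank[of "\<lambda>i. (x $ i) \<bullet> e"] by auto
    have 1: "action_potential_time m \<kappa> x c (T / 2) \<le> ennreal (M * (N * d)\<^sup>2 / (T / 2) + B * T powr \<beta>)"
      by (rule bnd[OF cxm \<sigma>(1,2)]) (use \<sigma>(3) F(1) in \<open>auto simp: ce monoD\<close>)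
    obtain \<tau> :: "'n \<Rightarrow> nat" where \<tau>: "inj \<tau>" "\<And>i. \<tau> i \<le> CARD('n)" "\<And>i j. \<tau> i < \<tau> j \<Longrightarrow> (y $ i) \<bullet> e \<le> (y $ j) \<bullet> e"
      using ex_rank[of "\<lambda>i. (y $ i) \<bullet> e"] by auto
    have 2: "action_potential_time m \<kappa> c y (T / 2) \<le> ennreal (M * ((N + 1) * d)\<^sup>2 / (T / 2) + B * T powr \<beta>)"
      by (rule bnd[OF ycm \<tau>(1,2)]) (use \<tau>(3) F(1) in \<open>auto simp: ce F(2) monoD\<close>)
    have "action_potential_time m \<kappa> x y (T / 2 + T / 2) \<le>
        action_potential_time m \<kappa> x c (T / 2) + action_potential_time m \<kappa> c y (T / 2)"
      using T by (intro action_potential_time_concat) auto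
    also have "\<dots> \<le> ennreal (M * (N * d)\<^sup>2 / (T / 2) + B * T powr \<beta>) + ennreal (M * ((N + 1) * d)\<^sup>2 / (T / 2) + B * T powr \<beta>)"
      using 1 2 by (intro add_mono)
    also have "\<dots> = ennreal ((M * (N * d)\<^sup>2 / (T / 2) + B * T powr \<beta>) + (M * ((N + 1) * d)\<^sup>2 / (T / 2) + B * T powr \<beta>))"
      using M B T by (subst ennreal_plus) auto
    also have "(M * (N * d)\<^sup>2 / (T / 2) + B * T powr \<beta>) + (M * ((N + 1) * d)\<^sup>2 / (T / 2) + B * T powr \<beta>) =
        K * d\<^sup>2 / T + 2 * B * T powr \<beta>"
      unfolding power_mult_distrib K_def using T by (simp add: field_simps)
    finally show ?thesis by (simp add: d_def)
  qed
  have "0 \<le> K" using M N by (simp add: K_def)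
  then show ?thesis using main B by (intro exI[of _ K] exI[of _ "2 * B"]) (auto simp: \<beta>_def)
qed

section \<open>Fixed points of coercive Lax--Oleinik semigroups\<close>

text \<open>For \<open>s\<close> fixed, \<open>escape_cost (t + s) - escape_cost t\<close> tends to \<open>0\<close> as \<open>t\<close> grows, so subtracting the value at
  the origin and passing to the lower limit turns the semigroup relation into a fixed point
  equation; coercivity keeps the minimisers in a bounded set.\<close>

locale action_functional =
  fixes P :: "'v::euclidean_space \<Rightarrow> 'v \<Rightarrow> real \<Rightarrow> ennreal" and K C \<beta> \<mu> :: real
  assumes concat: "\<And>x y z s t. 0 < s \<Longrightarrow> 0 < t \<Longrightarrow> P x z (s + t) \<le> P x y s + P y z t"
    and split: "\<And>x s t. 0 < s \<Longrightarrow> 0 < t \<Longrightarrow> (INF y. P x y s + (INF z. P y z t)) \<le> (INF z. P x z (s + t))"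
    and dilate: "\<And>x y c T. 1 \<le> c \<Longrightarrow> P x y (c * T) \<le> ennreal c * P x y T"
    and upper: "\<And>x y T. 0 < T \<Longrightarrow> P x y T \<le> ennreal (K * (norm (x - y))\<^sup>2 / T + C * T powr \<beta>)"
    and coercive: "\<And>x y T \<alpha>. 0 \<le> T \<Longrightarrow> ennreal (\<mu> * (2 * \<alpha> * norm (y - x) - \<alpha>\<^sup>2 * T)) \<le> P x y T"
    and constants: "0 \<le> K" "0 \<le> C" "0 < \<beta>" "\<beta> < 1" "0 < \<mu>"
begin

text \<open>\<open>enn2real\<close> would turn an infinite infimum into 0. For t > 0 this does not
  occur, because the end point z = x costs at most C t^\<beta>.\<close>

definition escape_cost :: "real \<Rightarrow> 'v \<Rightarrow> real" where
  "escape_cost t x = enn2real (INF z. P x z t)"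

lemma INF_eq_escape_cost:
  assumes "0 < t"
  shows "(INF z. P x z t) = ennreal (escape_cost t x)" "escape_cost t x \<le> C * t powr \<beta>"
proof -
  have le: "(INF z. P x z t) \<le> ennreal (C * t powr \<beta>)"
    using upper[OF assms, of x x] by (intro INF_lower2[of x]) auto
  show eq: "(INF z. P x z t) = ennreal (escape_cost t x)"
    unfolding escape_cost_def using le by (intro ennreal_enn2real[symmetric]) (auto intro: le_less_trans)
  show "escape_cost t x \<le> C * t powr \<beta>"
    using le constants unfolding eq by (subst (asm) ennreal_le_iff) auto
qed

lemma escape_cost_nonneg: "0 \<le> escape_cost t x"
  by (simp add: escape_cost_def)

lemma escape_cost_mono:
  assumes "0 < s" "0 < t"
  shows "escape_cost s x \<le> escape_cost (s + t) x"
proof -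
  have "(INF z. P x z s) \<le> (INF y. P x y s + (INF z. P y z t))"
    by (intro INF_mono[of UNIV]) (auto intro!: bexI[of _ _] add_increasing2)
  also note split[OF assms]
  finally show ?thesis
    using assms by (simp add: INF_eq_escape_cost escape_cost_nonneg)
qed

text \<open>Dilation by 1 + s / t leads from time t to t + s and costs at most s / t times the value
  at t, which is bounded by C t^\<beta>. The bound is uniform in x and tends to 0 as t grows, since
  \<beta> < 1.\<close>

lemma escape_cost_increment:
  assumes "0 < s" "0 < t"
  shows "escape_cost (t + s) x \<le> escape_cost t x + s * C * t powr (\<beta> - 1)"
proof -
  define c where "c = 1 + s / t"
  have c: "1 \<le> c" "c * t = t + s" using assms by (auto simp: c_def field_simps)
  have le: "(INF z. P x z (t + s)) \<le> ennreal c * P x z t" for z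
    using dilate[OF c(1), of x z t] unfolding c(2) by (rule INF_lower2[rotated]) simp
  have "ennreal (escape_cost (t + s) x) / ennreal c \<le> (INF z. P x z t)"
    using le c(1) assms by (intro INF_greatest divide_le_posI_ennreal) (auto simp: INF_eq_escape_cost mult.commute)
  then have "ennreal (escape_cost (t + s) x / c) \<le> ennreal (escape_cost t x)"
    using c(1) assms by (simp add: INF_eq_escape_cost divide_ennreal escape_cost_nonneg)
  then have "escape_cost (t + s) x / c \<le> escape_cost t x"
    by (simp add: escape_cost_nonneg)
  then have "escape_cost (t + s) x \<le> escape_cost t x * c"
    using c(1) by (simp add: pos_divide_le_eq)
  also have "\<dots> = escape_cost t x * (1 + s / t)" by (simp add: c_def)
  also have "\<dots> = escape_cost t x + s / t * escape_cost t x" by (simp add: algebra_simps)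
  also have "\<dots> \<le> escape_cost t x + s / t * (C * t powr \<beta>)"
    using INF_eq_escape_cost(2)[of t x] assms by (intro add_left_mono mult_left_mono) auto
  also have "s / t * (C * t powr \<beta>) = s * C * t powr (\<beta> - 1)"
    using assms by (simp add: powr_diff)
  finally show ?thesis .
qed

text \<open>Going to y first uses the time s + t, and monotonicity in time leads back to t. The
  constant b is the same for all t and thus survives the limit.\<close>

lemma escape_cost_dominated:
  assumes "0 < s" "0 < t" "P x y s \<le> ennreal b" "0 \<le> b"
  shows "escape_cost t x \<le> escape_cost t y + b"
proof -
  have "(INF z. P x z (s + t)) \<le> P x y s + P y z t" for z
    using concat[OF assms(1,2), of x z y] by (rule order_trans[OF INF_lower[OF UNIV_I]])
  then have "(INF z. P x z (s + t)) \<le> P x y s + (INF z. P y z t)"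
    using le_INF_add_INF[of "{()}" UNIV "INF z. P x z (s + t)" "\<lambda>_. P x y s" "\<lambda>z. P y z t"]
    by simp
  also have "\<dots> \<le> ennreal b + (INF z. P y z t)" using assms(3) by (intro add_right_mono)
  finally have "escape_cost (s + t) x \<le> b + escape_cost t y"
    using assms by (simp add: INF_eq_escape_cost escape_cost_nonneg flip: ennreal_plus)
  then show ?thesis using escape_cost_mono[OF assms(2,1), of x] by (simp add: add.commute)
qed

text \<open>The bound of \<open>upper\<close> as a function of the distance d with T at choice: a
  small T and then a smaller d make it arbitrarily small, while T = max 1 d makes it linear in d. It
  thus controls both continuity and growth.\<close>

definition modulus :: "real \<Rightarrow> real \<Rightarrow> real" where
  "modulus d T = K * d\<^sup>2 / T + C * T powr \<beta>"

lemma modulus_nonneg: "0 < T \<Longrightarrow> 0 \<le> modulus d T"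
  using constants by (simp add: modulus_def)

text \<open>Integer times suffice for a lower limit, and \<open>Suc n\<close> avoids time 0, at
  which \<open>upper\<close> gives nothing. Subtracting the value at the origin keeps the sequence
  bounded at every point.\<close>

definition normalized_cost :: "nat \<Rightarrow> 'v \<Rightarrow> real" where
  "normalized_cost n x = escape_cost (real (Suc n)) x - escape_cost (real (Suc n)) 0"

lemma normalized_cost_dominated:
  "0 < s \<Longrightarrow> P x y s \<le> ennreal b \<Longrightarrow> 0 \<le> b \<Longrightarrow> normalized_cost n x \<le> normalized_cost n y + b"
  unfolding normalized_cost_def using escape_cost_dominated[of s "real (Suc n)" x y b] by simp

lemma normalized_cost_modulus:
  "0 < T \<Longrightarrow> normalized_cost n x \<le> normalized_cost n y + modulus (norm (x - y)) T"
  using upper[of T x y] modulus_nonneg[of T "norm (x - y)"]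
  by (intro normalized_cost_dominated[of T]) (simp_all add: modulus_def)

lemma normalized_cost_bounds:
  "normalized_cost n x \<le> modulus (norm x) 1" "- modulus (norm x) 1 \<le> normalized_cost n x"
  using normalized_cost_modulus[of 1 n x 0] normalized_cost_modulus[of 1 n 0 x]
  by (simp_all add: normalized_cost_def)

text \<open>The lower limit is split into tail infima and their supremum. An inequality with an
  additive constant uniform in the index passes through both stages.\<close>

definition tail_inf :: "nat \<Rightarrow> 'v \<Rightarrow> real" where
  "tail_inf n x = (INF k. normalized_cost (n + k) x)"

definition weak_kam :: "'v \<Rightarrow> real" where
  "weak_kam x = (SUP n. tail_inf n x)"

lemma bdd_below_tail: "bdd_below (range (\<lambda>k. normalized_cost (n + k) x))"
  by (rule bdd_belowI[of _ "- modulus (norm x) 1"]) (auto intro: normalized_cost_bounds)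

lemma tail_inf_le: "n \<le> k \<Longrightarrow> tail_inf n x \<le> normalized_cost k x"
  unfolding tail_inf_def by (rule order_trans[OF cINF_lower[OF bdd_below_tail, of "k - n"]]) simp_all

lemma tail_inf_ge: "- modulus (norm x) 1 \<le> tail_inf n x"
  unfolding tail_inf_def by (rule cINF_greatest) (auto intro: normalized_cost_bounds)

lemma tail_inf_dominated:
  assumes "\<And>k. normalized_cost k x \<le> normalized_cost k y + b"
  shows "tail_inf n x \<le> tail_inf n y + b"
proof -
  have "tail_inf n x - b \<le> tail_inf n y"
    unfolding tail_inf_def[of n y]
  proof (rule cINF_greatest)
    fix k show "tail_inf n x - b \<le> normalized_cost (n + k) y"
      using tail_inf_le[of n "n + k" x] assms[of "n + k"] by simp
  qed simp
  then show ?thesis by simp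
qed

lemma bdd_above_tail_inf: "bdd_above (range (\<lambda>n. tail_inf n x))"
  by (rule bdd_aboveI[of _ "modulus (norm x) 1"])
    (auto intro: order_trans[OF tail_inf_le[OF order_refl] normalized_cost_bounds(1)])

lemma tail_inf_le_weak_kam: "tail_inf n x \<le> weak_kam x"
  unfolding weak_kam_def by (rule cSUP_upper[OF _ bdd_above_tail_inf]) simp

lemma tail_inf_tendsto: "(\<lambda>n. tail_inf n x) \<longlonglongrightarrow> weak_kam x"
  unfolding weak_kam_def
proof (rule LIMSEQ_incseq_SUP[OF bdd_above_tail_inf])
  show "incseq (\<lambda>n. tail_inf n x)"
  proof (rule incseq_SucI)
    fix n show "tail_inf n x \<le> tail_inf (Suc n) x"
      unfolding tail_inf_def[of "Suc n"] by (rule cINF_greatest) (auto intro: tail_inf_le)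
  qed
qed

lemma weak_kam_dominated:
  assumes "\<And>k. normalized_cost k x \<le> normalized_cost k y + b"
  shows "weak_kam x \<le> weak_kam y + b"
  unfolding weak_kam_def[of x]
proof (rule cSUP_least)
  fix n show "tail_inf n x \<le> weak_kam y + b"
    using tail_inf_dominated[OF assms, of n] tail_inf_le_weak_kam[of n y] by simp
qed simp

lemma weak_kam_le:
  assumes "0 < T"
  shows "ereal (weak_kam x) \<le> ereal (weak_kam y) + enn2ereal (P x y T)"
proof (cases "P x y T")
  case (real b)
  then have "weak_kam x \<le> weak_kam y + b"
    by (intro weak_kam_dominated normalized_cost_dominated[OF assms]) auto
  then show ?thesis using real by (simp add: enn2ereal_ennreal)
qed simp

section \<open>Exchange of infimum and lower limit\<close>

lemma approximate_minimizer:
  assumes s: "0 < s" and \<epsilon>: "0 < \<epsilon>"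
  shows "\<forall>\<^sub>F n in sequentially. \<exists>y q. P x y s = ennreal q \<and> 0 \<le> q \<and> q + tail_inf n y \<le> weak_kam x + 3 * \<epsilon>"
proof -
  have "((\<lambda>t. s * C * t powr (\<beta> - 1)) \<longlongrightarrow> s * C * 0) at_top"
    using constants by (intro tendsto_mult tendsto_const tendsto_neg_powr filterlim_ident) auto
  then have "\<forall>\<^sub>F t in at_top. s * C * t powr (\<beta> - 1) < \<epsilon>"
    by (rule order_tendstoD) (use \<epsilon> in simp)
  then obtain t0 where t0: "\<And>t. t0 \<le> t \<Longrightarrow> s * C * t powr (\<beta> - 1) < \<epsilon>"
    by (auto simp: eventually_at_top_linorder)
  obtain N where N: "t0 \<le> real N" using real_arch_simple by blast
  show ?thesis unfolding eventually_sequentially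
  proof (intro exI[of _ N] allI impI)
    fix n assume n: "N \<le> n"
    have "\<exists>k. normalized_cost (n + k) x < tail_inf n x + \<epsilon>"
    proof (rule ccontr)
      assume "\<not> ?thesis"
      then have "tail_inf n x + \<epsilon> \<le> tail_inf n x"
        unfolding tail_inf_def[of n] by (intro cINF_greatest) (auto simp: not_less)
      then show False using \<epsilon> by simp
    qed
    then obtain k where k: "n \<le> k" "normalized_cost k x < tail_inf n x + \<epsilon>" by (metis le_add1)
    let ?t = "real (Suc k)"
    have "(INF y. P x y s + (INF z. P y z ?t)) \<le> ennreal (escape_cost (s + ?t) x)"
      using split[OF s, of ?t x] s by (simp add: INF_eq_escape_cost)
    also have "\<dots> < ennreal (escape_cost (s + ?t) x + \<epsilon>)"
      using \<epsilon> escape_cost_nonneg by (simp add: ennreal_less_iff)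
    finally obtain y where y: "P x y s + ennreal (escape_cost ?t y) < ennreal (escape_cost (s + ?t) x + \<epsilon>)"
      by (auto simp: INF_less_iff INF_eq_escape_cost)
    then have "P x y s \<noteq> \<infinity>" by auto
    then obtain q where q: "P x y s = ennreal q" "0 \<le> q" by (cases "P x y s") auto
    have "q + escape_cost ?t y < escape_cost (s + ?t) x + \<epsilon>"
      using y q escape_cost_nonneg \<epsilon> by (simp add: ennreal_less_iff flip: ennreal_plus)
    moreover have "escape_cost (s + ?t) x \<le> escape_cost ?t x + \<epsilon>"
      using escape_cost_increment[OF s, of ?t x] t0[of ?t] N n k(1) by (simp add: add.commute)
    \<comment> \<open>One \<epsilon> comes from the choice of \<open>y\<close>, one from the
      increment in time; the third, below, comes from the choice of \<open>k\<close> near the tail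
      infimum.\<close>
    ultimately have "q + normalized_cost k y \<le> normalized_cost k x + 2 * \<epsilon>"
      by (simp add: normalized_cost_def)
    then have "q + tail_inf n y \<le> weak_kam x + 3 * \<epsilon>"
      using k(2) tail_inf_le[OF k(1), of y] tail_inf_le_weak_kam[of n x] by linarith
    then show "\<exists>y q. P x y s = ennreal q \<and> 0 \<le> q \<and> q + tail_inf n y \<le> weak_kam x + 3 * \<epsilon>"
      using q by blast
  qed
qed

text \<open>The cost of reaching y grows with |y - x| faster than \<open>tail_inf n y\<close> can
  decrease, uniformly in n.\<close>

lemma approximate_minimizer_bounded:
  assumes s: "0 < s"
  shows "\<exists>R. \<forall>y q n. P x y s = ennreal q \<longrightarrow> 0 \<le> q \<longrightarrow> q + tail_inf n y \<le> M \<longrightarrow> dist x y \<le> R"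
proof -
  \<comment> \<open>Makes the cost grow with slope K + C + 1, exceeding by 1 the slope K + C of the
    linear bound on \<open>tail_inf\<close> derived below.\<close>
  define \<alpha> where "\<alpha> = (K + C + 1) / (2 * \<mu>)"
  have \<alpha>: "2 * \<mu> * \<alpha> = K + C + 1" using constants by (simp add: \<alpha>_def)
  have "norm (y - x) \<le> M + modulus (norm x) 1 + C + \<mu> * \<alpha>\<^sup>2 * s"
    if q: "P x y s = ennreal q" "0 \<le> q" "q + tail_inf n y \<le> M" for y q n
  proof -
    let ?d = "norm (y - x)"
    \<comment> \<open>Allowing a time equal to the distance for far points makes the modulus linear;
      the lower bound 1 keeps the time positive.\<close>
    let ?T = "max 1 ?d"
    have "\<mu> * (2 * \<alpha> * ?d - \<alpha>\<^sup>2 * s) \<le> q"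
      using coercive[of s \<alpha> y x] s q by (simp add: ennreal_le_iff2) linarith
    then have "(K + C + 1) * ?d - \<mu> * \<alpha>\<^sup>2 * s \<le> q" unfolding \<alpha>[symmetric] by (simp add: algebra_simps)
    moreover have "tail_inf n x \<le> tail_inf n y + modulus (norm (x - y)) ?T"
      by (intro tail_inf_dominated normalized_cost_modulus) simp
    moreover have "modulus (norm (x - y)) ?T \<le> K * ?d + C * (1 + ?d)"
    proof -
      have "?d\<^sup>2 / ?T \<le> ?d" by (cases "1 \<le> ?d") (auto simp: max_def power2_eq_square mult_left_le)
      then have 1: "K * (?d\<^sup>2 / ?T) \<le> K * ?d" using constants by (intro mult_left_mono)
      have "?T powr \<beta> \<le> ?T powr 1" using constants by (intro powr_mono) auto
      also have "\<dots> \<le> 1 + ?d" by simp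
      finally have "C * ?T powr \<beta> \<le> C * (1 + ?d)" using constants by (intro mult_left_mono)
      with 1 show ?thesis by (simp add: modulus_def norm_minus_commute)
    qed
    ultimately show ?thesis using q(3) tail_inf_ge[of x n] by (simp add: algebra_simps)
  qed
  then show ?thesis
    by (intro exI[of _ "M + modulus (norm x) 1 + C + \<mu> * \<alpha>\<^sup>2 * s"]) (auto simp: dist_norm norm_minus_commute)
qed

text \<open>The near-minimisers y_n vary with n, while closeness of \<open>tail_inf\<close> to
  \<open>weak_kam\<close> is available at a fixed point only; so they are compared with a limit
  point z. The witness is one of the y_n and not z, because no semicontinuity of P in its end point
  is assumed. Of the six \<epsilon>, three come from \<open>approximate_minimizer\<close>, two from
  passing between y_n and z, one from the tail at z.\<close>

lemma weak_kam_attained: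
  assumes s: "0 < s" and \<epsilon>: "0 < \<epsilon>"
  shows "\<exists>y q. P x y s = ennreal q \<and> 0 \<le> q \<and> weak_kam y + q \<le> weak_kam x + 6 * \<epsilon>"
proof -
  from approximate_minimizer[OF s \<epsilon>, of x] obtain N where
    "\<And>n. N \<le> n \<Longrightarrow> \<exists>y q. P x y s = ennreal q \<and> 0 \<le> q \<and> q + tail_inf n y \<le> weak_kam x + 3 * \<epsilon>"
    by (auto simp: eventually_sequentially)
  then have "\<exists>y q. P x y s = ennreal q \<and> 0 \<le> q \<and> q + tail_inf (N + n) y \<le> weak_kam x + 3 * \<epsilon>" for n
    by simp
  then obtain y q where yq: "\<And>n. P x (y n) s = ennreal (q n)" "\<And>n. 0 \<le> q n"
    "\<And>n. q n + tail_inf (N + n) (y n) \<le> weak_kam x + 3 * \<epsilon>"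
    by metis
  obtain R where R: "\<And>n. dist x (y n) \<le> R"
    using approximate_minimizer_bounded[OF s, of x "weak_kam x + 3 * \<epsilon>"] yq by metis
  have "compact (cball x R)" "\<forall>n. y n \<in> cball x R" using R by auto
  then obtain z r where zr: "strict_mono r" "(y \<circ> r) \<longlonglongrightarrow> z"
    unfolding compact_def by blast
  \<comment> \<open>The time is fixed first, so that C T^\<beta> \<le> \<epsilon> / 2, and the
    distance to z is then made small relative to it. The 1 in C + 1 covers C = 0.\<close>
  define T where "T = (\<epsilon> / (2 * (C + 1))) powr (1 / \<beta>)"
  have "0 < T" using \<epsilon> constants by (simp add: T_def add_nonneg_pos)
  have T\<beta>: "T powr \<beta> = \<epsilon> / (2 * (C + 1))" using \<epsilon> constants by (simp add: T_def powr_powr)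
  have "C * T powr \<beta> \<le> (C + 1) * T powr \<beta>" by (intro mult_right_mono) auto
  also have "\<dots> = (C + 1) * (\<epsilon> / (2 * (C + 1)))" by (simp only: T\<beta>)
  also have "\<dots> = \<epsilon> / 2" using constants by (simp add: field_simps)
  finally have CT: "C * T powr \<beta> \<le> \<epsilon> / 2" .
  have "((\<lambda>j. K * (norm (y (r j) - z))\<^sup>2 / T) \<longlongrightarrow> K * (norm (z - z))\<^sup>2 / T) sequentially"
    using zr(2) \<open>0 < T\<close> by (intro tendsto_intros) (auto simp: o_def)
  then have "\<forall>\<^sub>F j in sequentially. K * (norm (y (r j) - z))\<^sup>2 / T < \<epsilon> / 2"
    by (rule order_tendstoD) (use \<epsilon> in simp)
  moreover have "\<forall>\<^sub>F j in sequentially. weak_kam z - \<epsilon> < tail_inf (N + r j) z"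
  proof -
    have "\<forall>\<^sub>F n in sequentially. weak_kam z - \<epsilon> < tail_inf n z"
      using tail_inf_tendsto[of z] by (rule order_tendstoD) (use \<epsilon> in simp)
    then obtain n0 where n0: "\<And>n. n0 \<le> n \<Longrightarrow> weak_kam z - \<epsilon> < tail_inf n z"
      by (auto simp: eventually_sequentially)
    show ?thesis unfolding eventually_sequentially
      by (intro exI[of _ n0] allI impI n0) (use seq_suble[OF zr(1)] in \<open>auto intro: order_trans trans_le_add2\<close>)
  qed
  ultimately obtain j where j: "K * (norm (y (r j) - z))\<^sup>2 / T < \<epsilon> / 2" "weak_kam z - \<epsilon> < tail_inf (N + r j) z"
    by (metis (mono_tags, lifting) eventually_conj eventually_happens trivial_limit_sequentially)
  let ?y = "y (r j)"
  have mod: "modulus (norm (?y - z)) T \<le> \<epsilon>" "modulus (norm (z - ?y)) T \<le> \<epsilon>"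
    using j(1) CT unfolding modulus_def norm_minus_commute[of z] by linarith+
  have "weak_kam ?y \<le> weak_kam z + modulus (norm (?y - z)) T"
    by (intro weak_kam_dominated normalized_cost_modulus \<open>0 < T\<close>)
  moreover have "tail_inf (N + r j) z \<le> tail_inf (N + r j) ?y + modulus (norm (z - ?y)) T"
    by (intro tail_inf_dominated normalized_cost_modulus \<open>0 < T\<close>)
  ultimately have "weak_kam ?y + q (r j) \<le> weak_kam x + 6 * \<epsilon>"
    using yq(3)[of "r j"] mod j(2) by linarith
  then show ?thesis using yq(1,2) by blast
qed

lemma weak_kam_fixed_point:
  assumes t: "0 < t"
  shows "ereal (weak_kam x) = (INF y. ereal (weak_kam y) + enn2ereal (P x y t))"
proof (rule antisym)
  show "ereal (weak_kam x) \<le> (INF y. ereal (weak_kam y) + enn2ereal (P x y t))"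
    by (intro INF_greatest weak_kam_le[OF t])
  show "(INF y. ereal (weak_kam y) + enn2ereal (P x y t)) \<le> ereal (weak_kam x)"
  proof (rule ereal_le_epsilon2)
    fix e :: real assume "0 < e"
    then obtain y q where "P x y t = ennreal q" "0 \<le> q" "weak_kam y + q \<le> weak_kam x + e"
      using weak_kam_attained[OF t, of "e / 6" x] by auto
    then show "(INF y. ereal (weak_kam y) + enn2ereal (P x y t)) \<le> ereal (weak_kam x) + ereal e"
      by (intro INF_lower2[of y]) (auto simp: enn2ereal_ennreal)
  qed
qed

text \<open>The function is built from free-end infima alone, and the constants subtracted at the
  origin are the same for x and y. A symmetry that moves the origin is therefore harmless.\<close>

lemma weak_kam_invariant:
  assumes "\<And>t. 0 < t \<Longrightarrow> (INF z. P x z t) = (INF z. P y z t)"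
  shows "weak_kam x = weak_kam y"
proof -
  have "normalized_cost n x = normalized_cost n y" for n
    using assms[of "real (Suc n)"] by (simp add: normalized_cost_def escape_cost_def)
  then show ?thesis by (simp add: weak_kam_def tail_inf_def)
qed

end

section \<open>Invariant weak KAM solutions\<close>

lemma INF_action_potential_time_isometry:
  fixes m :: "'n::{finite,linorder} \<Rightarrow> real" and x :: "('a::euclidean_space, 'n) vec" and A :: "'a \<Rightarrow> 'a"
  assumes A: "orthogonal_transformation A"
  shows "(INF z. action_potential_time m \<kappa> (\<chi> i. A (x $ i) + r) z t) = (INF z. action_potential_time m \<kappa> x z t)"
proof -
  have le: "(INF z. action_potential_time m \<kappa> (\<chi> i. A (x $ i) + r) z t) \<le> (INF z. action_potential_time m \<kappa> x z t)"
    if A: "orthogonal_transformation A" for A :: "'a \<Rightarrow> 'a" and x :: "('a, 'n) vec" and r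
  proof (rule INF_greatest)
    fix z
    show "(INF z. action_potential_time m \<kappa> (\<chi> i. A (x $ i) + r) z t) \<le> action_potential_time m \<kappa> x z t"
      unfolding action_potential_time_def[of m \<kappa> x z]
    proof (rule INF_greatest)
      fix \<gamma> assume "\<gamma> \<in> curves x z t"
      then have g: "absolutely_continuous_curve 0 t \<gamma>" "\<gamma> 0 = x" "\<gamma> t = z" by (auto simp: curves_def)
      let ?\<eta> = "\<lambda>s. \<chi> i. A (\<gamma> s $ i) + r"
      have "?\<eta> \<in> curves (\<chi> i. A (x $ i) + r) (\<chi> i. A (z $ i) + r) t"
        using absolutely_continuous_curve_isometry(1)[OF A g(1), of r] g by (simp add: curves_def)
      then have "action_potential_time m \<kappa> (\<chi> i. A (x $ i) + r) (\<chi> i. A (z $ i) + r) t \<le> action m \<kappa> 0 t ?\<eta>"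
        unfolding action_potential_time_def by (rule INF_lower)
      also have "\<dots> = action m \<kappa> 0 t \<gamma>" by (rule absolutely_continuous_curve_isometry(2)[OF A g(1)])
      finally show "(INF z. action_potential_time m \<kappa> (\<chi> i. A (x $ i) + r) z t) \<le> action m \<kappa> 0 t \<gamma>"
        by (rule order_trans[OF INF_lower[OF UNIV_I]])
    qed
  qed
  have lin: "linear (inv A)" and A': "orthogonal_transformation (inv A)"
    using orthogonal_transformation_inv[OF A] by (auto simp: orthogonal_transformation_def)
  \<comment> \<open>The inverse motion has the same form, with translation part - A^(-1) r, so the
    inequality applied twice gives equality.\<close>
  have "inv A (A v + r) + - inv A r = v" for v
    using orthogonal_transformation_inj[OF A] by (simp add: linear_add[OF lin])
  then have "x = (\<chi> i. inv A ((\<chi> i. A (x $ i) + r) $ i) + - inv A r)" by (simp add: vec_eq_iff)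
  then show ?thesis
    using le[OF A, of x r] le[OF A', of "\<chi> i. A (x $ i) + r" "- inv A r"] by (simp add: order_antisym)
qed

theorem theorem3:
  fixes m :: "'n::{finite,linorder} \<Rightarrow> real" and \<kappa> :: real
  assumes "CARD('n) \<ge> 2"
    and "\<And>i. m i > 0"
    and "0 < \<kappa>" and "\<kappa> < 1"
  shows "\<exists>u :: ('a::euclidean_space, 'n) vec \<Rightarrow> real.
    invariant u \<and> dominated m \<kappa> u \<and>
    (\<forall>t\<ge>0. \<forall>x. ereal (u x) = lax_oleinik m \<kappa> t u x)"
proof -
  define P where "P = (action_potential_time m \<kappa> :: ('a, 'n) vec \<Rightarrow> _)"
  define \<beta> where "\<beta> = (1 - \<kappa>) / (1 + \<kappa>)"
  have \<beta>: "0 < \<beta>" "\<beta> < 1" using assms(3,4) by (auto simp: \<beta>_def)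
  obtain K C where KC: "0 \<le> K" "0 \<le> C"
    "\<And>x y T. 0 < T \<Longrightarrow> P x y T \<le> ennreal (K * (norm (x - y))\<^sup>2 / T + C * T powr \<beta>)"
    using action_potential_time_le[where m = m and ?'a = 'a, OF assms(2-4)] unfolding P_def \<beta>_def by blast
  obtain \<mu> where \<mu>: "0 < \<mu>"
    "\<And>x y T \<alpha>. 0 \<le> T \<Longrightarrow> ennreal (\<mu> * (2 * \<alpha> * norm (y - x) - \<alpha>\<^sup>2 * T)) \<le> P x y T"
    using ex_coercivity_constant[where m = m and \<kappa> = \<kappa> and ?'a = 'a, OF assms(2)] unfolding P_def by blast
  interpret action_functional P K C \<beta> \<mu>
  proof
    fix x y z :: "('a, 'n) vec" and s t :: real
    assume st: "0 < s" "0 < t"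
    then show "P x z (s + t) \<le> P x y s + P y z t"
      unfolding P_def by (intro action_potential_time_concat) auto
    show "(INF y. P x y s + (INF z. P y z t)) \<le> (INF z. P x z (s + t))"
    proof (rule INF_greatest)
      fix z
      show "(INF y. P x y s + (INF z. P y z t)) \<le> P x z (s + t)"
        unfolding P_def action_potential_time_def[of m \<kappa> x z]
      proof (rule INF_greatest)
        fix \<gamma> assume "\<gamma> \<in> curves x z (s + t)"
        from curves_split[OF this, of m \<kappa>] st
        have "P x (\<gamma> s) s + P (\<gamma> s) z t \<le> action m \<kappa> 0 (s + t) \<gamma>" unfolding P_def by simp
        moreover have "P x (\<gamma> s) s + (INF z. P (\<gamma> s) z t) \<le> P x (\<gamma> s) s + P (\<gamma> s) z t"
          by (intro add_left_mono INF_lower) simp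
        ultimately have "P x (\<gamma> s) s + (INF z. P (\<gamma> s) z t) \<le> action m \<kappa> 0 (s + t) \<gamma>"
          by (rule order_trans[rotated])
        then show "(INF y. action_potential_time m \<kappa> x y s + (INF z. action_potential_time m \<kappa> y z t)) \<le> action m \<kappa> 0 (s + t) \<gamma>"
          unfolding P_def by (rule INF_lower2[OF UNIV_I])
      qed
    qed
  qed (use KC \<mu> \<beta> in \<open>auto simp: P_def intro: action_potential_time_dilate\<close>)
  have "invariant weak_kam"
    unfolding invariant_def
  proof (intro allI impI)
    fix x :: "('a, 'n) vec" and r and A :: "'a \<Rightarrow> 'a"
    assume "orthogonal_transformation A"
    then show "weak_kam x = weak_kam (\<chi> i. A (x $ i) + r)"
      by (intro weak_kam_invariant) (simp add: P_def INF_action_potential_time_isometry)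
  qed
  moreover have "dominated m \<kappa> weak_kam"
    unfolding dominated_def
  proof (intro allI)
    fix x y
    \<comment> \<open>\<open>ennreal\<close> replaces a negative difference by 0, which is
      admissible because the action potential is nonnegative.\<close>
    have "ennreal (weak_kam x - weak_kam y) \<le> action_potential m \<kappa> x y"
      unfolding action_potential_def
    proof (rule INF_greatest)
      fix T :: real assume "T \<in> {0<..}"
      then have "ereal (weak_kam x) \<le> ereal (weak_kam y) + enn2ereal (P x y T)" by (intro weak_kam_le) simp
      then show "ennreal (weak_kam x - weak_kam y) \<le> action_potential_time m \<kappa> x y T"
        unfolding P_def by (cases "action_potential_time m \<kappa> x y T") (auto simp: enn2ereal_ennreal intro: ennreal_leI)
    qed
    then have "ereal (max 0 (weak_kam x - weak_kam y)) \<le> enn2ereal (action_potential m \<kappa> x y)"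
      unfolding less_eq_ennreal.rep_eq ennreal.rep_eq by (simp add: zero_ereal_def[symmetric])
    then show "ereal (weak_kam x - weak_kam y) \<le> enn2ereal (action_potential m \<kappa> x y)"
      by (rule order_trans[rotated]) simp
  qed
  moreover have "ereal (weak_kam x) = lax_oleinik m \<kappa> t weak_kam x" if "0 \<le> t" for t x
    using weak_kam_fixed_point[of t x] that by (simp add: lax_oleinik_def P_def)
  ultimately show ?thesis by blast
qed

end
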